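(* Let $p$ be a prime, $n\ge1$, let $\mu$ be a Federer measure on a Besicovitch metric space $X$, $\mathcal{L}$ an affine subspace of $\mathbb{Q}_p^n$, and let $\mathbf{f}:X\to\mathcal{L}$ be a continuous map such that $(\mathbf{f},\mu)$ is good and nonplanar in $\mathcal{L}$. Then $$w(\mathbf{f}_*\mu)=w(\mathcal{L})=\inf\{w(\mathbf{y}):\mathbf{y}\in\mathcal{L}\}=\inf\{w(\mathbf{f}(x)):x\in\operatorname{supp}\mu\}.$$
   Context: For $\mathbf{y}\in\mathbb{Q}_p^n$, $w(\mathbf{y})$ is the supremum of $v>0$ such that there are infinitely many $\tilde{\mathbf{q}}=(q_0,\mathbf{q})\in\mathbb{Z}\times\mathbb{Z}^n$ with $|q_0+\mathbf{q}\cdot\mathbf{y}|_p\le\|\tilde{\mathbf{q}}\|_\infty^{-v}$, where $\|\cdot\|_\infty$ is the maximum of real absolute values of the coordinates. For a Borel measure $\nu$ on $\mathbb{Q}_p^n$, $w(\nu)=\sup\{v:\nu(\{\mathbf{y}:w(\mathbf{y})>v\})>0\}$. $w(\mathcal{L})$ is the exponent of the pushforward of Haar measure on $\mathbb{Q}_p^s$, $s=\dim\mathcal{L}$, under an affine isomorphism $\mathbb{Q}_p^s\to\mathcal{L}$. A metric space $X$ is Besicovitch if there is a constant $N_X$ such that for any bounded subset $E$ of $X$ and any family $\mathcal{B}$ of nonempty open balls such that every $x\in E$ is a center of some ball of $\mathcal{B}$, there is a finite or countable subfamily $\{B_i\}$ of $\mathcal{B}$ with $1_E\le\sum_i1_{B_i}\le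 N_X$. Measures $\mu$ on $X$ are nonzero Radon measures. $\mu$ is $D$-Federer on an open set $U$ with $\mu(U)>0$ if $\sup\{\mu(B(x,3r))/\mu(B(x,r)) : x\in\operatorname{supp}\mu,\ r>0,\ B(x,3r)\subset U\}<D$. $\mu$ is Federer if for $\mu$-a.e. $x\in X$ there are a neighbourhood $U$ of $x$ and $D>0$ such that $\mu$ is $D$-Federer on $U$. For $C,\alpha>0$, a Borel function $f:U\to\mathbb{Q}_p$ ($U\subset X$) is $(C,\alpha)$-good on $U$ with respect to $\mu$ if for any open ball $B\subset U$ centered in $\operatorname{supp}\mu$ and any $\varepsilon>0$, $$\mu(\{x\in B:|f(x)|_p<\varepsilon\})\le C\left(\frac{\varepsilon}{\|f\|_{\mu,B}}\right)^{\alpha}\mu(B),\qquad \|f\|_{\mu,B}=\sup\{c:\mu(\{x\in B:|f(x)|_p>c\})>0\}.$$ For $\mathbf{f}=(f_1,\dots,f_n):X\to\mathbb{Q}_p^n$, the pair $(\mathbf{f},\mu)$ is good if for $\mu$-a.e. $x\in X$ there are a neighbourhood $V$ of $x$ and $C,\alpha>0$ such that every $\mathbb{Q}_p$-linear combination of $1,f_1,\dots,f_n$ is $(C,\alpha)$-good on $V$ with respect to $\mu$. The affine span $\langle M\rangle_a$ of $M\subset\mathbb{Q}_p^n$ is the intersection of all affine subspaces containing $M$. $(\mathbf{f},\mu)$ is nonplanar in $\mathcal{L}$ if $\mathcal{L}=\langle\mathbf{f}(B\cap\operatorname{supp}\mu)\rangle_a$ for all nonempty open $B\subset X$ with $\mu(B)>0$.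 *)

theory Defs
  imports "HOL-Analysis.Analysis" "HOL-Computational_Algebra.Primes"
begin

section \<open>The \<open>p\<close>-adic absolute value on the rationals\<close>

definition padic_abs :: "nat \<Rightarrow> rat \<Rightarrow> real" where
  "padic_abs p q =
     (if q = 0 then 0
      else real p powi (int (multiplicity (int p) (snd (quotient_of q)))
                        - int (multiplicity (int p) (fst (quotient_of q)))))"

lemma padic_abs_0 [simp]: "padic_abs p 0 = 0"
  by (simp add: padic_abs_def)

lemma padic_abs_quotient:
  assumes p: "prime p" and "a \<noteq> 0" "b \<noteq> 0"
  shows "padic_abs p (of_int a / of_int b)
           = real p powi (int (multiplicity (int p) b) - int (multiplicity (int p) a))"
proof -
  define q :: rat where "q = of_int a / of_int b"
  obtain c d where cd: "quotient_of q = (c, d)" by fastforce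
  have d: "d > 0" using quotient_of_denom_pos cd by blast
  have q: "q = of_int c / of_int d" using quotient_of_div cd by blast
  have q0: "q \<noteq> 0" using assms by (simp add: q_def)
  then have c: "c \<noteq> 0" using q by auto
  have "(of_int (a * d) :: rat) = of_int (c * b)"
    using q q_def assms d by (simp add: field_simps)
  then have eq: "a * d = c * b" by (simp only: of_int_eq_iff)
  have pr: "prime_elem (int p)" using p by simp
  have "multiplicity (int p) a + multiplicity (int p) d
          = multiplicity (int p) c + multiplicity (int p) b"
    using eq prime_elem_multiplicity_mult_distrib[OF pr] assms c d
    by (metis less_irrefl)
  then have "int (multiplicity (int p) d) - int (multiplicity (int p) c)
          = int (multiplicity (int p) b) - int (multiplicity (int p) a)" by linarith
  then show ?thesis using q0 cd by (simp add: padic_abs_def flip: q_def)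
qed

lemma rat_quotientE:
  obtains a b where "(q :: rat) = of_int a / of_int b" "b \<noteq> 0"
  by (metis Fract_of_int_quotient Rat_cases less_irrefl)

lemma padic_abs_pos: "prime p \<Longrightarrow> q \<noteq> 0 \<Longrightarrow> padic_abs p q > 0"
  by (simp add: padic_abs_def prime_gt_0_nat zero_less_power_int)

lemma padic_abs_nonneg [simp]: "padic_abs p q \<ge> 0"
  by (simp add: padic_abs_def)

lemma padic_abs_eq_0 [simp]: "prime p \<Longrightarrow> padic_abs p q = 0 \<longleftrightarrow> q = 0"
  using padic_abs_pos[of p q] by (metis less_irrefl padic_abs_0)

lemma padic_abs_1 [simp]: "padic_abs p 1 = 1"
  by (simp add: padic_abs_def)

lemma padic_abs_mult:
  assumes p: "prime p"
  shows "padic_abs p (x * y) = padic_abs p x * padic_abs p y"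
proof (cases "x = 0 \<or> y = 0")
  case False
  obtain a b where x: "x = of_int a / of_int b" "b \<noteq> 0" by (rule rat_quotientE)
  obtain c d where y: "y = of_int c / of_int d" "d \<noteq> 0" by (rule rat_quotientE)
  have nz: "a \<noteq> 0" "c \<noteq> 0" using False x y by auto
  have xy: "x * y = of_int (a * c) / of_int (b * d)" using x y by simp
  have pr: "prime_elem (int p)" using p by simp
  have "real p \<noteq> 0" using p prime_gt_0_nat by force
  then have pw: "real p powi (int k + int l - (int m + int n))
      = real p powi (int k - int m) * real p powi (int l - int n)" for k l m n :: nat
    by (subst power_int_add[symmetric]) (simp_all add: algebra_simps)
  show ?thesis
    unfolding xy unfolding x y
    using padic_abs_quotient[OF p, of "a * c" "b * d"] padic_abs_quotient[OF p, of a b]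
      padic_abs_quotient[OF p, of c d] nz x(2) y(2)
    by (simp add: prime_elem_multiplicity_mult_distrib[OF pr] pw)
qed auto

lemma padic_abs_minus [simp]: "padic_abs p (- x) = padic_abs p x"
proof -
  have "multiplicity (int p) (- a) = multiplicity (int p) a" for a :: int
    by (rule multiplicity_cong) simp
  then show ?thesis by (simp add: padic_abs_def rat_uminus_code Let_def split: prod.splits)
qed

lemma padic_abs_commute: "padic_abs p (x - y) = padic_abs p (y - x)"
  using padic_abs_minus[of p "x - y"] by simp

lemma padic_abs_ultra:
  assumes p: "prime p"
  shows "padic_abs p (x + y) \<le> max (padic_abs p x) (padic_abs p y)"
proof (cases "x = 0 \<or> y = 0 \<or> x + y = 0")
  case True
  then show ?thesis by (auto simp: le_max_iff_disj)
next
  case False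
  obtain a b where x: "x = of_int a / of_int b" "b \<noteq> 0" by (rule rat_quotientE)
  obtain c d where y: "y = of_int c / of_int d" "d \<noteq> 0" by (rule rat_quotientE)
  define a' c' e where "a' = a * d" and "c' = c * b" and "e = b * d"
  have e: "e \<noteq> 0" using x y by (simp add: e_def)
  have x': "x = of_int a' / of_int e" and y': "y = of_int c' / of_int e"
    using x y by (simp_all add: a'_def c'_def e_def)
  have xy': "x + y = of_int (a' + c') / of_int e"
    by (simp add: x' y' add_divide_distrib)
  have nz: "a' \<noteq> 0" "c' \<noteq> 0" "a' + c' \<noteq> 0" using False x' y' xy' by auto
  let ?m = "multiplicity (int p)"
  have "int p ^ min (?m a') (?m c') dvd a' + c'"
    by (intro dvd_add) (simp_all add: multiplicity_dvd')
  then have "min (?m a') (?m c') \<le> ?m (a' + c')"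
    using nz p by (intro multiplicity_geI) (auto simp: prime_nat_iff)
  moreover have "1 \<le> real p" using p prime_ge_1_nat by force
  ultimately show ?thesis
    unfolding xy' unfolding x' y'
    using nz e by (auto simp: padic_abs_quotient[OF p] le_max_iff_disj min_def
        simp del: of_int_add split: if_splits intro!: power_int_increasing)
qed

lemma padic_abs_triangle: "prime p \<Longrightarrow> padic_abs p (x + y) \<le> padic_abs p x + padic_abs p y"
  using padic_abs_ultra[of p x y] padic_abs_nonneg[of p x] padic_abs_nonneg[of p y] by linarith

lemma padic_abs_reverse_triangle:
  assumes "prime p"
  shows "\<bar>padic_abs p x - padic_abs p y\<bar> \<le> padic_abs p (x - y)"
  using padic_abs_triangle[OF assms, of "x - y" y] padic_abs_triangle[OF assms, of "y - x" x]
    padic_abs_commute[of p x y] by auto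

lemma padic_abs_inverse: 
  assumes "prime p"
  shows "padic_abs p (inverse x) = inverse (padic_abs p x)"
proof (cases "x = 0")
  case False
  then have "padic_abs p (inverse x) * padic_abs p x = 1"
    by (simp flip: padic_abs_mult[OF assms])
  then show ?thesis by (metis inverse_unique mult.commute)
qed simp


section \<open>The field of \<open>p\<close>-adic numbers\<close>

text \<open>
  The prime \<open>p\<close> is carried by a type parameter of prime cardinality, so that
  \<open>'p padic\<close> is the field $\mathbb{Q}_p$ with \<open>p = CARD('p)\<close>. It is the completion of the
  rationals with respect to \<open>padic_abs p\<close>, i.e. Cauchy sequences modulo null sequences.
\<close>

class prime_card = finite +
  assumes prime_card: "prime CARD('a)"

definition padic_null :: "nat \<Rightarrow> (nat \<Rightarrow> rat) \<Rightarrow> bool" where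
  "padic_null p X \<longleftrightarrow> (\<lambda>n. padic_abs p (X n)) \<longlonglongrightarrow> 0"

definition padic_cauchy :: "nat \<Rightarrow> (nat \<Rightarrow> rat) \<Rightarrow> bool" where
  "padic_cauchy p X \<longleftrightarrow> (\<forall>e>0. \<exists>N. \<forall>m\<ge>N. \<forall>n\<ge>N. padic_abs p (X m - X n) < e)"

lemma padic_cauchy_const [simp]: "padic_cauchy p (\<lambda>_. c)"
  by (simp add: padic_cauchy_def)

lemma padic_null_0 [simp]: "padic_null p (\<lambda>_. 0)"
  by (simp add: padic_null_def)

lemma padic_null_const [simp]: "prime p \<Longrightarrow> padic_null p (\<lambda>_. c) \<longleftrightarrow> c = 0"
  by (simp add: padic_null_def LIMSEQ_const_iff)

lemma padic_null_minus: "padic_null p X \<Longrightarrow> padic_null p (\<lambda>n. - X n)"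
  by (simp add: padic_null_def)

lemma padic_null_add:
  assumes "prime p" "padic_null p X" "padic_null p Y"
  shows "padic_null p (\<lambda>n. X n + Y n)"
  unfolding padic_null_def
proof (rule tendsto_sandwich[OF _ _ tendsto_const])
  show "(\<lambda>n. padic_abs p (X n) + padic_abs p (Y n)) \<longlonglongrightarrow> 0"
    using tendsto_add[OF assms(2,3)[unfolded padic_null_def]] by simp
qed (auto intro: padic_abs_triangle[OF assms(1)] always_eventually)

lemma padic_cauchy_minus: "padic_cauchy p X \<Longrightarrow> padic_cauchy p (\<lambda>n. - X n)"
  unfolding padic_cauchy_def by (metis minus_diff_minus padic_abs_minus)

lemma padic_cauchy_add:
  assumes p: "prime p" and X: "padic_cauchy p X" and Y: "padic_cauchy p Y"
  shows "padic_cauchy p (\<lambda>n. X n + Y n)"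
  unfolding padic_cauchy_def
proof (intro allI impI)
  fix e :: real assume e: "e > 0"
  obtain M where M: "\<And>m n. m \<ge> M \<Longrightarrow> n \<ge> M \<Longrightarrow> padic_abs p (X m - X n) < e"
    using X e unfolding padic_cauchy_def by blast
  obtain N where N: "\<And>m n. m \<ge> N \<Longrightarrow> n \<ge> N \<Longrightarrow> padic_abs p (Y m - Y n) < e"
    using Y e unfolding padic_cauchy_def by blast
  have "padic_abs p ((X m + Y m) - (X n + Y n)) < e" if "m \<ge> max M N" "n \<ge> max M N" for m n
    using padic_abs_ultra[OF p, of "X m - X n" "Y m - Y n"] M[of m n] N[of m n] that
    by (simp add: algebra_simps)
  then show "\<exists>N. \<forall>m\<ge>N. \<forall>n\<ge>N. padic_abs p ((X m + Y m) - (X n + Y n)) < e" by blast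
qed

lemma padic_cauchy_convergent_abs:
  assumes p: "prime p" and X: "padic_cauchy p X"
  shows "convergent (\<lambda>n. padic_abs p (X n))"
proof -
  have "Cauchy (\<lambda>n. padic_abs p (X n))"
    unfolding Cauchy_def dist_real_def
    using X padic_abs_reverse_triangle[OF p] unfolding padic_cauchy_def
    by (meson le_less_trans)
  then show ?thesis by (simp add: Cauchy_convergent_iff)
qed

lemma padic_cauchy_bounded:
  assumes p: "prime p" and X: "padic_cauchy p X"
  obtains B where "B > 0" "\<And>n. padic_abs p (X n) \<le> B"
proof -
  have "Bseq (\<lambda>n. padic_abs p (X n))"
    using padic_cauchy_convergent_abs[OF assms] convergent_imp_Bseq by blast
  then show ?thesis using that unfolding Bseq_def by (auto simp: abs_of_nonneg)
qed

lemma padic_null_mult: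
  assumes p: "prime p" and X: "padic_cauchy p X" and Y: "padic_null p Y"
  shows "padic_null p (\<lambda>n. X n * Y n)"
proof -
  obtain B where B: "B > 0" "\<And>n. padic_abs p (X n) \<le> B" using padic_cauchy_bounded[OF p X] by blast
  have "(\<lambda>n. B * padic_abs p (Y n)) \<longlonglongrightarrow> 0"
    using tendsto_mult_right_zero[OF Y[unfolded padic_null_def]] by blast
  then show ?thesis unfolding padic_null_def
    by (rule Lim_null_comparison[rotated]) (auto simp: padic_abs_mult[OF p] B mult_right_mono)
qed

lemma padic_cauchy_mult:
  assumes p: "prime p" and X: "padic_cauchy p X" and Y: "padic_cauchy p Y"
  shows "padic_cauchy p (\<lambda>n. X n * Y n)"
  unfolding padic_cauchy_def
proof (intro allI impI)
  fix e :: real assume e: "e > 0"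
  obtain A where A: "A > 0" "\<And>n. padic_abs p (X n) \<le> A" using padic_cauchy_bounded[OF p X] by blast
  obtain B where B: "B > 0" "\<And>n. padic_abs p (Y n) \<le> B" using padic_cauchy_bounded[OF p Y] by blast
  obtain M where M: "\<And>m n. m \<ge> M \<Longrightarrow> n \<ge> M \<Longrightarrow> padic_abs p (X m - X n) < e / B"
    using X e B(1) unfolding padic_cauchy_def by (meson divide_pos_pos)
  obtain N where N: "\<And>m n. m \<ge> N \<Longrightarrow> n \<ge> N \<Longrightarrow> padic_abs p (Y m - Y n) < e / A"
    using Y e A(1) unfolding padic_cauchy_def by (meson divide_pos_pos)
  have "padic_abs p (X m * Y m - X n * Y n) < e" if mn: "m \<ge> max M N" "n \<ge> max M N" for m n
  proof -
    have "padic_abs p (X m * (Y m - Y n)) \<le> A * padic_abs p (Y m - Y n)"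
      by (simp add: padic_abs_mult[OF p] A mult_right_mono)
    also have "\<dots> < e" using N[of m n] mn A(1) by (simp add: field_simps)
    finally have 1: "padic_abs p (X m * (Y m - Y n)) < e" .
    have "padic_abs p ((X m - X n) * Y n) \<le> padic_abs p (X m - X n) * B"
      by (simp add: padic_abs_mult[OF p] B mult_left_mono)
    also have "\<dots> < e" using M[of m n] mn B(1) by (simp add: field_simps)
    finally have 2: "padic_abs p ((X m - X n) * Y n) < e" .
    show ?thesis
      using padic_abs_ultra[OF p, of "X m * (Y m - Y n)" "(X m - X n) * Y n"] 1 2
      by (simp add: algebra_simps)
  qed
  then show "\<exists>N. \<forall>m\<ge>N. \<forall>n\<ge>N. padic_abs p (X m * Y m - X n * Y n) < e" by blast
qed

lemma padic_cauchy_not_null: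
  assumes p: "prime p" and X: "padic_cauchy p X" and nz: "\<not> padic_null p X"
  obtains b N where "b > 0" "\<And>n. n \<ge> N \<Longrightarrow> padic_abs p (X n) > b"
proof -
  obtain l where l: "(\<lambda>n. padic_abs p (X n)) \<longlonglongrightarrow> l"
    using padic_cauchy_convergent_abs[OF p X] unfolding convergent_def by blast
  have "l \<ge> 0" by (rule LIMSEQ_le_const[OF l]) auto
  moreover have "l \<noteq> 0" using nz l unfolding padic_null_def by auto
  ultimately have l0: "l > 0" by simp
  then have "eventually (\<lambda>n. padic_abs p (X n) > l / 2) sequentially"
    by (intro order_tendstoD(1)[OF l]) simp
  then show ?thesis using that[of "l / 2"] l0 unfolding eventually_sequentially by auto
qed

lemma padic_cauchy_inverse:
  assumes p: "prime p" and X: "padic_cauchy p X" and nz: "\<not> padic_null p X"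
  shows "padic_cauchy p (\<lambda>n. inverse (X n))"
  unfolding padic_cauchy_def
proof (intro allI impI)
  fix e :: real assume e: "e > 0"
  obtain b M where b: "b > 0" "\<And>n. n \<ge> M \<Longrightarrow> padic_abs p (X n) > b"
    using padic_cauchy_not_null[OF p X nz] by blast
  obtain N where N: "\<And>m n. m \<ge> N \<Longrightarrow> n \<ge> N \<Longrightarrow> padic_abs p (X m - X n) < e * (b * b)"
    using X e b(1) unfolding padic_cauchy_def by (metis mult_pos_pos)
  have "padic_abs p (inverse (X m) - inverse (X n)) < e"
    if mn: "m \<ge> max M N" "n \<ge> max M N" for m n
  proof -
    have bm: "padic_abs p (X m) > b" and bn: "padic_abs p (X n) > b" using b(2) mn by auto
    then have nz: "X m \<noteq> 0" "X n \<noteq> 0" using b(1) by auto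
    have "inverse (X m) - inverse (X n) = - (inverse (X m) * (X m - X n) * inverse (X n))"
      by (rule inverse_diff_inverse[OF nz])
    then have eq: "padic_abs p (inverse (X m) - inverse (X n))
        = padic_abs p (X m - X n) / (padic_abs p (X m) * padic_abs p (X n))"
      by (simp add: padic_abs_mult[OF p] padic_abs_inverse[OF p] divide_inverse mult_ac)
    have bb: "b * b < padic_abs p (X m) * padic_abs p (X n)"
      using bm bn b(1) by (intro mult_strict_mono) auto
    have "padic_abs p (X m - X n) < e * (b * b)" using N mn by auto
    also have "\<dots> < e * (padic_abs p (X m) * padic_abs p (X n))" using bb e by simp
    finally show ?thesis unfolding eq
      using bb b(1) by (subst pos_divide_less_eq) (auto intro: less_trans[OF mult_pos_pos[OF b(1) b(1)]])
  qed
  then show "\<exists>N. \<forall>m\<ge>N. \<forall>n\<ge>N. padic_abs p (inverse (X m) - inverse (X n)) < e" by blast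
qed

typedef (overloaded) 'p padic_seq = "{X. padic_cauchy CARD('p::prime_card) X}"
  by (auto intro: padic_cauchy_const)

setup_lifting type_definition_padic_seq

instantiation padic_seq :: (prime_card) comm_ring_1
begin

lift_definition zero_padic_seq :: "'a padic_seq" is "\<lambda>_. 0" by simp

lift_definition one_padic_seq :: "'a padic_seq" is "\<lambda>_. 1" by simp

lift_definition plus_padic_seq :: "'a padic_seq \<Rightarrow> 'a padic_seq \<Rightarrow> 'a padic_seq"
  is "\<lambda>X Y n. X n + Y n" by (rule padic_cauchy_add[OF prime_card])

lift_definition minus_padic_seq :: "'a padic_seq \<Rightarrow> 'a padic_seq \<Rightarrow> 'a padic_seq"
  is "\<lambda>X Y n. X n - Y n"
  using padic_cauchy_add[OF prime_card _ padic_cauchy_minus] by fastforce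

lift_definition uminus_padic_seq :: "'a padic_seq \<Rightarrow> 'a padic_seq" is "\<lambda>X n. - X n"
  by (rule padic_cauchy_minus)

lift_definition times_padic_seq :: "'a padic_seq \<Rightarrow> 'a padic_seq \<Rightarrow> 'a padic_seq"
  is "\<lambda>X Y n. X n * Y n" by (rule padic_cauchy_mult[OF prime_card])

instance
  by (standard; transfer) (auto simp: algebra_simps fun_eq_iff)

end

lift_definition null_seq :: "'p::prime_card padic_seq \<Rightarrow> bool" is "padic_null CARD('p)" .

lift_definition inverse_seq :: "'p::prime_card padic_seq \<Rightarrow> 'p padic_seq"
  is "\<lambda>X. if padic_null CARD('p) X then (\<lambda>_. 0) else (\<lambda>n. inverse (X n))"
  by (auto intro: padic_cauchy_inverse prime_card)

lemma null_seq_0 [simp]: "null_seq 0"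
  by transfer simp

lemma not_null_seq_1 [simp]: "\<not> null_seq 1"
  by transfer (simp add: prime_card)

lemma null_seq_add: "null_seq X \<Longrightarrow> null_seq Y \<Longrightarrow> null_seq (X + Y)"
  by transfer (rule padic_null_add[OF prime_card])

lemma null_seq_minus: "null_seq X \<Longrightarrow> null_seq (- X)"
  by transfer (rule padic_null_minus)

lemma null_seq_mult: "null_seq Y \<Longrightarrow> null_seq (X * Y)"
  by transfer (rule padic_null_mult[OF prime_card])

lemma null_seq_diff_cong: "null_seq (X - Y) \<Longrightarrow> null_seq X \<longleftrightarrow> null_seq Y"
  using null_seq_add[of "X - Y" Y] null_seq_add[of X "- (X - Y)"] null_seq_minus[of "X - Y"] by auto

lemma null_seq_inverse:
  assumes "\<not> null_seq X"
  shows "null_seq (inverse_seq X * X - 1)"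
  using assms
proof transfer
  fix X :: "nat \<Rightarrow> rat"
  assume c: "padic_cauchy CARD('a) X" and nn: "\<not> padic_null CARD('a) X"
  obtain b M where b: "b > 0" "\<And>n. n \<ge> M \<Longrightarrow> padic_abs CARD('a) (X n) > b"
    using padic_cauchy_not_null[OF prime_card c nn] by blast
  have "inverse (X n) * X n - 1 = 0" if "n \<ge> M" for n
    using b(1) b(2)[OF that] by (cases "X n = 0") auto
  then have "eventually (\<lambda>n. padic_abs CARD('a) (inverse (X n) * X n - 1) = 0) sequentially"
    unfolding eventually_sequentially by (metis padic_abs_0)
  then have "padic_null CARD('a) (\<lambda>n. inverse (X n) * X n - 1)"
    unfolding padic_null_def by (rule tendsto_eventually)
  then show "padic_null CARD('a)
      (\<lambda>n. (if padic_null CARD('a) X then \<lambda>_. 0 else (\<lambda>n. inverse (X n))) n * X n - 1)"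
    using nn by simp
qed

lemma inverse_seq_cong:
  fixes X Y :: "'p::prime_card padic_seq"
  assumes "null_seq (X - Y)"
  shows "null_seq (inverse_seq X - inverse_seq Y)"
proof (cases "null_seq X")
  case True
  moreover have "null_seq Y" using True null_seq_diff_cong[OF assms] by simp
  ultimately show ?thesis by transfer simp
next
  case False
  let ?I = "inverse_seq X" and ?J = "inverse_seq Y"
  have Y: "\<not> null_seq Y" using False null_seq_diff_cong[OF assms] by simp
  have "?I - ?J = ?J * (?I * X - 1) + - (?I * (?J * Y - 1)) + - ((?I * ?J) * (X - Y))"
    by (simp add: algebra_simps)
  then show ?thesis
    using null_seq_inverse[OF False] null_seq_inverse[OF Y] assms
    by (metis null_seq_add null_seq_minus null_seq_mult)
qed

quotient_type (overloaded) 'p padic = "'p::prime_card padic_seq" / "\<lambda>X Y. null_seq (X - Y)"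
proof (rule equivpI)
  show "reflp (\<lambda>X Y :: 'p padic_seq. null_seq (X - Y))" by (simp add: reflp_def)
  show "symp (\<lambda>X Y :: 'p padic_seq. null_seq (X - Y))"
    unfolding symp_def using null_seq_minus by (metis minus_diff_eq)
  show "transp (\<lambda>X Y :: 'p padic_seq. null_seq (X - Y))"
    unfolding transp_def using null_seq_add by (metis diff_add_cancel add_diff_eq)
qed

instantiation padic :: (prime_card) field
begin

lift_definition zero_padic :: "'a padic" is 0 .

lift_definition one_padic :: "'a padic" is 1 .

lift_definition plus_padic :: "'a padic \<Rightarrow> 'a padic \<Rightarrow> 'a padic" is "(+)"
  by (metis add_diff_add null_seq_add)

lift_definition uminus_padic :: "'a padic \<Rightarrow> 'a padic" is uminus
  by (metis minus_diff_minus null_seq_minus)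

lift_definition minus_padic :: "'a padic \<Rightarrow> 'a padic \<Rightarrow> 'a padic" is "(-)"
proof -
  fix X X' Y Y' :: "'a padic_seq"
  assume "null_seq (X - X')" "null_seq (Y - Y')"
  from null_seq_add[OF this(1) null_seq_minus[OF this(2)]]
  show "null_seq (X - Y - (X' - Y'))" by (simp add: algebra_simps)
qed

lift_definition times_padic :: "'a padic \<Rightarrow> 'a padic \<Rightarrow> 'a padic" is "(*)"
proof -
  fix X X' Y Y' :: "'a padic_seq"
  assume "null_seq (X - X')" "null_seq (Y - Y')"
  from null_seq_add[OF null_seq_mult[OF this(2), of X] null_seq_mult[OF this(1), of Y']]
  show "null_seq (X * Y - X' * Y')" by (simp add: algebra_simps)
qed

lift_definition inverse_padic :: "'a padic \<Rightarrow> 'a padic" is inverse_seq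
  by (rule inverse_seq_cong)

definition divide_padic :: "'a padic \<Rightarrow> 'a padic \<Rightarrow> 'a padic" where
  "divide_padic x y = x * inverse y"

instance
proof
  fix x y z :: "'a padic"
  show "x + y + z = x + (y + z)" by transfer (simp add: algebra_simps)
  show "x + y = y + x" by transfer (simp add: algebra_simps)
  show "0 + x = x" by transfer simp
  show "- x + x = 0" by transfer simp
  show "x - y = x + - y" by transfer simp
  show "x * y * z = x * (y * z)" by transfer (simp add: algebra_simps)
  show "x * y = y * x" by transfer (simp add: algebra_simps)
  show "1 * x = x" by transfer simp
  show "(x + y) * z = x * z + y * z" by transfer (simp add: algebra_simps)
  show "(0 :: 'a padic) \<noteq> 1" 
    by transfer (metis diff_0 minus_minus not_null_seq_1 null_seq_minus)
  show "x div y = x * inverse y" by (rule divide_padic_def)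
  show "inverse (0 :: 'a padic) = 0"
    by transfer (transfer, simp)
  show "x \<noteq> 0 \<Longrightarrow> inverse x * x = 1"
    by transfer (simp add: null_seq_inverse)
qed

end

lift_definition seq_norm :: "'p::prime_card padic_seq \<Rightarrow> real"
  is "\<lambda>X. lim (\<lambda>n. padic_abs CARD('p) (X n))" .

lemma seq_norm_tendsto:
  "(\<lambda>n. padic_abs CARD('p) (Rep_padic_seq X n)) \<longlonglongrightarrow> seq_norm (X :: 'p::prime_card padic_seq)"
  by transfer (metis convergent_LIMSEQ_iff padic_cauchy_convergent_abs prime_card)

lemma null_seq_iff: "null_seq X \<longleftrightarrow> seq_norm X = 0"
  using seq_norm_tendsto[of X]
  by (metis LIMSEQ_unique null_seq.rep_eq padic_null_def)

lemma seq_norm_nonneg: "seq_norm X \<ge> 0"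
  by (rule LIMSEQ_le_const[OF seq_norm_tendsto]) auto

lemma seq_norm_minus: "seq_norm (- X) = seq_norm X"
  by transfer simp

lemma seq_norm_mult: "seq_norm (X * Y) = seq_norm X * seq_norm Y"
proof (rule LIMSEQ_unique[OF seq_norm_tendsto])
  show "(\<lambda>n. padic_abs CARD('a) (Rep_padic_seq (X * Y) n)) \<longlonglongrightarrow> seq_norm X * seq_norm Y"
    using tendsto_mult[OF seq_norm_tendsto[of X] seq_norm_tendsto[of Y]]
    by (simp add: times_padic_seq.rep_eq padic_abs_mult[OF prime_card])
qed

lemma seq_norm_ultra: "seq_norm (X + Y) \<le> max (seq_norm X) (seq_norm Y)"
proof (rule LIMSEQ_le[OF seq_norm_tendsto tendsto_max[OF seq_norm_tendsto[of X] seq_norm_tendsto[of Y]]])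
  show "\<exists>N. \<forall>n\<ge>N. padic_abs CARD('a) (Rep_padic_seq (X + Y) n)
    \<le> max (padic_abs CARD('a) (Rep_padic_seq X n)) (padic_abs CARD('a) (Rep_padic_seq Y n))"
    by (simp add: plus_padic_seq.rep_eq padic_abs_ultra[OF prime_card])
qed

lemma seq_norm_cong:
  assumes "null_seq (X - Y)"
  shows "seq_norm X = seq_norm Y"
  using seq_norm_ultra[of "X - Y" Y] seq_norm_ultra[of X "- (X - Y)"] seq_norm_minus[of "X - Y"]
    seq_norm_nonneg[of X] seq_norm_nonneg[of Y] assms by (simp add: null_seq_iff)

text \<open>The absolute value $|x|_p$, normalised by $|p|_p = 1/p$.\<close>

lift_definition padic_norm :: "'p::prime_card padic \<Rightarrow> real" is seq_norm
  by (rule seq_norm_cong)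

lemma padic_norm_eq_0 [simp]: "padic_norm x = 0 \<longleftrightarrow> x = 0"
  by transfer (simp add: null_seq_iff)

lemma padic_norm_nonneg [simp]: "padic_norm x \<ge> 0"
  by transfer (rule seq_norm_nonneg)

lemma padic_norm_minus [simp]: "padic_norm (- x) = padic_norm x"
  by transfer (rule seq_norm_minus)

lemma padic_norm_minus_commute: "padic_norm (x - y) = padic_norm (y - x)"
  using padic_norm_minus[of "x - y"] by simp

lemma padic_norm_mult: "padic_norm (x * y) = padic_norm x * padic_norm y"
  by transfer (rule seq_norm_mult)

lemma padic_norm_ultra: "padic_norm (x + y) \<le> max (padic_norm x) (padic_norm y)"
  by transfer (rule seq_norm_ultra)

instantiation padic :: (prime_card) metric_space
begin

definition dist_padic :: "'a padic \<Rightarrow> 'a padic \<Rightarrow> real" where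
  "dist_padic x y = padic_norm (x - y)"

definition uniformity_padic :: "('a padic \<times> 'a padic) filter" where
  "uniformity_padic = (INF e\<in>{0<..}. principal {(x, y). padic_norm (x - y) < e})"

definition open_padic :: "'a padic set \<Rightarrow> bool" where
  "open_padic U \<longleftrightarrow> (\<forall>x\<in>U. eventually (\<lambda>(x', y). x' = x \<longrightarrow> y \<in> U) uniformity)"

instance
proof
  fix x y z :: "'a padic"
  show "dist x y \<le> dist x z + dist y z"
    using padic_norm_ultra[of "x - z" "z - y", simplified] padic_norm_minus_commute[of z y]
      padic_norm_nonneg[of "x - z"] padic_norm_nonneg[of "y - z"]
    unfolding dist_padic_def by linarith
qed (simp_all add: dist_padic_def uniformity_padic_def open_padic_def)

end

lemma padic_of_nat: "(of_nat n :: 'p::prime_card padic) = abs_padic (of_nat n)"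
  by (induction n) (simp_all add: zero_padic_def one_padic_def plus_padic.abs_eq)

lemma Rep_padic_seq_of_nat: "Rep_padic_seq (of_nat n) = (\<lambda>_. of_nat n)"
  by (induction n) (simp_all add: zero_padic_seq.rep_eq one_padic_seq.rep_eq plus_padic_seq.rep_eq)

lemma padic_norm_of_nat: "padic_norm (of_nat n :: 'p::prime_card padic) = padic_abs CARD('p) (of_nat n)"
  by (simp add: padic_of_nat padic_norm.abs_eq seq_norm.rep_eq Rep_padic_seq_of_nat)

instance padic :: (prime_card) field_char_0
proof
  show "inj (of_nat :: nat \<Rightarrow> 'a padic)"
  proof (rule injI)
    fix m n :: nat assume "(of_nat m :: 'a padic) = of_nat n"
    then have *: "of_nat (nat \<bar>int m - int n\<bar>) = (0 :: 'a padic)"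
      by (cases "m \<le> n") (auto simp: of_nat_diff nat_diff_distrib)
    then have "padic_abs CARD('a) (of_nat (nat \<bar>int m - int n\<bar>)) = 0"
      by (metis padic_norm_of_nat padic_norm_eq_0)
    then show "m = n" by (simp add: prime_card)
  qed
qed

lemma padic_norm_divide: "padic_norm (x / y) = padic_norm x / padic_norm y"
proof (cases "y = 0")
  case True
  then show ?thesis by (metis div_by_0 padic_norm_eq_0)
next
  case False
  then have "padic_norm (x / y) * padic_norm y = padic_norm x"
    by (simp flip: padic_norm_mult)
  then show ?thesis using False by (simp add: field_simps)
qed

lemma padic_norm_of_rat: "padic_norm (of_rat q :: 'p::prime_card padic) = padic_abs CARD('p) q"
proof -
  have int: "padic_norm (of_int a :: 'p padic) = padic_abs CARD('p) (of_int a)" for a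
    by (cases a rule: int_cases2) (simp_all add: padic_norm_of_nat)
  obtain a b where q: "q = of_int a / of_int b" "b \<noteq> 0" by (rule rat_quotientE)
  have "padic_norm (of_rat q :: 'p padic) = padic_norm (of_int a / of_int b :: 'p padic)"
    using q by (simp add: of_rat_divide)
  also have "\<dots> = padic_abs CARD('p) (of_int a) / padic_abs CARD('p) (of_int b)"
    by (simp add: padic_norm_divide int)
  also have "\<dots> = padic_abs CARD('p) q"
    by (simp add: q divide_inverse padic_abs_mult[OF prime_card] padic_abs_inverse[OF prime_card])
  finally show ?thesis .
qed

lift_definition const_seq :: "rat \<Rightarrow> 'p::prime_card padic_seq" is "\<lambda>q _. q" by simp

lemma padic_of_rat: "(of_rat q :: 'p::prime_card padic) = abs_padic (const_seq q)"
proof -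
  have nat: "of_nat n = (const_seq (of_nat n) :: 'p padic_seq)" for n
    by (simp add: Rep_padic_seq_of_nat const_seq.rep_eq flip: Rep_padic_seq_inject)
  have minus: "- const_seq x = (const_seq (- x) :: 'p padic_seq)" for x by transfer simp
  have mult: "const_seq x * const_seq y = (const_seq (x * y) :: 'p padic_seq)" for x y
    by transfer simp
  have int: "(of_int a :: 'p padic) = abs_padic (const_seq (of_int a))" for a
    by (cases a rule: int_cases2)
       (simp_all add: padic_of_nat nat uminus_padic.abs_eq minus)
  obtain a b where q: "q = of_int a / of_int b" "b \<noteq> 0" by (rule rat_quotientE)
  have "abs_padic (const_seq q) * of_int b = (of_int a :: 'p padic)"
    using q by (simp add: int times_padic.abs_eq mult)
  then have "abs_padic (const_seq q) = (of_int a / of_int b :: 'p padic)"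
    using q(2) by (simp add: eq_divide_eq)
  then show ?thesis by (simp add: q(1) of_rat_divide)
qed

lemma padic_norm_diff_of_rat_le:
  assumes "\<And>n. n \<ge> N \<Longrightarrow> padic_abs CARD('p) (Rep_padic_seq X n - q) \<le> e"
  shows "padic_norm (abs_padic X - of_rat q :: 'p::prime_card padic) \<le> e"
proof -
  have "seq_norm (X - const_seq q) \<le> e"
    by (rule LIMSEQ_le_const2[OF seq_norm_tendsto])
      (use assms in \<open>auto simp: minus_padic_seq.rep_eq const_seq.rep_eq\<close>)
  then show ?thesis by (simp add: padic_of_rat minus_padic.abs_eq padic_norm.abs_eq)
qed

lemma padic_dense:
  fixes x :: "'p::prime_card padic"
  assumes "e > 0"
  shows "\<exists>q. dist x (of_rat q) < e"
proof -
  obtain X where x: "x = abs_padic X" by (metis Quotient3_abs_rep Quotient3_padic)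
  have "padic_cauchy CARD('p) (Rep_padic_seq X)" using Rep_padic_seq by auto
  then obtain N where "\<And>m n. m \<ge> N \<Longrightarrow> n \<ge> N
      \<Longrightarrow> padic_abs CARD('p) (Rep_padic_seq X m - Rep_padic_seq X n) < e / 2"
    unfolding padic_cauchy_def using assms by (meson half_gt_zero)
  then have "padic_norm (x - of_rat (Rep_padic_seq X N)) \<le> e / 2"
    unfolding x by (intro padic_norm_diff_of_rat_le[of N]) (auto intro: less_imp_le)
  then show ?thesis using assms unfolding dist_padic_def
    by (intro exI[of _ "Rep_padic_seq X N"]) linarith
qed

instance padic :: (prime_card) complete_space
proof
  fix X :: "nat \<Rightarrow> 'a padic" assume X: "Cauchy X"
  have "\<exists>q. dist (X n) (of_rat q) < inverse (Suc n)" for n by (rule padic_dense) simp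
  then obtain q where q: "\<And>n. dist (X n) (of_rat (q n)) < inverse (Suc n)" by metis
  have close: "(\<lambda>n. dist (X n) (of_rat (q n))) \<longlonglongrightarrow> 0"
    using LIMSEQ_inverse_real_of_nat
    by (rule Lim_null_comparison[rotated]) (use q in \<open>simp add: less_imp_le\<close>)
  have "padic_cauchy CARD('a) q"
    unfolding padic_cauchy_def
  proof (intro allI impI)
    fix e :: real assume e: "e > 0"
    then have e3: "e / 3 > 0" by simp
    obtain M where M: "\<And>m n. m \<ge> M \<Longrightarrow> n \<ge> M \<Longrightarrow> dist (X m) (X n) < e / 3"
      using X e3 unfolding Cauchy_def by blast
    obtain N where N: "\<And>n. n \<ge> N \<Longrightarrow> dist (X n) (of_rat (q n)) < e / 3"
      using order_tendstoD(2)[OF close e3] unfolding eventually_sequentially by blast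
    have "padic_abs CARD('a) (q m - q n) < e" if "m \<ge> max M N" "n \<ge> max M N" for m n
    proof -
      have "padic_abs CARD('a) (q m - q n) = dist (of_rat (q m) :: 'a padic) (of_rat (q n))"
        by (simp add: dist_padic_def padic_norm_of_rat flip: of_rat_diff)
      also have "\<dots> \<le> dist (of_rat (q m)) (X m) + dist (X m) (X n) + dist (X n) (of_rat (q n))"
        by metric
      also have "\<dots> < e"
        using M[of m n] N[of m] N[of n] that dist_commute[of "of_rat (q m)" "X m"] by simp
      finally show ?thesis .
    qed
    then show "\<exists>N. \<forall>m\<ge>N. \<forall>n\<ge>N. padic_abs CARD('a) (q m - q n) < e" by blast
  qed note cauchy = this
  define Q where "Q = (Abs_padic_seq q :: 'a padic_seq)"
  have Q: "Rep_padic_seq Q = q" using cauchy by (simp add: Q_def Abs_padic_seq_inverse)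
  have "(\<lambda>n. of_rat (q n)) \<longlonglongrightarrow> abs_padic Q"
    unfolding lim_sequentially
  proof (intro allI impI)
    fix e :: real assume "e > 0"
    then obtain N where N: "\<And>m n. m \<ge> N \<Longrightarrow> n \<ge> N \<Longrightarrow> padic_abs CARD('a) (q m - q n) < e / 2"
      using cauchy unfolding padic_cauchy_def by (meson half_gt_zero)
    have "dist (of_rat (q n)) (abs_padic Q) < e" if "n \<ge> N" for n
    proof -
      have "padic_norm (abs_padic Q - of_rat (q n)) \<le> e / 2"
        using N that by (intro padic_norm_diff_of_rat_le[of N]) (auto simp: Q intro: less_imp_le)
      then show ?thesis using \<open>e > 0\<close> 
        by (simp add: dist_padic_def padic_norm_minus_commute[of "of_rat _"])
    qed
    then show "\<exists>N. \<forall>n\<ge>N. dist (of_rat (q n)) (abs_padic Q) < e" by blast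
  qed
  then have "(\<lambda>n. dist (X n) (of_rat (q n)) + dist (of_rat (q n)) (abs_padic Q)) \<longlonglongrightarrow> 0"
    using tendsto_add_zero[OF close] by (metis tendsto_dist_iff)
  then have "(\<lambda>n. dist (X n) (abs_padic Q)) \<longlonglongrightarrow> 0"
    by (rule Lim_null_comparison[rotated]) (simp add: dist_triangle)
  then have "X \<longlonglongrightarrow> abs_padic Q" by (simp add: tendsto_dist_iff[of X])
  then show "convergent X" unfolding convergent_def by blast
qed


section \<open>Affine subspaces\<close>

definition affine_subspace :: "('p::prime_card padic ^ 'n) set \<Rightarrow> bool" where
  "affine_subspace A \<longleftrightarrow> (\<exists>a S. vec.subspace S \<and> A = (\<lambda>x. a + x) ` S)"

definition affine_span :: "('p::prime_card padic ^ 'n) set \<Rightarrow> ('p padic ^ 'n) set" where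
  "affine_span M = \<Inter>{A. affine_subspace A \<and> M \<subseteq> A}"

definition affine_dim :: "('p::prime_card padic ^ 'n) set \<Rightarrow> nat" where
  "affine_dim A = vec.dim {x - y | x y. x \<in> A \<and> y \<in> A}"


section \<open>Diophantine exponents\<close>

fun sup_norm :: "int \<times> (int ^ 'n) \<Rightarrow> real" where
  "sup_norm (q\<^sub>0, q) = Max (insert \<bar>real_of_int q\<^sub>0\<bar> (range (\<lambda>i. \<bar>real_of_int (q $ i)\<bar>)))"

text \<open>
  Exponents are extended reals, since the suprema may be infinite. The zero vector satisfies the
  inequality because \<open>0 powr (- v) = 0\<close>, which is immaterial to the infinitude of the set.
\<close>

definition dioph_exponent :: "'p::prime_card padic ^ 'n \<Rightarrow> ereal" where
  "dioph_exponent y = Sup (ereal ` {v. v > 0 \<and>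
     infinite {(q\<^sub>0, q). padic_norm (of_int q\<^sub>0 + (\<Sum>i\<in>UNIV. of_int (q $ i) * y $ i))
                           \<le> sup_norm (q\<^sub>0, q) powr (- v)}})"

definition measure_exponent :: "('p::prime_card padic ^ 'n) measure \<Rightarrow> ereal" where
  "measure_exponent \<nu> = Sup (ereal ` {v. emeasure \<nu> {y. dioph_exponent y > ereal v} > 0})"

text \<open>
  The space $\mathbb{Q}_p^s$, for a dimension \<open>s\<close> that is a value, is realised as the closed
  subgroup of sequences supported on the first \<open>s\<close> coordinates; its topology is the subspace
  topology of the product topology on \<open>nat \<Rightarrow> 'p padic\<close>.
\<close>

definition padic_space :: "nat \<Rightarrow> (nat \<Rightarrow> 'p::prime_card padic) set" where
  "padic_space s = {x. \<forall>i\<ge>s. x i = 0}"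

text \<open>
  Regularity need not be demanded: a Borel measure on $\mathbb{Q}_p^s$ that is finite on compact
  sets is automatically regular.
\<close>

definition haar_measure :: "nat \<Rightarrow> (nat \<Rightarrow> 'p::prime_card padic) measure \<Rightarrow> bool" where
  "haar_measure s \<eta> \<longleftrightarrow>
     sets \<eta> = sets (restrict_space borel (padic_space s)) \<and>
     emeasure \<eta> (padic_space s) > 0 \<and>
     (\<forall>K. compact K \<and> K \<subseteq> padic_space s \<longrightarrow> emeasure \<eta> K < \<infinity>) \<and>
     (\<forall>v\<in>padic_space s. \<forall>A\<in>sets \<eta>. emeasure \<eta> ((\<lambda>x i. v i + x i) ` A) = emeasure \<eta> A)"

definition affine_iso :: "nat \<Rightarrow> ((nat \<Rightarrow> 'p::prime_card padic) \<Rightarrow> 'p padic ^ 'n)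
    \<Rightarrow> ('p padic ^ 'n) set \<Rightarrow> bool" where
  "affine_iso s \<phi> A \<longleftrightarrow>
     (\<exists>a b. \<forall>x\<in>padic_space s. \<phi> x = a + (\<Sum>i<s. x i *s b i)) \<and> bij_betw \<phi> (padic_space s) A"

text \<open>
  The exponent of an affine subspace is independent of the choice of the affine isomorphism and of
  the normalisation of Haar measure, which is what the definite description expresses.
\<close>

definition affine_exponent :: "('p::prime_card padic ^ 'n) set \<Rightarrow> ereal" where
  "affine_exponent A = (THE w. \<exists>\<phi> \<eta>. affine_iso (affine_dim A) \<phi> A \<and>
     haar_measure (affine_dim A) \<eta> \<and> w = measure_exponent (distr \<eta> borel \<phi>))"


section \<open>Besicovitch spaces and Federer measures\<close>

definition besicovitch_space :: "'a::metric_space itself \<Rightarrow> bool" where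
  "besicovitch_space _ \<longleftrightarrow> (\<exists>N::nat. \<forall>(E :: 'a set) \<B>.
     bounded E \<and> \<B> \<subseteq> {ball x r | x r. r > 0} \<and> (\<forall>x\<in>E. \<exists>r>0. ball x r \<in> \<B>) \<longrightarrow>
     (\<exists>\<C>\<subseteq>\<B>. countable \<C> \<and> E \<subseteq> \<Union>\<C> \<and>
        (\<forall>x. finite {B \<in> \<C>. x \<in> B} \<and> card {B \<in> \<C>. x \<in> B} \<le> N)))"

definition radon_measure :: "'a::metric_space measure \<Rightarrow> bool" where
  "radon_measure \<mu> \<longleftrightarrow>
     sets \<mu> = sets borel \<and>
     (\<forall>K. compact K \<longrightarrow> emeasure \<mu> K < \<infinity>) \<and>
     (\<forall>A\<in>sets borel. emeasure \<mu> A = (INF U\<in>{U. open U \<and> A \<subseteq> U}. emeasure \<mu> U)) \<and>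
     (\<forall>U. open U \<longrightarrow> emeasure \<mu> U = (SUP K\<in>{K. compact K \<and> K \<subseteq> U}. emeasure \<mu> K))"

definition msupport :: "'a::metric_space measure \<Rightarrow> 'a set" where
  "msupport \<mu> = {x. \<forall>U. open U \<and> x \<in> U \<longrightarrow> emeasure \<mu> U > 0}"

text \<open>
  In \<open>ennreal\<close> one has \<open>\<infinity> / \<infinity> = 0\<close>. This does not affect \<open>federer\<close> below: Radon measures are
  locally finite by outer regularity, and the neighbourhood \<open>U\<close> may always be shrunk.
\<close>

definition federer_on :: "real \<Rightarrow> 'a::metric_space measure \<Rightarrow> 'a set \<Rightarrow> bool" where
  "federer_on D \<mu> U \<longleftrightarrow> open U \<and> emeasure \<mu> U > 0 \<and>
     (SUP (x, r)\<in>{(x, r). x \<in> msupport \<mu> \<and> r > 0 \<and> ball x (3 * r) \<subseteq> U}.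
        emeasure \<mu> (ball x (3 * r)) / emeasure \<mu> (ball x r)) < ennreal D"

definition federer :: "'a::metric_space measure \<Rightarrow> bool" where
  "federer \<mu> \<longleftrightarrow> (AE x in \<mu>. \<exists>U D. x \<in> U \<and> D > 0 \<and> federer_on D \<mu> U)"


section \<open>Good and nonplanar pairs\<close>

definition sup_norm_on :: "'a measure \<Rightarrow> 'a set \<Rightarrow> ('a \<Rightarrow> 'p::prime_card padic) \<Rightarrow> ennreal" where
  "sup_norm_on \<mu> B f = Sup {c. emeasure \<mu> {x\<in>B. ennreal (padic_norm (f x)) > c} > 0}"

definition ennreal_powr :: "ennreal \<Rightarrow> real \<Rightarrow> ennreal" where
  "ennreal_powr x a = (if x = \<infinity> then \<infinity> else ennreal (enn2real x powr a))"

text \<open>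
  In \<open>ennreal\<close> one has \<open>\<epsilon> / 0 = \<infinity>\<close> and \<open>\<epsilon> / \<infinity> = 0\<close> for \<open>0 < \<epsilon> < \<infinity>\<close>, so that the condition is void
  on balls on which \<open>f\<close> vanishes almost everywhere.
\<close>

definition good_on :: "real \<Rightarrow> real \<Rightarrow> 'a::metric_space measure \<Rightarrow> 'a set
    \<Rightarrow> ('a \<Rightarrow> 'p::prime_card padic) \<Rightarrow> bool" where
  "good_on C \<alpha> \<mu> U f \<longleftrightarrow> f \<in> borel_measurable (restrict_space borel U) \<and>
     (\<forall>x\<in>msupport \<mu>. \<forall>r>0. ball x r \<subseteq> U \<longrightarrow> (\<forall>\<epsilon>>0.
        emeasure \<mu> {y \<in> ball x r. padic_norm (f y) < \<epsilon>}
          \<le> ennreal C * ennreal_powr (ennreal \<epsilon> / sup_norm_on \<mu> (ball x r) f) \<alpha>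
              * emeasure \<mu> (ball x r)))"

definition good_pair :: "('a::metric_space \<Rightarrow> 'p::prime_card padic ^ 'n) \<Rightarrow> 'a measure \<Rightarrow> bool" where
  "good_pair f \<mu> \<longleftrightarrow> (AE x in \<mu>. \<exists>V C \<alpha>. open V \<and> x \<in> V \<and> C > 0 \<and> \<alpha> > 0 \<and>
     (\<forall>c\<^sub>0 c. good_on C \<alpha> \<mu> V (\<lambda>x. c\<^sub>0 + (\<Sum>i\<in>UNIV. c $ i * f x $ i))))"

definition nonplanar_in :: "('a::metric_space \<Rightarrow> 'p::prime_card padic ^ 'n) \<Rightarrow> 'a measure
    \<Rightarrow> ('p padic ^ 'n) set \<Rightarrow> bool" where
  "nonplanar_in f \<mu> L \<longleftrightarrow> (\<forall>B. open B \<and> B \<noteq> {} \<and> emeasure \<mu> B > 0 \<longrightarrow>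
     L = affine_span (f ` (B \<inter> msupport \<mu>)))"

end

theory Submission
  imports Defs "HOL-Probability.Infinite_Product_Measure"
begin

text \<open>
  Write $\ell_y(q) = q_0 + q_1 y_1 + \dots + q_n y_n$ for an integer vector \<open>q\<close>. Since
  $w \ge \inf_L w$ on \<open>L\<close>, everything follows from: if $w(y_0) < v < w'$ for some $y_0 \in L$, then
  $w(f(x)) \le w'$ for almost every \<open>x\<close>; the same statement for Haar measure on \<open>L\<close> identifies
  $w(L)$.

  An approximation of exponent above $w'$ to $f(x)$ gives, for infinitely many \<open>k\<close>, a vector in the
  lattice $\Lambda_x = \{q : |\ell_{f(x)}(q)|_p \le p^{-k}\}$ which is exponentially (in \<open>k\<close>) shorter
  than $R = p^{k/v}/2$. By the Kleinbock--Margulis induction over flags of rational subspaces such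
  \<open>x\<close> form a set of exponentially small measure in a small ball \<open>B\<close>, and Borel--Cantelli applies,
  unless for some rational subspace \<open>W\<close> the covolume of $\Lambda_x \cap W$ is small for all \<open>x\<close> in
  \<open>B\<close> and the support. In that case, $y_0$ being an affine combination of values of \<open>f\<close> on this
  set, $\ell_{y_0}$ is small on the integer points of \<open>W\<close> in the box of size \<open>R\<close>, and the pigeonhole
  principle gives $q \ne 0$ of norm at most $2R$ with $|\ell_{y_0}(q)|_p \le p^{-k}$, which for large
  \<open>k\<close> contradicts $w(y_0) < v$.

  Covolumes are measured by counting integer points in boxes, so that no exterior algebra is needed.
\<close>

section \<open>Arithmetic and topology of $\mathbb{Q}_p$\<close>

text \<open>The flag argument asks three things of a covolume: it is a good function of
  \<open>x\<close> with constants independent of \<open>k\<close> and \<open>W\<close>, adjoining a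
  vector of length \<open>\<epsilon> R\<close> multiplies it by at most a constant times
  \<open>\<epsilon>\<close>, and the zero space has covolume 1. The quotient
  \<open>lat_index l k W R / cnt W R\<close> has all three. Its denominator does not depend on
  \<open>x\<close>; its numerator is the maximum of 1 and finitely many \<open>p^k |l(q)|\<close>,
  where \<open>l(q)\<close> is a linear combination of 1 and the coordinates of \<open>f x\<close>,
  and a maximum of good functions is good with the same constants. The price is a factor depending
  only on the dimension, which exponential smallness absorbs. The point \<open>y0\<close> enters
  through a constant \<open>K\<close> such that for every \<open>q\<close> some \<open>z\<close> in
  the ball and the support has \<open>|l(q)|\<close> at \<open>y0\<close> at most \<open>K\<close>
  times \<open>|l(q)|\<close> at \<open>f z\<close>. Since \<open>K\<close> does not depend on
  \<open>q\<close>, the threshold for covolumes does not depend on \<open>k\<close>. The general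
  argument lives on a carrier set with an explicit metric, because it is applied twice: to
  \<open>X\<close>, and to Q_p^s, where ultrametric geometry supplies the covering property and
  affine functions are good by a counting of translates.\<close>

lemma CARD_prime_gt_1: "CARD('p::prime_card) > 1"
  using prime_gt_1_nat[OF prime_card] .

lemma CARD_prime_ge_2: "real CARD('p::prime_card) \<ge> 2"
proof -
  have "CARD('p) \<ge> 2" using CARD_prime_gt_1[where 'p='p] by linarith
  then have "real 2 \<le> real CARD('p)" by (simp only: of_nat_le_iff)
  then show ?thesis by simp
qed

lemma padic_norm_0 [simp]: "padic_norm 0 = 0"
  by simp

lemma CARD_prime_real_gt_1: "real CARD('p::prime_card) > 1"
  using CARD_prime_ge_2[where 'p='p] by linarith

lemma padic_norm_1 [simp]: "padic_norm (1 :: 'p::prime_card padic) = 1"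
  using padic_norm_of_nat[of 1, where 'p='p] by simp

lemma padic_norm_power: "padic_norm (x ^ k) = padic_norm x ^ k"
  by (induction k) (simp_all add: padic_norm_mult)

lemma padic_norm_of_nat_powi:
  assumes "n > 0"
  shows "padic_norm (of_nat n :: 'p::prime_card padic)
      = inverse (real CARD('p) ^ multiplicity (int CARD('p)) (int n))"
proof -
  have "padic_norm (of_nat n :: 'p padic) = padic_abs CARD('p) (of_int (int n) / of_int 1)"
    by (simp add: padic_norm_of_nat)
  also have "\<dots> = inverse (real CARD('p) ^ multiplicity (int CARD('p)) (int n))"
    using assms by (subst padic_abs_quotient[OF prime_card]) (auto simp: power_int_minus)
  finally show ?thesis .
qed

lemma padic_norm_of_nat_le_1: "padic_norm (of_nat n :: 'p::prime_card padic) \<le> 1"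
proof (cases "n = 0")
  case False
  have "1 \<le> real CARD('p) ^ k" for k using CARD_prime_ge_2[where 'p='p] by simp
  then show ?thesis using False by (simp add: padic_norm_of_nat_powi inverse_le_1_iff)
qed simp

lemma padic_norm_of_int_le_1: "padic_norm (of_int n :: 'p::prime_card padic) \<le> 1"
  by (cases n rule: int_cases2) (simp_all add: padic_norm_of_nat_le_1)

text \<open>The largest power of \<open>p\<close> dividing \<open>n\<close> is at most
  \<open>n\<close>. In the counting arguments below this bound separates translates by multiples of
  a single vector.\<close>

lemma padic_norm_of_nat_ge:
  assumes "n > 0"
  shows "padic_norm (of_nat n :: 'p::prime_card padic) \<ge> 1 / real n"
proof -
  have "int CARD('p) ^ multiplicity (int CARD('p)) (int n) dvd int n" by (rule multiplicity_dvd)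
  then have "int CARD('p) ^ multiplicity (int CARD('p)) (int n) \<le> int n"
    using assms by (intro zdvd_imp_le) auto
  then have "real_of_int (int CARD('p) ^ multiplicity (int CARD('p)) (int n)) \<le> real_of_int (int n)"
    by (simp only: of_int_le_iff)
  moreover have "real CARD('p) ^ multiplicity (int CARD('p)) (int n) > 0"
    using CARD_prime_ge_2[where 'p='p] by simp
  ultimately show ?thesis
    using assms by (simp add: padic_norm_of_nat_powi field_simps)
qed

lemma padic_norm_CARD: "padic_norm (of_nat CARD('p) :: 'p::prime_card padic) = 1 / real CARD('p)"
proof -
  have "multiplicity (int CARD('p)) (int CARD('p)) = 1"
    using CARD_prime_gt_1[where 'p='p] by (intro multiplicity_self) auto
  then show ?thesis
    using CARD_prime_gt_1[where 'p='p] by (subst padic_norm_of_nat_powi) (auto simp: divide_simps)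
qed

lemma padic_norm_diff_ultra: "padic_norm (x - y) \<le> max (padic_norm x) (padic_norm y)"
  using padic_norm_ultra[of x "- y"] by simp

lemma padic_norm_add_le: "padic_norm x \<le> c \<Longrightarrow> padic_norm y \<le> c \<Longrightarrow> padic_norm (x + y) \<le> c"
  using padic_norm_ultra[of x y] by linarith

lemma padic_norm_diff_le: "padic_norm x \<le> c \<Longrightarrow> padic_norm y \<le> c \<Longrightarrow> padic_norm (x - y) \<le> c"
  using padic_norm_diff_ultra[of x y] by linarith

lemma padic_norm_sum_le:
  assumes "c \<ge> 0" "\<And>i. i \<in> A \<Longrightarrow> padic_norm (f i) \<le> c"
  shows "padic_norm (\<Sum>i\<in>A. f i) \<le> c"
  using assms(2) by (induction A rule: infinite_finite_induct)
    (use \<open>c \<ge> 0\<close> in \<open>auto intro: padic_norm_add_le\<close>)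

lemma padic_norm_eq_of_diff_less:
  assumes "padic_norm (x - y) < padic_norm x"
  shows "padic_norm y = padic_norm x"
proof -
  have "padic_norm y \<le> padic_norm x"
    using padic_norm_diff_ultra[of x "x - y"] assms by simp
  moreover have "padic_norm x \<le> max (padic_norm (x - y)) (padic_norm y)"
    using padic_norm_ultra[of "x - y" y] by simp
  ultimately show ?thesis using assms by linarith
qed

text \<open>By density \<open>z\<close> may be replaced by a fraction \<open>c / d\<close> in lowest
  terms. As its norm is at most 1, \<open>p\<close> does not divide \<open>d\<close>, and Bezout's
  identity gives an inverse \<open>u\<close> of \<open>d\<close> modulo \<open>p^k\<close>; then
  \<open>a\<close> is \<open>c u\<close> reduced modulo \<open>p^k\<close>.\<close>

lemma padic_residue:
  fixes z :: "'p::prime_card padic"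
  assumes z: "padic_norm z \<le> 1"
  shows "\<exists>a < CARD('p) ^ k. padic_norm (z - of_nat a) \<le> 1 / real CARD('p) ^ k"
proof -
  let ?p = "CARD('p)"
  have p: "real ?p > 1" by (rule CARD_prime_real_gt_1)
  have e: "1 / real ?p ^ k > 0" using p by simp
  obtain q where q: "dist z (of_rat q) < 1 / real ?p ^ k" using padic_dense[OF e] by blast
  have zq: "padic_norm (z - of_rat q) < 1 / real ?p ^ k" using q by (simp add: dist_padic_def)
  have "1 / real ?p ^ k \<le> 1" using p by simp
  then have "padic_norm (z - of_rat q) \<le> 1" using zq by linarith
  then have "padic_norm (of_rat q :: 'p padic) \<le> 1"
    using padic_norm_diff_le[of z 1 "z - of_rat q"] z by simp
  then have q1: "padic_abs ?p q \<le> 1" by (simp add: padic_norm_of_rat)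
  obtain c d where cd: "quotient_of q = (c, d)" by fastforce
  have d: "d > 0" and cop: "coprime c d" and qcd: "q = of_int c / of_int d"
    using quotient_of_denom_pos cd quotient_of_coprime quotient_of_div by blast+
  have "\<not> int ?p dvd d"
  proof
    assume pd: "int ?p dvd d"
    have "\<not> is_unit (int ?p)" using CARD_prime_gt_1[where 'p='p] by simp
    then have npc: "\<not> int ?p dvd c" using cop pd coprime_common_divisor by blast
    then have c0: "c \<noteq> 0" by auto
    have "multiplicity (int ?p) c = 0" using npc by (rule not_dvd_imp_multiplicity_0)
    moreover have "multiplicity (int ?p) d \<ge> 1"
      using pd d \<open>\<not> is_unit (int ?p)\<close> by (intro multiplicity_geI) auto
    moreover have "padic_abs ?p q = real ?p powi (int (multiplicity (int ?p) d) - int (multiplicity (int ?p) c))"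
      unfolding qcd using c0 d by (intro padic_abs_quotient[OF prime_card]) auto
    ultimately have "padic_abs ?p q = real ?p ^ multiplicity (int ?p) d" by simp
    moreover have "real ?p ^ multiplicity (int ?p) d > 1"
      using p \<open>multiplicity (int ?p) d \<ge> 1\<close> by (intro one_less_power) auto
    ultimately show False using q1 by simp
  qed
  then have "coprime (int ?p) d" using prime_card[where 'a='p] by (intro prime_imp_coprime) auto
  then have "gcd d (int ?p ^ k) = 1" by (simp add: coprime_commute)
  then obtain u v where uv: "u * d + v * int ?p ^ k = 1" using bezout_int[of d "int ?p ^ k"] by auto
  define a where "a = (c * u) mod int ?p ^ k"
  have a: "0 \<le> a" "a < int ?p ^ k" using CARD_prime_gt_1[where 'p='p] by (auto simp: a_def)
  have "int ?p ^ k dvd c - a * d"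
  proof -
    have "c - a * d = c * (u * d + v * int ?p ^ k) - a * d" using uv by simp
    also have "\<dots> = (c * u - a) * d + c * v * int ?p ^ k" by (simp add: algebra_simps)
    finally have eq: "c - a * d = (c * u - a) * d + c * v * int ?p ^ k" .
    have "int ?p ^ k dvd c * u - a" unfolding a_def by (metis dvd_minus_mod)
    then show ?thesis unfolding eq by simp
  qed
  then obtain w where w: "c - a * d = int ?p ^ k * w" by (elim dvdE)
  have nd: "padic_norm (of_int d :: 'p padic) = 1"
  proof -
    have "multiplicity (int ?p) d = 0" using \<open>\<not> int ?p dvd d\<close> by (rule not_dvd_imp_multiplicity_0)
    moreover have "(of_int d :: 'p padic) = of_nat (nat d)" "int (nat d) = d" using d by auto
    ultimately show ?thesis using d padic_norm_of_nat_powi[of "nat d", where 'p='p] by simp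
  qed
  have "(of_rat q - of_int a :: 'p padic) = of_int (c - a * d) / of_int d"
    using d by (simp add: qcd of_rat_divide field_simps)
  also have "padic_norm \<dots> = padic_norm (of_nat ?p ^ k * of_int w :: 'p padic)"
    unfolding w by (simp add: padic_norm_divide nd)
  also have "\<dots> \<le> (1 / real ?p) ^ k * 1"
    unfolding padic_norm_mult padic_norm_power padic_norm_CARD
    by (intro mult_left_mono padic_norm_of_int_le_1) auto
  finally have "padic_norm (of_rat q - of_int a :: 'p padic) \<le> 1 / real ?p ^ k"
    by (simp add: power_divide)
  then have "padic_norm ((z - of_rat q) + (of_rat q - of_int a)) \<le> 1 / real ?p ^ k"
    using zq by (intro padic_norm_add_le) auto
  moreover have "(of_int a :: 'p padic) = of_nat (nat a)" using a by simp
  moreover have "nat a < ?p ^ k" using a by (simp add: nat_less_iff)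
  ultimately show ?thesis by (intro exI[of _ "nat a"]) simp
qed

text \<open>The sign makes \<open>k\<close> the exponent of the norm, since \<open>p\<close> itself
  has norm \<open>1 / p\<close>.\<close>

definition padic_scale :: "int \<Rightarrow> 'p::prime_card padic" where
  "padic_scale k = of_nat CARD('p) powi (- k)"

lemma padic_norm_scale: "padic_norm (padic_scale k :: 'p::prime_card padic) = real CARD('p) powi k"
proof -
  have inv: "padic_norm (inverse x :: 'p padic) = inverse (padic_norm x)" for x
    using padic_norm_divide[of 1 x] by (simp add: inverse_eq_divide)
  show ?thesis
    by (cases k rule: int_cases2)
      (simp_all add: padic_scale_def power_int_minus padic_norm_power padic_norm_CARD inv power_divide
        inverse_eq_divide padic_norm_divide)
qed

lemma padic_scale_neq_0 [simp]: "(padic_scale k :: 'p::prime_card padic) \<noteq> 0"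
  by (simp add: padic_scale_def)

text \<open>After scaling to the unit ball this is the statement on residues: a ball of radius
  \<open>p^(i + j)\<close> is covered by \<open>p^j\<close> balls of radius
  \<open>p^i\<close>.\<close>

lemma padic_cover:
  fixes z :: "'p::prime_card padic"
  assumes "padic_norm z \<le> real CARD('p) powi (i + int j)"
  shows "\<exists>a < CARD('p) ^ j. padic_norm (z - padic_scale (i + int j) * of_nat a) \<le> real CARD('p) powi i"
proof -
  let ?p = "CARD('p)" and ?\<pi> = "padic_scale (i + int j) :: 'p padic"
  have p: "real ?p > 0" using CARD_prime_ge_2[where 'p='p] by linarith
  have n\<pi>: "padic_norm ?\<pi> = real ?p powi (i + int j)" by (rule padic_norm_scale)
  have pos: "real ?p powi (i + int j) > 0" using p by simp
  have "padic_norm (z / ?\<pi>) \<le> 1" using assms pos by (simp add: padic_norm_divide n\<pi>)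
  then obtain a where a: "a < ?p ^ j" "padic_norm (z / ?\<pi> - of_nat a) \<le> 1 / real ?p ^ j"
    using padic_residue by blast
  have "z - ?\<pi> * of_nat a = ?\<pi> * (z / ?\<pi> - of_nat a)" by (simp add: algebra_simps)
  then have "padic_norm (z - ?\<pi> * of_nat a) = real ?p powi (i + int j) * padic_norm (z / ?\<pi> - of_nat a)"
    by (simp only: padic_norm_mult n\<pi>)
  also have "\<dots> \<le> real ?p powi (i + int j) * (1 / real ?p ^ j)"
    using a(2) pos by (intro mult_left_mono) auto
  also have "\<dots> = real ?p powi i" using p by (simp add: power_int_add)
  finally show ?thesis using a(1) by blast
qed

text \<open>All values lie in a ball covered by \<open>p^j\<close> balls of radius
  \<open>p^-k\<close>, where \<open>p^j\<close> is the least power of \<open>p\<close> that is at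
  least \<open>r p^k\<close>. The factor \<open>p\<close> in the last hypothesis pays for this
  rounding: \<open>p^j < p r p^k \<le> card A\<close>.\<close>

lemma padic_pigeonhole:
  fixes g :: "'a \<Rightarrow> 'p::prime_card padic"
  assumes A: "finite A" "card A \<ge> 2"
    and g: "\<And>a. a \<in> A \<Longrightarrow> padic_norm (g a) \<le> r"
    and r: "real CARD('p) * r * real CARD('p) ^ k \<le> card A"
  obtains a b where "a \<in> A" "b \<in> A" "a \<noteq> b" "padic_norm (g a - g b) \<le> 1 / real CARD('p) ^ k"
proof (cases "r \<le> 1 / real CARD('p) ^ k")
  case True
  obtain a b where "a \<in> A" "b \<in> A" "a \<noteq> b"
    using A by (metis card_le_Suc0_iff_eq not_less_eq_eq numeral_2_eq_2)
  then show ?thesis using that[of a b] padic_norm_diff_le[of "g a" r "g b"] g True by force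
next
  case False
  let ?p = "CARD('p)"
  have p: "real ?p > 1" by (rule CARD_prime_real_gt_1)
  define j where "j = (LEAST j. r * real ?p ^ k \<le> real ?p ^ j)"
  have ex: "\<exists>j. r * real ?p ^ k \<le> real ?p ^ j"
    using real_arch_pow[OF p] less_imp_le by blast
  have j: "r * real ?p ^ k \<le> real ?p ^ j" unfolding j_def using ex by (rule LeastI_ex)
  have "j \<noteq> 0" using j False p by (intro notI) (simp add: field_simps)
  then obtain i where i: "j = Suc i" using not0_implies_Suc by blast
  have "\<not> r * real ?p ^ k \<le> real ?p ^ i"
    using not_less_Least[of i "\<lambda>j. r * real ?p ^ k \<le> real ?p ^ j"] i j_def by simp
  then have "real ?p ^ j < real ?p * (r * real ?p ^ k)" using p by (simp add: i)
  also have "\<dots> \<le> card A" using r by (simp add: mult_ac)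
  finally have cj: "?p ^ j < card A" by (metis of_nat_less_iff of_nat_power)
  have "\<exists>c < ?p ^ j. padic_norm (g a - padic_scale (- int k + int j) * of_nat c) \<le> real ?p powi (- int k)"
    if "a \<in> A" for a
  proof (rule padic_cover)
    have "padic_norm (g a) \<le> r" using g that by blast
    also have "r \<le> real ?p ^ j / real ?p ^ k" using j p by (simp add: field_simps)
    also have "\<dots> = real ?p powi (- int k + int j)"
      using p by (simp add: power_int_diff)
    finally show "padic_norm (g a) \<le> real ?p powi (- int k + int j)" .
  qed
  then obtain c where c: "\<And>a. a \<in> A \<Longrightarrow> c a < ?p ^ j"
    "\<And>a. a \<in> A \<Longrightarrow> padic_norm (g a - padic_scale (- int k + int j) * of_nat (c a)) \<le> real ?p powi (- int k)"
    by metis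
  have "c ` A \<subseteq> {..<?p ^ j}" using c(1) by auto
  then have "card (c ` A) \<le> ?p ^ j" by (metis card_lessThan card_mono finite_lessThan)
  then have "\<not> inj_on c A" using cj by (metis card_image not_le)
  then obtain a b where ab: "a \<in> A" "b \<in> A" "a \<noteq> b" "c a = c b" unfolding inj_on_def by blast
  have "padic_norm ((g a - padic_scale (- int k + int j) * of_nat (c a))
      - (g b - padic_scale (- int k + int j) * of_nat (c b))) \<le> real ?p powi (- int k)"
    by (intro padic_norm_diff_le c ab)
  then have "padic_norm (g a - g b) \<le> real ?p powi (- int k)" using ab(4) by simp
  then show ?thesis using that ab by (simp add: power_int_minus inverse_eq_divide)
qed

section \<open>Continuity of the arithmetic operations\<close>

instance padic :: (prime_card) topological_comm_monoid_add
proof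
  fix a b :: "'a padic"
  show "LIM x (nhds a \<times>\<^sub>F nhds b). fst x + snd x :> nhds (a + b)"
    unfolding tendsto_iff
  proof (intro allI impI)
    fix e :: real assume e: "e > 0"
    have 1: "eventually (\<lambda>x. dist x a < e) (nhds a)" "eventually (\<lambda>x. dist x b < e) (nhds b)"
      using e by (auto simp: eventually_nhds_metric)
    have "dist (fst x + snd x) (a + b) < e" if "dist (fst x) a < e" "dist (snd x) b < e" for x
      using that padic_norm_ultra[of "fst x - a" "snd x - b"]
      by (simp add: dist_padic_def algebra_simps)
    then show "eventually (\<lambda>x. dist (fst x + snd x) (a + b) < e) (nhds a \<times>\<^sub>F nhds b)"
      using 1 unfolding eventually_prod_filter by (metis fst_conv snd_conv)
  qed
qed

instance padic :: (prime_card) topological_semigroup_mult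
proof
  fix a b :: "'a padic"
  show "LIM x (nhds a \<times>\<^sub>F nhds b). fst x * snd x :> nhds (a * b)"
    unfolding tendsto_iff
  proof (intro allI impI)
    fix e :: real assume e: "e > 0"
    define B where "B = padic_norm a + padic_norm b + 1"
    have B: "B \<ge> 1" "padic_norm a \<le> B" "padic_norm b \<le> B"
      using padic_norm_nonneg[of a] padic_norm_nonneg[of b] by (auto simp: B_def)
    \<comment> \<open>The bound by 1 keeps the norm of \<open>y\<close> at most \<open>B\<close>;
      the bound by \<open>e / B\<close> makes both products small.\<close>
    define c where "c = min (e / B) 1"
    have c: "c > 0" "c \<le> 1" "c * B \<le> e" using e B by (auto simp: c_def min_def field_simps)
    have 1: "eventually (\<lambda>x. dist x a < c) (nhds a)" "eventually (\<lambda>x. dist x b < c) (nhds b)"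
      using c by (auto simp: eventually_nhds_metric)
    have "dist (x * y) (a * b) < e" if xy: "dist x a < c" "dist y b < c" for x y
    proof -
      have y: "padic_norm y \<le> B"
        using padic_norm_add_le[of "y - b" B b] xy c B by (simp add: dist_padic_def)
      have "padic_norm ((x - a) * y) \<le> padic_norm (x - a) * B"
        unfolding padic_norm_mult by (intro mult_left_mono y) simp
      also have "\<dots> < c * B" using xy B by (intro mult_strict_right_mono) (auto simp: dist_padic_def)
      finally have 1: "padic_norm ((x - a) * y) < e" using c by linarith
      have "padic_norm (a * (y - b)) \<le> B * padic_norm (y - b)"
        unfolding padic_norm_mult by (intro mult_right_mono B) simp
      also have "\<dots> < B * c" using xy B by (intro mult_strict_left_mono) (auto simp: dist_padic_def)
      finally have 2: "padic_norm (a * (y - b)) < e" using c by (simp add: mult.commute)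
      have "x * y - a * b = (x - a) * y + a * (y - b)" by (simp add: algebra_simps)
      then show ?thesis using 1 2 padic_norm_ultra[of "(x - a) * y" "a * (y - b)"]
        by (simp add: dist_padic_def)
    qed
    then show "eventually (\<lambda>x. dist (fst x * snd x) (a * b) < e) (nhds a \<times>\<^sub>F nhds b)"
      using 1 unfolding eventually_prod_filter by (metis fst_conv snd_conv)
  qed
qed

lemma continuous_on_padic_norm [continuous_intros]:
  assumes "continuous_on S f"
  shows "continuous_on S (\<lambda>x. padic_norm (f x :: 'p::prime_card padic))"
proof -
  have "padic_norm z = dist z 0" for z :: "'p padic" by (simp add: dist_padic_def)
  then show ?thesis using assms by (simp add: continuous_on_dist)
qed

section \<open>Quantitative nondivergence\<close>

text \<open>A carrier with an explicit metric, rather than a type class, lets one development serve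
  both the space \<open>X\<close> and \<open>padic_space s\<close> with the metric
  \<open>pdist s\<close>.\<close>

locale besicovitch_measure = Metric_space M d for M :: "'x set" and d :: "'x \<Rightarrow> 'x \<Rightarrow> real" +
  fixes \<mu> :: "'x measure" and N :: nat
  assumes space_eq: "space \<mu> = M"
    and mball_sets [measurable]: "mball x r \<in> sets \<mu>"
    and N_pos: "N \<ge> 1"
    and besicovitch: "mbounded E \<Longrightarrow> \<B> \<subseteq> {mball x r | x r. x \<in> M \<and> r > 0} \<Longrightarrow>
      (\<forall>x\<in>E. \<exists>r>0. mball x r \<in> \<B>) \<Longrightarrow>
      \<exists>\<C>\<subseteq>\<B>. countable \<C> \<and> E \<subseteq> \<Union>\<C> \<and>
        (\<forall>x. finite {B \<in> \<C>. x \<in> B} \<and> card {B \<in> \<C>. x \<in> B} \<le> N)"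
begin

definition supp :: "'x set" where
  "supp = {x \<in> M. \<forall>r>0. emeasure \<mu> (mball x r) > 0}"

text \<open>Values at points of the support replace the essential supremum. For a continuous
  function they are bounded by it, so this follows from goodness in the usual sense, and only real
  quotients occur.\<close>

definition ball_good :: "real \<Rightarrow> real \<Rightarrow> 'x set \<Rightarrow> ('x \<Rightarrow> real) \<Rightarrow> bool" where
  "ball_good C \<alpha> U g \<longleftrightarrow> (\<forall>x\<in>supp. \<forall>r>0. mball x r \<subseteq> U \<longrightarrow>
     (\<forall>z\<in>mball x r \<inter> supp. \<forall>\<epsilon>>0. g z > 0 \<longrightarrow>
        emeasure \<mu> {y \<in> mball x r. g y < \<epsilon>}
          \<le> ennreal (C * (\<epsilon> / g z) powr \<alpha>) * emeasure \<mu> (mball x r)))"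

definition ball_doubling :: "real \<Rightarrow> 'x set \<Rightarrow> bool" where
  "ball_doubling D U \<longleftrightarrow> (\<forall>x\<in>supp. \<forall>r>0. mball x (3 * r) \<subseteq> U \<longrightarrow>
     emeasure \<mu> (mball x (3 * r)) \<le> ennreal D * emeasure \<mu> (mball x r))"

lemma supp_subset: "supp \<subseteq> M"
  by (auto simp: supp_def)

lemma ball_good_mono: "ball_good C \<alpha> U g \<Longrightarrow> V \<subseteq> U \<Longrightarrow> ball_good C \<alpha> V g"
  unfolding ball_good_def by (meson order_trans)

lemma ball_doubling_mono: "ball_doubling D U \<Longrightarrow> V \<subseteq> U \<Longrightarrow> ball_doubling D V"
  unfolding ball_doubling_def by (meson order_trans)

text \<open>The covering property speaks of balls as sets, while the applications attach data to
  centres. One centre is chosen for each selected ball; a centre determines its ball, so the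
  multiplicity does not grow.\<close>

lemma besicovitch_subfamily:
  assumes "E \<subseteq> M" "mbounded E" and \<rho>: "\<And>y. y \<in> E \<Longrightarrow> \<rho> y > 0"
  obtains Y where "Y \<subseteq> E" "countable Y" "E \<subseteq> (\<Union>y\<in>Y. mball y (\<rho> y))"
    "\<And>x. finite {y \<in> Y. x \<in> mball y (\<rho> y)}" "\<And>x. card {y \<in> Y. x \<in> mball y (\<rho> y)} \<le> N"
proof -
  let ?B = "\<lambda>y. mball y (\<rho> y)"
  have "\<exists>\<C>\<subseteq>?B ` E. countable \<C> \<and> E \<subseteq> \<Union>\<C> \<and>
        (\<forall>x. finite {B \<in> \<C>. x \<in> B} \<and> card {B \<in> \<C>. x \<in> B} \<le> N)"
    by (rule besicovitch) (use assms in auto)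
  then obtain \<C> where C: "\<C> \<subseteq> ?B ` E" "countable \<C>" "E \<subseteq> \<Union>\<C>"
    "\<And>x. finite {B \<in> \<C>. x \<in> B}" "\<And>x. card {B \<in> \<C>. x \<in> B} \<le> N" by blast
  have "\<forall>X\<in>\<C>. \<exists>y\<in>E. X = ?B y" using C(1) by blast
  then obtain g where g: "\<And>X. X \<in> \<C> \<Longrightarrow> g X \<in> E" "\<And>X. X \<in> \<C> \<Longrightarrow> X = ?B (g X)" by metis
  have img: "{y \<in> g ` \<C>. x \<in> ?B y} = g ` {B \<in> \<C>. x \<in> B}" for x using g(2) by blast
  show ?thesis
  proof (rule that[of "g ` \<C>"])
    show "E \<subseteq> (\<Union>y\<in>g ` \<C>. ?B y)" using C(3) g(2) by blast
    show "card {y \<in> g ` \<C>. x \<in> ?B y} \<le> N" for x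
      unfolding img using C(5)[of x] card_image_le[OF C(4)] le_trans by blast
  qed (use C g img in auto)
qed

text \<open>Double counting: the sum of the measures of the \<open>B y\<close> is the integral of
  the number of \<open>B y\<close> containing a point, which is at most \<open>N\<close> and
  vanishes outside \<open>V\<close>. The exchange is Tonelli's theorem for counting measure on the
  countable \<open>Y\<close>.\<close>

lemma emeasure_UN_le_overlap:
  assumes Y: "countable Y" "\<And>x. finite {y \<in> Y. x \<in> B y}" "\<And>x. card {y \<in> Y. x \<in> B y} \<le> N"
    and A: "\<And>y. y \<in> Y \<Longrightarrow> A y \<in> sets \<mu>" and B: "\<And>y. y \<in> Y \<Longrightarrow> B y \<in> sets \<mu>"
    and le: "\<And>y. y \<in> Y \<Longrightarrow> emeasure \<mu> (A y) \<le> \<kappa> * emeasure \<mu> (B y)"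
    and V: "V \<in> sets \<mu>" "\<And>y. y \<in> Y \<Longrightarrow> B y \<subseteq> V"
  shows "emeasure \<mu> (\<Union>y\<in>Y. A y) \<le> \<kappa> * (of_nat N * emeasure \<mu> V)"
proof -
  have "emeasure \<mu> (\<Union>y\<in>Y. A y) = (\<integral>\<^sup>+x. indicator (\<Union>y\<in>Y. A y) x \<partial>\<mu>)"
    using A Y(1) by (intro nn_integral_indicator[symmetric]) auto
  also have "\<dots> \<le> (\<integral>\<^sup>+x. (\<integral>\<^sup>+y. indicator (A y) x \<partial>count_space Y) \<partial>\<mu>)"
  proof (intro nn_integral_mono)
    fix x
    show "indicator (\<Union>y\<in>Y. A y) x \<le> (\<integral>\<^sup>+y. (indicator (A y) x :: ennreal) \<partial>count_space Y)"
    proof (cases "x \<in> (\<Union>y\<in>Y. A y)")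
      case True
      then obtain y where y: "y \<in> Y" "x \<in> A y" by blast
      have "(1 :: ennreal) = (\<integral>\<^sup>+y'. indicator {y} y' \<partial>count_space Y)"
        using y by (simp add: nn_integral_indicator)
      also have "\<dots> \<le> (\<integral>\<^sup>+y. indicator (A y) x \<partial>count_space Y)"
        by (intro nn_integral_mono) (use y in \<open>auto simp: indicator_def\<close>)
      finally show ?thesis using True by simp
    qed simp
  qed
  also have "\<dots> = (\<integral>\<^sup>+y. (\<integral>\<^sup>+x. indicator (A y) x \<partial>\<mu>) \<partial>count_space Y)"
    by (rule nn_integral_count_space_nn_integral) (use Y A in auto)
  also have "\<dots> = (\<integral>\<^sup>+y. emeasure \<mu> (A y) \<partial>count_space Y)"
    by (intro nn_integral_cong nn_integral_indicator) (use A in auto)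
  also have "\<dots> \<le> (\<integral>\<^sup>+y. \<kappa> * emeasure \<mu> (B y) \<partial>count_space Y)"
    by (intro nn_integral_mono) (use le in auto)
  also have "\<dots> = \<kappa> * (\<integral>\<^sup>+y. emeasure \<mu> (B y) \<partial>count_space Y)"
    by (rule nn_integral_cmult) auto
  also have "(\<integral>\<^sup>+y. emeasure \<mu> (B y) \<partial>count_space Y)
      = (\<integral>\<^sup>+y. (\<integral>\<^sup>+x. indicator (B y) x \<partial>\<mu>) \<partial>count_space Y)"
    by (intro nn_integral_cong nn_integral_indicator[symmetric]) (use B in auto)
  also have "\<dots> = (\<integral>\<^sup>+x. (\<integral>\<^sup>+y. indicator (B y) x \<partial>count_space Y) \<partial>\<mu>)"
    by (rule nn_integral_count_space_nn_integral[symmetric]) (use Y B in auto)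
  also have "\<dots> \<le> (\<integral>\<^sup>+x. of_nat N * indicator V x \<partial>\<mu>)"
  proof (intro nn_integral_mono)
    fix x
    have "(\<integral>\<^sup>+y. (indicator (B y) x :: ennreal) \<partial>count_space Y)
        = (\<integral>\<^sup>+y. indicator {y \<in> Y. x \<in> B y} y \<partial>count_space Y)"
      by (intro nn_integral_cong) (auto simp: indicator_def)
    also have "\<dots> = of_nat (card {y \<in> Y. x \<in> B y})"
      using Y(2)[of x] by (subst nn_integral_indicator) (auto intro!: emeasure_count_space_finite)
    also have "\<dots> \<le> of_nat N * indicator V x"
    proof (cases "x \<in> V")
      case True
      then show ?thesis using Y(3)[of x] by (simp add: of_nat_le_iff)
    next
      case False
      then have "{y \<in> Y. x \<in> B y} = {}" using V(2) by blast
      then show ?thesis by (simp only: card.empty of_nat_0 zero_le)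
    qed
    finally show "(\<integral>\<^sup>+y. (indicator (B y) x :: ennreal) \<partial>count_space Y) \<le> of_nat N * indicator V x" .
  qed
  also have "\<dots> = of_nat N * emeasure \<mu> V"
    using V(1) by (simp add: nn_integral_cmult_indicator)
  finally show ?thesis by (simp add: mult_left_mono)
qed

text \<open>The Besicovitch property takes the place of separability: each bounded piece of
  \<open>G\<close> is covered by countably many of the given balls, and countably many bounded
  pieces exhaust \<open>G\<close>.\<close>

lemma locally_null:
  assumes G: "G \<subseteq> M"
    and loc: "\<And>x. x \<in> G \<Longrightarrow> \<exists>r>0. \<exists>H\<in>null_sets \<mu>. Z \<inter> mball x r \<subseteq> H"
  shows "\<exists>H\<in>null_sets \<mu>. G \<inter> Z \<subseteq> H"
proof (cases "M = {}")
  case True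
  then show ?thesis using G by blast
next
  case False
  then obtain a where a: "a \<in> M" by blast
  have "\<forall>x\<in>G. \<exists>r H. r > 0 \<and> H \<in> null_sets \<mu> \<and> Z \<inter> mball x r \<subseteq> H" using loc by blast
  then obtain \<rho> K where \<rho>: "\<And>x. x \<in> G \<Longrightarrow> \<rho> x > 0" "\<And>x. x \<in> G \<Longrightarrow> K x \<in> null_sets \<mu>"
      "\<And>x. x \<in> G \<Longrightarrow> Z \<inter> mball x (\<rho> x) \<subseteq> K x"
    by metis
  have "\<exists>H\<in>null_sets \<mu>. G \<inter> mball a (real n) \<inter> Z \<subseteq> H" for n
  proof -
    have "mbounded (G \<inter> mball a (real n))" by (meson inf_le2 mbounded_mball mbounded_subset)
    then obtain Y where Y: "Y \<subseteq> G \<inter> mball a (real n)" "countable Y"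
      "G \<inter> mball a (real n) \<subseteq> (\<Union>y\<in>Y. mball y (\<rho> y))"
      using besicovitch_subfamily[of "G \<inter> mball a (real n)" \<rho>] \<rho>(1) G by (metis IntD1 le_infI1)
    have "(\<Union>y\<in>Y. K y) \<in> null_sets \<mu>"
      using Y \<rho>(2) by (intro null_sets_UN') auto
    moreover have "G \<inter> mball a (real n) \<inter> Z \<subseteq> (\<Union>y\<in>Y. K y)"
      using Y \<rho>(3) by blast
    ultimately show ?thesis by blast
  qed
  then obtain H where H: "\<And>n::nat. H n \<in> null_sets \<mu>" "\<And>n. G \<inter> mball a (real n) \<inter> Z \<subseteq> H n" by metis
  have "G \<inter> Z \<subseteq> (\<Union>n. H n)"
  proof
    fix x assume x: "x \<in> G \<inter> Z"
    obtain n where "d a x < real n" using reals_Archimedean2 by blast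
    then have "x \<in> mball a (real n)" using a x G by auto
    then show "x \<in> (\<Union>n. H n)" using H(2)[of n] x by blast
  qed
  then show ?thesis using H(1) by (intro bexI[of _ "\<Union>n. H n"]) auto
qed

lemma AE_of_local:
  assumes loc: "AE x in \<mu>. \<exists>r>0. \<exists>H\<in>null_sets \<mu>. Z \<inter> mball x r \<subseteq> H"
  shows "AE x in \<mu>. x \<notin> Z"
proof -
  let ?G = "{x \<in> M. \<exists>r>0. \<exists>H\<in>null_sets \<mu>. Z \<inter> mball x r \<subseteq> H}"
  have "\<exists>H\<in>null_sets \<mu>. ?G \<inter> Z \<subseteq> H" by (rule locally_null) auto
  then obtain H where H: "H \<in> null_sets \<mu>" "?G \<inter> Z \<subseteq> H" by blast
  show ?thesis
    using loc AE_not_in[OF H(1)] AE_space by eventually_elim (use H(2) in \<open>auto simp: space_eq\<close>)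
qed

text \<open>Every point outside the support is the centre of a null ball.\<close>

lemma AE_supp: "AE x in \<mu>. x \<in> supp"
proof -
  have "\<exists>H\<in>null_sets \<mu>. (M - supp) \<inter> UNIV \<subseteq> H"
  proof (rule locally_null)
    fix x assume "x \<in> M - supp"
    then obtain r where "r > 0" "emeasure \<mu> (mball x r) = 0"
      by (auto simp: supp_def zero_less_iff_neq_zero)
    then show "\<exists>r>0. \<exists>H\<in>null_sets \<mu>. UNIV \<inter> mball x r \<subseteq> H"
      by (intro exI[of _ r]) (auto intro!: bexI[of _ "mball x r"] null_setsI)
  qed auto
  then obtain H where H: "H \<in> null_sets \<mu>" "M - supp \<subseteq> H" by auto
  show ?thesis using AE_not_in[OF H(1)] AE_space
    by eventually_elim (use H(2) in \<open>auto simp: space_eq\<close>)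
qed

text \<open>The marked points of Kleinbock and Margulis: \<open>F\<close> is a flag whose members
  have values that are small but under control, and it cannot be refined by a further member with
  value below \<open>\<rho>\<close>. The flag may be empty; then no value at \<open>x\<close> is
  below \<open>\<rho>\<close>.\<close>

definition marked :: "('s::order \<Rightarrow> 'x \<Rightarrow> real) \<Rightarrow> 's set \<Rightarrow> real \<Rightarrow> real \<Rightarrow> 'x \<Rightarrow> bool" where
  "marked \<psi> P \<epsilon> \<rho> x \<longleftrightarrow> (\<exists>F\<subseteq>P. finite F \<and> (\<forall>s\<in>F. \<forall>t\<in>F. s \<le> t \<or> t \<le> s) \<and>
     (\<forall>s\<in>F. \<epsilon> \<le> \<psi> s x \<and> \<psi> s x < \<rho>) \<and>
     (\<forall>s\<in>P - F. (\<forall>t\<in>F. s \<le> t \<or> t \<le> s) \<longrightarrow> \<rho> \<le> \<psi> s x))"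

text \<open>Induction on the bound \<open>m\<close> for the length of chains. Around a point where
  some value is below \<open>\<rho>\<close>, a suitable ball has one element \<open>s\<close> below
  \<open>\<rho>\<close> throughout, while on its triple every element reaches \<open>\<rho>\<close>.
  The element \<open>s\<close> joins the flag, and the induction hypothesis on the triple handles
  the elements comparable with \<open>s\<close>, whose chains are shorter by one. The radii triple
  at each of the \<open>m\<close> levels, whence the ball of radius \<open>3^m r0\<close> in the
  hypotheses.\<close>

lemma nondivergence:
  fixes \<psi> :: "'s::order \<Rightarrow> 'x \<Rightarrow> real"
  assumes C: "C > 0" and \<alpha>: "\<alpha> > 0" and D: "D \<ge> 1" and \<epsilon>: "\<epsilon> > 0" and \<rho>: "\<rho> > 0"
  shows "\<lbrakk>x0 \<in> supp; r0 > 0;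
    \<And>F. F \<subseteq> P \<Longrightarrow> finite F \<Longrightarrow> (\<forall>s\<in>F. \<forall>t\<in>F. s \<le> t \<or> t \<le> s) \<Longrightarrow> card F \<le> m;
    ball_doubling D (mball x0 (3 ^ m * r0));
    \<And>s. s \<in> P \<Longrightarrow> ball_good C \<alpha> (mball x0 (3 ^ m * r0)) (\<psi> s);
    \<And>s c. s \<in> P \<Longrightarrow> {x \<in> M. \<psi> s x < c} \<in> sets \<mu>;
    \<And>s y c. s \<in> P \<Longrightarrow> y \<in> M \<Longrightarrow> \<psi> s y < c \<Longrightarrow> \<exists>r>0. \<forall>z\<in>mball y r. \<psi> s z < c;
    \<And>s. s \<in> P \<Longrightarrow> \<exists>z\<in>mball x0 r0 \<inter> supp. \<rho> \<le> \<psi> s z\<rbrakk> \<Longrightarrow>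
    \<exists>A\<in>sets \<mu>. emeasure \<mu> A \<le> ennreal (real m * C * (real N * D\<^sup>2) ^ m * (\<epsilon> / \<rho>) powr \<alpha>)
        * emeasure \<mu> (mball x0 r0) \<and>
      (\<forall>x\<in>mball x0 r0 \<inter> supp - A. marked \<psi> P \<epsilon> \<rho> x)"
proof (induction m arbitrary: x0 r0 P)
  case 0
  have "P = {}"
  proof (rule ccontr)
    assume "P \<noteq> {}"
    then obtain s where "s \<in> P" by blast
    then show False using 0(3)[of "{s}"] by simp
  qed
  then show ?case by (intro bexI[of _ "{}"]) (auto simp: marked_def)
next
  case (Suc m)
  note x0 = Suc.prems(1) and r0 = Suc.prems(2) and chain = Suc.prems(3) and dbl = Suc.prems(4)
    and good = Suc.prems(5) and meas = Suc.prems(6) and usc = Suc.prems(7) and big = Suc.prems(8)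
  have x0M: "x0 \<in> M" using x0 supp_subset by blast
  define E where "E = {y \<in> mball x0 r0 \<inter> supp. \<exists>s\<in>P. \<psi> s y < \<rho>}"
  \<comment> \<open>Among the radii \<open>2 r0 / 3^j\<close> the first is taken at which a single
    element stays below \<open>\<rho>\<close>. Semicontinuity at \<open>y\<close> gives such a
    radius. The radius \<open>2 r0\<close> is not one, as that ball contains
    \<open>mball x0 r0\<close>, where every element reaches \<open>\<rho>\<close>; so the preceding
    radius, three times as large, exists and fails.\<close>
  have scale: "\<exists>r>0. \<exists>s\<in>P. 3 * r \<le> 2 * r0 \<and> (\<forall>z\<in>mball y r \<inter> supp. \<psi> s z < \<rho>) \<and>
      (\<forall>t\<in>P. \<exists>z\<in>mball y (3 * r) \<inter> supp. \<rho> \<le> \<psi> t z)" if y: "y \<in> E" for y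
  proof -
    define T where "T = (\<lambda>r. \<exists>s\<in>P. \<forall>z\<in>mball y r \<inter> supp. \<psi> s z < \<rho>)"
    obtain s where s: "s \<in> P" "\<psi> s y < \<rho>" using y E_def by blast
    have yM: "y \<in> M" and yx: "d x0 y < r0" using y by (auto simp: E_def)
    obtain t0 where t0: "t0 > 0" "\<forall>z\<in>mball y t0. \<psi> s z < \<rho>" using usc s yM by blast
    have down: "T r" if "T r'" "r \<le> r'" for r r'
      using that mball_subset_concentric[of r r' y] unfolding T_def by blast
    have top: "\<not> T (2 * r0)"
    proof
      assume "T (2 * r0)"
      then obtain s where s: "s \<in> P" "\<forall>z\<in>mball y (2 * r0) \<inter> supp. \<psi> s z < \<rho>"
        unfolding T_def by blast
      have "mball x0 r0 \<subseteq> mball y (2 * r0)" using yM yx by (intro mball_subset) auto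
      then show False using big[OF s(1)] s(2) by (meson IntD1 IntD2 IntI in_mono linorder_not_less)
    qed
    define u where "u = (\<lambda>j::nat. 2 * r0 / 3 ^ j)"
    have "\<exists>j. T (u j)"
    proof -
      obtain j where "(1/3::real) ^ j < t0 / (2 * r0)"
        using real_arch_pow_inv[of "t0 / (2 * r0)" "1/3"] t0 r0 by auto
      then have "u j \<le> t0" using r0 by (simp add: u_def field_simps power_divide)
      moreover have "T t0" unfolding T_def using s(1) t0 by blast
      ultimately show ?thesis using down by blast
    qed
    define j where "j = (LEAST j. T (u j))"
    have j: "T (u j)" unfolding j_def using \<open>\<exists>j. T (u j)\<close> by (rule LeastI_ex)
    have "j \<noteq> 0" using j top by (intro notI) (simp add: u_def)
    then obtain i where i: "j = Suc i" using not0_implies_Suc by blast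
    have ni: "\<not> T (u i)" using not_less_Least[of i "\<lambda>j. T (u j)"] i j_def by simp
    have ui: "3 * u j = u i" by (simp add: u_def i)
    obtain s where "s \<in> P" "\<forall>z\<in>mball y (u j) \<inter> supp. \<psi> s z < \<rho>" using j T_def by blast
    moreover have "u i \<le> 2 * r0" using r0 by (simp add: u_def field_simps)
    moreover have "u j > 0" using r0 by (simp add: u_def)
    moreover have "\<forall>t\<in>P. \<exists>z\<in>mball y (u i) \<inter> supp. \<rho> \<le> \<psi> t z"
      using ni unfolding T_def by (meson linorder_not_less)
    ultimately show ?thesis using ui by metis
  qed
  have "\<forall>y\<in>E. \<exists>r s. r > 0 \<and> s \<in> P \<and> 3 * r \<le> 2 * r0 \<and>
      (\<forall>z\<in>mball y r \<inter> supp. \<psi> s z < \<rho>) \<and> (\<forall>t\<in>P. \<exists>z\<in>mball y (3 * r) \<inter> supp. \<rho> \<le> \<psi> t z)"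
    using scale by blast
  then obtain r \<sigma> where r\<sigma>: "\<And>y. y \<in> E \<Longrightarrow> r y > 0" "\<And>y. y \<in> E \<Longrightarrow> \<sigma> y \<in> P"
    "\<And>y. y \<in> E \<Longrightarrow> 3 * r y \<le> 2 * r0"
    "\<And>y z. y \<in> E \<Longrightarrow> z \<in> mball y (r y) \<inter> supp \<Longrightarrow> \<psi> (\<sigma> y) z < \<rho>"
    "\<And>y t. y \<in> E \<Longrightarrow> t \<in> P \<Longrightarrow> \<exists>z\<in>mball y (3 * r y) \<inter> supp. \<rho> \<le> \<psi> t z"
    by (simp only: bchoice_iff) blast
  define Q where "Q = (\<lambda>y. {s \<in> P - {\<sigma> y}. s \<le> \<sigma> y \<or> \<sigma> y \<le> s})"
  define \<theta> where "\<theta> = (\<epsilon> / \<rho>) powr \<alpha>"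
  define b where "b = real N * D\<^sup>2"
  have b1: "b \<ge> 1"
  proof -
    have "1 * 1 \<le> real N * D\<^sup>2" using N_pos D by (intro mult_mono) auto
    then show ?thesis by (simp add: b_def)
  qed
  have \<theta>: "\<theta> \<ge> 0" by (simp add: \<theta>_def)
  \<comment> \<open>The exceptional set is that of the induction hypothesis together with the points
    where \<open>\<psi> (\<sigma> y)\<close> drops below \<open>\<epsilon>\<close>. Both are
    estimated on the tripled ball, where \<open>\<psi> (\<sigma> y)\<close> reaches
    \<open>\<rho>\<close>; one doubling, the factor \<open>D\<close>, returns to the ball
    itself.\<close>
  have local: "\<exists>A\<in>sets \<mu>. emeasure \<mu> A \<le> ennreal (real (Suc m) * C * b ^ m * \<theta> * D) * emeasure \<mu> (mball y (r y))
      \<and> (\<forall>x\<in>mball y (r y) \<inter> supp - A. marked \<psi> P \<epsilon> \<rho> x)" if y: "y \<in> E" for y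
  proof -
    have yM: "y \<in> M" and yx: "d x0 y < r0" and ys: "y \<in> supp" using y by (auto simp: E_def)
    let ?s = "\<sigma> y"
    have r: "r y > 0" and sP: "?s \<in> P" using r\<sigma> y by auto
    have sub: "mball y (3 ^ m * (3 * r y)) \<subseteq> mball x0 (3 ^ Suc m * r0)"
    proof (rule mball_subset[OF _ x0M])
      have "3 ^ m * (3 * r y) \<le> 3 ^ m * (2 * r0)" using r\<sigma>(3)[OF y] by (intro mult_left_mono) auto
      moreover have "r0 \<le> 3 ^ m * r0" using r0 by simp
      ultimately show "d y x0 + 3 ^ m * (3 * r y) \<le> 3 ^ Suc m * r0"
        using yx commute[of x0 y] unfolding power_Suc by linarith
    qed
    have sub1: "mball y (3 * r y) \<subseteq> mball y (3 ^ m * (3 * r y))"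
    proof -
      have "1 * (3 * r y) \<le> 3 ^ m * (3 * r y)" using r by (intro mult_right_mono) auto
      then show ?thesis by (intro mball_subset_concentric) simp
    qed
    have "\<exists>A\<in>sets \<mu>. emeasure \<mu> A \<le> ennreal (real m * C * (real N * D\<^sup>2) ^ m * (\<epsilon> / \<rho>) powr \<alpha>)
        * emeasure \<mu> (mball y (3 * r y)) \<and>
      (\<forall>x\<in>mball y (3 * r y) \<inter> supp - A. marked \<psi> (Q y) \<epsilon> \<rho> x)"
    proof (rule Suc.IH[OF ys])
      show "0 < 3 * r y" using r by simp
      fix F assume F: "F \<subseteq> Q y" "finite F" "\<forall>s\<in>F. \<forall>t\<in>F. s \<le> t \<or> t \<le> s"
      have "card (insert ?s F) \<le> Suc m"
        using F sP by (intro chain) (auto simp: Q_def)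
      moreover have "?s \<notin> F" using F(1) by (auto simp: Q_def)
      ultimately show "card F \<le> m" using F(2) by simp
    next
      show "ball_doubling D (mball y (3 ^ m * (3 * r y)))" using dbl sub by (rule ball_doubling_mono)
    next
      fix s assume "s \<in> Q y"
      then have s: "s \<in> P" by (simp add: Q_def)
      show "ball_good C \<alpha> (mball y (3 ^ m * (3 * r y))) (\<psi> s)"
        using good[OF s] sub by (rule ball_good_mono)
      show "{x \<in> M. \<psi> s x < c} \<in> sets \<mu>" for c using meas s by blast
      show "\<exists>r>0. \<forall>z\<in>mball y' r. \<psi> s z < c" if "y' \<in> M" "\<psi> s y' < c" for y' c
        using usc s that by blast
      show "\<exists>z\<in>mball y (3 * r y) \<inter> supp. \<rho> \<le> \<psi> s z" using r\<sigma>(5) y s by blast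
    qed
    then obtain A where A: "A \<in> sets \<mu>"
      "emeasure \<mu> A \<le> ennreal (real m * C * b ^ m * \<theta>) * emeasure \<mu> (mball y (3 * r y))"
      "\<And>x. x \<in> mball y (3 * r y) \<inter> supp - A \<Longrightarrow> marked \<psi> (Q y) \<epsilon> \<rho> x"
      unfolding b_def \<theta>_def by blast
    define A2 where "A2 = {x \<in> mball y (3 * r y). \<psi> ?s x < \<epsilon>}"
    have "A2 = mball y (3 * r y) \<inter> {x \<in> M. \<psi> ?s x < \<epsilon>}" by (auto simp: A2_def)
    then have A2s: "A2 \<in> sets \<mu>" using meas[OF sP] by auto
    have A2e: "emeasure \<mu> A2 \<le> ennreal (C * \<theta>) * emeasure \<mu> (mball y (3 * r y))"
    proof -
      obtain z where z: "z \<in> mball y (3 * r y) \<inter> supp" "\<rho> \<le> \<psi> ?s z" using r\<sigma>(5)[OF y sP] by blast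
      have "emeasure \<mu> A2 \<le> ennreal (C * (\<epsilon> / \<psi> ?s z) powr \<alpha>) * emeasure \<mu> (mball y (3 * r y))"
        unfolding A2_def
        by (rule good[OF sP, unfolded ball_good_def, rule_format])
          (use ys r z \<epsilon> \<rho> order_trans[OF sub1 sub] in auto)
      also have "\<dots> \<le> ennreal (C * \<theta>) * emeasure \<mu> (mball y (3 * r y))"
      proof (intro mult_right_mono ennreal_leI mult_left_mono)
        show "(\<epsilon> / \<psi> ?s z) powr \<alpha> \<le> \<theta>" unfolding \<theta>_def
          using z(2) \<epsilon> \<rho> \<alpha> by (intro powr_mono2 divide_left_mono) auto
      qed (use C in auto)
      finally show ?thesis .
    qed
    have dbl': "emeasure \<mu> (mball y (3 * r y)) \<le> ennreal D * emeasure \<mu> (mball y (r y))"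
      by (rule dbl[unfolded ball_doubling_def, rule_format])
        (use ys r order_trans[OF sub1 sub] in auto)
    have "emeasure \<mu> (A \<union> A2) \<le> emeasure \<mu> A + emeasure \<mu> A2"
      using A(1) A2s by (rule emeasure_subadditive)
    also have "\<dots> \<le> (ennreal (real m * C * b ^ m * \<theta>) + ennreal (C * \<theta>)) * emeasure \<mu> (mball y (3 * r y))"
      using add_mono[OF A(2) A2e] by (simp add: distrib_right)
    also have "\<dots> \<le> (ennreal (real m * C * b ^ m * \<theta>) + ennreal (C * \<theta>)) * (ennreal D * emeasure \<mu> (mball y (r y)))"
      using dbl' by (rule mult_left_mono) simp
    also have "\<dots> = ennreal ((real m * C * b ^ m * \<theta> + C * \<theta>) * D) * emeasure \<mu> (mball y (r y))"
    proof -
      have "ennreal (real m * C * b ^ m * \<theta>) + ennreal (C * \<theta>) = ennreal (real m * C * b ^ m * \<theta> + C * \<theta>)"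
        using C \<theta> b1 by (intro ennreal_plus[symmetric]) auto
      moreover have "ennreal ((real m * C * b ^ m * \<theta> + C * \<theta>) * D)
          = ennreal (real m * C * b ^ m * \<theta> + C * \<theta>) * ennreal D"
        using C \<theta> b1 D by (intro ennreal_mult) auto
      ultimately show ?thesis by (simp only: mult.assoc)
    qed
    also have "\<dots> \<le> ennreal (real (Suc m) * C * b ^ m * \<theta> * D) * emeasure \<mu> (mball y (r y))"
    proof (intro mult_right_mono ennreal_leI)
      \<comment> \<open>Enlarging the second term by \<open>b ^ m\<close> merges the two
        contributions and turns \<open>m\<close> into \<open>Suc m\<close>.\<close>
      have "C * \<theta> * 1 \<le> C * \<theta> * b ^ m" using C \<theta> b1 by (intro mult_left_mono) auto
      then show "real m * C * b ^ m * \<theta> + C * \<theta> \<le> real (Suc m) * C * b ^ m * \<theta>"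
        by (simp add: algebra_simps)
    qed (use D in auto)
    finally have le: "emeasure \<mu> (A \<union> A2)
      \<le> ennreal (real (Suc m) * C * b ^ m * \<theta> * D) * emeasure \<mu> (mball y (r y))" .
    have "marked \<psi> P \<epsilon> \<rho> x" if x: "x \<in> mball y (r y) \<inter> supp - (A \<union> A2)" for x
    proof -
      have x3: "x \<in> mball y (3 * r y) \<inter> supp" using x r by auto
      then have "marked \<psi> (Q y) \<epsilon> \<rho> x" using A(3) x by blast
      then obtain F where F: "F \<subseteq> Q y" "finite F" "\<forall>s\<in>F. \<forall>t\<in>F. s \<le> t \<or> t \<le> s"
        "\<forall>s\<in>F. \<epsilon> \<le> \<psi> s x \<and> \<psi> s x < \<rho>"
        "\<forall>s\<in>Q y - F. (\<forall>t\<in>F. s \<le> t \<or> t \<le> s) \<longrightarrow> \<rho> \<le> \<psi> s x"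
        by (auto simp only: marked_def)
      have "\<epsilon> \<le> \<psi> ?s x" using x x3 by (auto simp: A2_def)
      moreover have "\<psi> ?s x < \<rho>" using r\<sigma>(4)[OF y] x by blast
      moreover have "insert ?s F \<subseteq> P" "finite (insert ?s F)" using F sP by (auto simp: Q_def)
      moreover have "s \<le> t \<or> t \<le> s" if "s \<in> insert ?s F" "t \<in> insert ?s F" for s t
      proof -
        have "s \<le> ?s \<or> ?s \<le> s" if "s \<in> F" for s using that F(1) by (auto simp: Q_def)
        then show ?thesis using that F(3) by blast
      qed
      moreover have "\<rho> \<le> \<psi> s x" if "s \<in> P - insert ?s F" "\<forall>t\<in>insert ?s F. s \<le> t \<or> t \<le> s" for s
      proof -
        have "s \<in> Q y - F" using that by (auto simp: Q_def)
        then show ?thesis using F(5) that(2) by blast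
      qed
      ultimately show ?thesis
        unfolding marked_def using F(4) by (intro exI[of _ "insert ?s F"] conjI ballI impI) auto
    qed
    then show ?thesis using le A(1) A2s by (intro bexI[of _ "A \<union> A2"]) auto
  qed
  then obtain A where A: "\<And>y. y \<in> E \<Longrightarrow> A y \<in> sets \<mu>"
    "\<And>y. y \<in> E \<Longrightarrow> emeasure \<mu> (A y) \<le> ennreal (real (Suc m) * C * b ^ m * \<theta> * D) * emeasure \<mu> (mball y (r y))"
    "\<And>y x. y \<in> E \<Longrightarrow> x \<in> mball y (r y) \<inter> supp - A y \<Longrightarrow> marked \<psi> P \<epsilon> \<rho> x"
    by metis
  have "E \<subseteq> mball x0 r0" by (auto simp: E_def)
  then have E: "E \<subseteq> M" "mbounded E"
    using mbounded_subset[OF mbounded_mball] mball_subset_mspace by blast+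
  obtain Y where Y: "Y \<subseteq> E" "countable Y" "E \<subseteq> (\<Union>y\<in>Y. mball y (r y))"
    "\<And>x. finite {y \<in> Y. x \<in> mball y (r y)}" "\<And>x. card {y \<in> Y. x \<in> mball y (r y)} \<le> N"
    using besicovitch_subfamily[OF E, of r] r\<sigma>(1) by blast
  \<comment> \<open>The selected balls have radius at most \<open>2 r0 / 3\<close> and stay inside
    the ball of radius \<open>3 r0\<close>; a second doubling returns to radius \<open>r0\<close>.
    With the overlap \<open>N\<close> this accounts for the factor \<open>N D\<^sup>2\<close> of
    each level.\<close>
  have "emeasure \<mu> (\<Union>y\<in>Y. A y) \<le> ennreal (real (Suc m) * C * b ^ m * \<theta> * D)
      * (of_nat N * emeasure \<mu> (mball x0 (3 * r0)))"
  proof (rule emeasure_UN_le_overlap[OF Y(2) Y(4,5)])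
    fix y assume "y \<in> Y"
    then have y: "y \<in> E" using Y by blast
    show "A y \<in> sets \<mu>" using A y by blast
    show "emeasure \<mu> (A y) \<le> ennreal (real (Suc m) * C * b ^ m * \<theta> * D) * emeasure \<mu> (mball y (r y))"
      using A y by blast
    have "d y x0 < r0" using y commute[of x0 y] by (auto simp: E_def)
    then show "mball y (r y) \<subseteq> mball x0 (3 * r0)"
      using r\<sigma>(3)[OF y] r0 by (intro mball_subset x0M) auto
  qed auto
  also have "\<dots> \<le> ennreal (real (Suc m) * C * b ^ m * \<theta> * D) * (of_nat N * (ennreal D * emeasure \<mu> (mball x0 r0)))"
  proof (intro mult_left_mono)
    have "3 * r0 \<le> 3 ^ Suc m * r0" using r0 by simp
    then have "mball x0 (3 * r0) \<subseteq> mball x0 (3 ^ Suc m * r0)" by (rule mball_subset_concentric)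
    then show "emeasure \<mu> (mball x0 (3 * r0)) \<le> ennreal D * emeasure \<mu> (mball x0 r0)"
      using dbl x0 r0 unfolding ball_doubling_def by blast
  qed auto
  also have "\<dots> = ennreal ((real (Suc m) * C * b ^ m * \<theta> * D) * (real N * D)) * emeasure \<mu> (mball x0 r0)"
    using C \<theta> D b1 by (simp add: ennreal_mult mult.assoc ennreal_of_nat_eq_real_of_nat)
  also have "(real (Suc m) * C * b ^ m * \<theta> * D) * (real N * D) = real (Suc m) * C * b ^ Suc m * \<theta>"
    by (simp add: b_def power2_eq_square algebra_simps)
  finally have le: "emeasure \<mu> (\<Union>y\<in>Y. A y) \<le> ennreal (real (Suc m) * C * b ^ Suc m * \<theta>) * emeasure \<mu> (mball x0 r0)" .
  have "marked \<psi> P \<epsilon> \<rho> x" if x: "x \<in> mball x0 r0 \<inter> supp - (\<Union>y\<in>Y. A y)" for x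
  proof (cases "x \<in> E")
    case True
    then obtain y where y: "y \<in> Y" "x \<in> mball y (r y)" using Y(3) by blast
    then show ?thesis using A(3)[of y x] x Y(1) by blast
  next
    case False
    then show ?thesis using x unfolding marked_def E_def by (intro exI[of _ "{}"]) auto
  qed
  moreover have "(\<Union>y\<in>Y. A y) \<in> sets \<mu>" using A(1) Y(1,2) by blast
  ultimately show ?case using le unfolding b_def \<theta>_def by blast
qed

end

section \<open>Covolumes of lattice subspaces\<close>

definition int_norm :: "int ^ 'm::finite \<Rightarrow> real" where
  "int_norm q = Max (range (\<lambda>i. \<bar>real_of_int (q $ i)\<bar>))"

definition ibox :: "real \<Rightarrow> (int ^ 'm::finite) set" where
  "ibox R = {q. int_norm q \<le> R}"

definition real_vec :: "int ^ 'm::finite \<Rightarrow> real ^ 'm" where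
  "real_vec q = (\<chi> i. real_of_int (q $ i))"

definition pts :: "(real ^ 'm::finite) set \<Rightarrow> real \<Rightarrow> (int ^ 'm) set" where
  "pts W R = {q \<in> ibox R. real_vec q \<in> W}"

definition cnt :: "(real ^ 'm::finite) set \<Rightarrow> real \<Rightarrow> real" where
  "cnt W R = real (card (pts W R))"

lemma int_norm_le_iff: "int_norm q \<le> R \<longleftrightarrow> (\<forall>i. \<bar>real_of_int (q $ i)\<bar> \<le> R)"
  unfolding int_norm_def by (subst Max_le_iff) auto

lemma int_norm_component: "\<bar>real_of_int (q $ i)\<bar> \<le> int_norm q"
  using int_norm_le_iff[of q "int_norm q"] by blast

lemma int_norm_ge_1:
  assumes "q \<noteq> 0"
  shows "int_norm q \<ge> 1"
proof -
  obtain i where "q $ i \<noteq> 0" using assms by (auto simp: vec_eq_iff)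
  then have "1 \<le> \<bar>q $ i\<bar>" by linarith
  then have "(1::real) \<le> \<bar>real_of_int (q $ i)\<bar>" by linarith
  then show ?thesis using int_norm_component[of q i] by linarith
qed

lemma int_norm_0 [simp]: "int_norm 0 = 0"
  by (simp add: int_norm_def)

lemma in_ibox: "q \<in> ibox R \<longleftrightarrow> (\<forall>i. \<bar>real_of_int (q $ i)\<bar> \<le> R)"
  by (simp add: ibox_def int_norm_le_iff)

lemma ibox_add: "a \<in> ibox R \<Longrightarrow> b \<in> ibox S \<Longrightarrow> a + b \<in> ibox (R + S)"
  by (auto simp: in_ibox intro: order_trans[OF abs_triangle_ineq add_mono])

lemma ibox_diff: "a \<in> ibox R \<Longrightarrow> b \<in> ibox S \<Longrightarrow> a - b \<in> ibox (R + S)"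
  by (auto simp: in_ibox intro: order_trans[OF abs_triangle_ineq4 add_mono])

lemma finite_ibox: "finite (ibox R :: (int ^ 'm::finite) set)"
proof -
  have "(ibox R :: (int ^ 'm) set) \<subseteq> (\<lambda>f. \<chi> i. f i) ` (PiE UNIV (\<lambda>_. {- \<lceil>R\<rceil>..\<lceil>R\<rceil>}))"
  proof
    fix q :: "int ^ 'm" assume q: "q \<in> ibox R"
    have "q $ i \<in> {- \<lceil>R\<rceil>..\<lceil>R\<rceil>}" for i
    proof -
      have "\<bar>real_of_int (q $ i)\<bar> \<le> R" using q in_ibox by blast
      then have "real_of_int \<bar>q $ i\<bar> \<le> of_int \<lceil>R\<rceil>" using le_of_int_ceiling[of R] by linarith
      then show ?thesis by auto
    qed
    then have "(\<lambda>i. q $ i) \<in> PiE UNIV (\<lambda>_. {- \<lceil>R\<rceil>..\<lceil>R\<rceil>})" by auto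
    moreover have "q = (\<chi> i. q $ i)" by (simp add: vec_eq_iff)
    ultimately show "q \<in> (\<lambda>f. \<chi> i. f i) ` (PiE UNIV (\<lambda>_. {- \<lceil>R\<rceil>..\<lceil>R\<rceil>}))" by blast
  qed
  then show ?thesis by (rule finite_subset) (intro finite_imageI finite_PiE, auto)
qed

lemma finite_pts [simp]: "finite (pts W R)"
  unfolding pts_def using finite_ibox by (rule finite_subset[rotated]) auto

lemma real_vec_add: "real_vec (a + b) = real_vec a + real_vec b"
  by (simp add: real_vec_def vec_eq_iff)

lemma real_vec_diff: "real_vec (a - b) = real_vec a - real_vec b"
  by (simp add: real_vec_def vec_eq_iff)

lemma real_vec_smult: "real_vec (c *s a) = real_of_int c *\<^sub>R real_vec a"
  by (simp add: real_vec_def vec_eq_iff)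

lemma real_vec_0 [simp]: "real_vec 0 = 0"
  by (simp add: real_vec_def vec_eq_iff)

lemma real_vec_sum: "real_vec (\<Sum>i\<in>A. f i) = (\<Sum>i\<in>A. real_vec (f i))"
  by (induction A rule: infinite_finite_induct) (simp_all add: real_vec_add)

lemma inj_real_vec: "inj real_vec"
  by (rule injI) (simp add: real_vec_def vec_eq_iff)

lemma real_vec_eq_iff [simp]: "real_vec a = real_vec b \<longleftrightarrow> a = b"
  using inj_real_vec by (auto dest: injD)

lemma real_vec_eq_0 [simp]: "real_vec a = 0 \<longleftrightarrow> a = 0"
  using real_vec_eq_iff[of a 0] by simp

lemma zero_in_pts: "subspace W \<Longrightarrow> R \<ge> 0 \<Longrightarrow> 0 \<in> pts W R"
  by (simp add: pts_def ibox_def subspace_0)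

lemma cnt_ge_1:
  assumes "subspace W" "R \<ge> 0"
  shows "cnt W R \<ge> 1"
proof -
  have "card (pts W R) > 0" using zero_in_pts[OF assms] by (auto simp: card_gt_0_iff)
  then show ?thesis by (simp add: cnt_def)
qed

text \<open>The box of size \<open>t R\<close> is cut into cells of side \<open>R\<close>, with at
  most \<open>2 t + 1\<close> cells in each direction. Subtracting a fixed point of the same cell
  maps the points of \<open>W\<close> in a cell injectively into \<open>pts W R\<close>.\<close>

lemma cnt_scale:
  fixes W :: "(real ^ 'm::finite) set"
  assumes W: "subspace W" and R: "R > 0"
  shows "cnt W (real t * R) \<le> (2 * real t + 1) ^ CARD('m) * cnt W R"
proof -
  define g where "g = (\<lambda>q :: int ^ 'm. \<lambda>i. \<lfloor>real_of_int (q $ i) / R\<rfloor>)"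
  let ?A = "pts W (real t * R)" and ?S = "PiE (UNIV :: 'm set) (\<lambda>_. {- int t..int t})"
  have img: "g ` ?A \<subseteq> ?S"
  proof (rule image_subsetI)
    fix q assume "q \<in> ?A"
    then have "\<bar>real_of_int (q $ i)\<bar> \<le> real t * R" for i by (simp add: pts_def in_ibox)
    then have b: "- real t \<le> real_of_int (q $ i) / R" "real_of_int (q $ i) / R \<le> real t" for i
      using R by (auto simp: field_simps abs_le_iff minus_le_iff)
    have "real_of_int (q $ i) / R < real t + 1" for i using b(2)[of i] by linarith
    then have "g q i \<in> {- int t..int t}" for i
      using b(1)[of i] unfolding g_def by (auto simp: le_floor_iff floor_le_iff)
    then show "g q \<in> ?S" by auto
  qed
  have fib: "card {q \<in> ?A. g q = y} \<le> card (pts W R)" for y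
  proof (cases "{q \<in> ?A. g q = y} = {}")
    case False
    then obtain q0 where q0: "q0 \<in> ?A" "g q0 = y" by blast
    have "(\<lambda>q. q - q0) ` {q \<in> ?A. g q = y} \<subseteq> pts W R"
    proof (rule image_subsetI)
      fix q assume "q \<in> {q \<in> ?A. g q = y}"
      then have q: "q \<in> ?A" "g q = y" by auto
      have "\<bar>real_of_int ((q - q0) $ i)\<bar> \<le> R" for i
      proof -
        have "g q i = g q0 i" using q q0 by simp
        then have "\<bar>real_of_int (q $ i) / R - real_of_int (q0 $ i) / R\<bar> < 1"
          unfolding g_def by linarith
        then have "\<bar>(real_of_int (q $ i) - real_of_int (q0 $ i)) / R\<bar> < 1" by (simp add: diff_divide_distrib)
        then show ?thesis using R by (simp add: abs_divide)
      qed
      moreover have "real_vec (q - q0) \<in> W"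
        using q q0 W by (simp add: real_vec_diff pts_def subspace_diff)
      ultimately show "q - q0 \<in> pts W R" by (simp add: pts_def in_ibox)
    qed
    moreover have "inj_on (\<lambda>q. q - q0) {q \<in> ?A. g q = y}" by (simp add: inj_on_def)
    ultimately show ?thesis using finite_pts[of W R] by (intro card_inj_on_le)
  next
    case True
    then show ?thesis by (metis card.empty zero_le)
  qed
  have finS: "finite ?S" by (intro finite_PiE) auto
  have "?A \<subseteq> (\<Union>y\<in>?S. {q \<in> ?A. g q = y})" using img by blast
  then have "card ?A \<le> card (\<Union>y\<in>?S. {q \<in> ?A. g q = y})"
    by (rule card_mono[rotated]) (use finS in auto)
  also have "\<dots> \<le> (\<Sum>y\<in>?S. card {q \<in> ?A. g q = y})" using finS by (rule card_UN_le)
  also have "\<dots> \<le> card ?S * card (pts W R)" using sum_bounded_above[of ?S, OF fib] by simp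
  also have "card ?S = (2 * t + 1) ^ CARD('m)"
  proof -
    have "nat (2 * int t + 1) = 2 * t + 1" by simp
    then show ?thesis by (simp add: card_PiE)
  qed
  finally have "real (card ?A) \<le> real ((2 * t + 1) ^ CARD('m) * card (pts W R))" by (simp only: of_nat_le_iff)
  then show ?thesis by (simp add: cnt_def add.commute)
qed

lemma additive_smult:
  fixes l :: "int ^ 'm::finite \<Rightarrow> 'a::comm_ring_1"
  assumes "Modules.additive l"
  shows "l (c *s q) = of_int c * l q"
proof -
  interpret Modules.additive l by fact
  have nat: "l (int n *s q) = of_nat n * l q" for n
    by (induction n) (simp_all add: zero add vector_sadd_rdistrib algebra_simps)
  show ?thesis
  proof (cases c rule: int_cases2)
    case (nonneg n)
    then show ?thesis using nat by simp
  next
    case (nonpos n)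
    then have "c *s q = - (int n *s q)" by (simp add: vec_eq_iff)
    then show ?thesis using nat[of n] nonpos by (simp add: minus)
  qed
qed

text \<open>Reduction to a fundamental parallelotope: in an expression of \<open>q\<close> by real
  multiples of the vectors in \<open>V\<close>, the fractional parts give the bounded
  \<open>z\<close>, and the integer parts give \<open>q - z\<close>. On the latter every additive
  \<open>l\<close> is as small as on \<open>V\<close>, by the ultrametric inequality.\<close>

lemma lattice_reduction:
  fixes q :: "int ^ 'm::finite"
  assumes V: "finite V" "V \<subseteq> ibox R" and R: "R \<ge> 0" and q: "real_vec q \<in> span (real_vec ` V)"
  shows "\<exists>z\<in>pts (span (real_vec ` V)) (real (card V) * R).
    \<forall>(l :: int ^ 'm \<Rightarrow> 'p::prime_card padic) \<delta>. Modules.additive l \<longrightarrow> \<delta> \<ge> 0 \<longrightarrow>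
      (\<forall>c\<in>V. padic_norm (l c) \<le> \<delta>) \<longrightarrow> padic_norm (l (q - z)) \<le> \<delta>"
proof -
  have "finite (real_vec ` V)" using V(1) by simp
  then obtain u where "real_vec q = (\<Sum>x\<in>real_vec ` V. u x *\<^sub>R x)"
    using q by (auto simp: span_finite)
  then have "real_vec q = (\<Sum>c\<in>V. u (real_vec c) *\<^sub>R real_vec c)"
    by (subst (asm) sum.reindex) (auto intro: inj_on_subset[OF inj_real_vec])
  then obtain t where t: "real_vec q = (\<Sum>c\<in>V. t c *\<^sub>R real_vec c)"
    by (metis (no_types))
  define w where "w = (\<Sum>c\<in>V. \<lfloor>t c\<rfloor> *s c)"
  have rz: "real_vec (q - w) = (\<Sum>c\<in>V. frac (t c) *\<^sub>R real_vec c)"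
    by (simp add: real_vec_diff t w_def real_vec_sum real_vec_smult frac_def scaleR_diff_left
        flip: sum_subtractf)
  have "\<bar>real_of_int ((q - w) $ i)\<bar> \<le> real (card V) * R" for i
  proof -
    have "real_of_int ((q - w) $ i) = real_vec (q - w) $ i" by (simp add: real_vec_def)
    also have "\<dots> = (\<Sum>c\<in>V. frac (t c) * real_of_int (c $ i))"
      by (simp only: rz sum_component) (simp add: real_vec_def)
    also have "\<bar>\<dots>\<bar> \<le> (\<Sum>c\<in>V. \<bar>frac (t c) * real_of_int (c $ i)\<bar>)" by (rule sum_abs)
    also have "\<dots> \<le> (\<Sum>c\<in>V. R)"
    proof (rule sum_mono)
      fix c assume "c \<in> V"
      then have "\<bar>real_of_int (c $ i)\<bar> \<le> R" using V(2) in_ibox by blast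
      moreover have "0 \<le> frac (t c)" "frac (t c) \<le> 1" by (simp_all add: frac_lt_1 less_imp_le)
      ultimately have "frac (t c) * \<bar>real_of_int (c $ i)\<bar> \<le> 1 * R" by (intro mult_mono) auto
      then show "\<bar>frac (t c) * real_of_int (c $ i)\<bar> \<le> R" by (simp add: abs_mult)
    qed
    finally show ?thesis by simp
  qed
  moreover have "real_vec (q - w) \<in> span (real_vec ` V)"
    unfolding rz by (intro span_sum span_scale span_base) auto
  ultimately have "q - w \<in> pts (span (real_vec ` V)) (real (card V) * R)"
    by (simp add: pts_def in_ibox)
  moreover have "padic_norm (l (q - (q - w))) \<le> \<delta>"
    if l: "Modules.additive l" and \<delta>: "\<delta> \<ge> 0" "\<forall>c\<in>V. padic_norm (l c) \<le> \<delta>"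
    for l :: "int ^ 'm \<Rightarrow> 'p padic" and \<delta>
  proof -
    interpret Modules.additive l by fact
    have "l (q - (q - w)) = (\<Sum>c\<in>V. of_int \<lfloor>t c\<rfloor> * l c)"
      by (simp add: w_def sum additive_smult[OF l])
    also have "padic_norm \<dots> \<le> \<delta>"
    proof (rule padic_norm_sum_le[OF \<delta>(1)])
      fix c assume "c \<in> V"
      then have "padic_norm (of_int \<lfloor>t c\<rfloor> :: 'p padic) * padic_norm (l c) \<le> 1 * \<delta>"
        using \<delta> by (intro mult_mono padic_norm_of_int_le_1) auto
      then show "padic_norm (of_int \<lfloor>t c\<rfloor> * l c) \<le> \<delta>" by (simp add: padic_norm_mult)
    qed
    finally show ?thesis .
  qed
  ultimately show ?thesis by blast
qed

text \<open>\<open>lat_index l k W R\<close> plays the role of the index in \<open>W \<inter> \<int>\<^sup>m\<close> of the sublattice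
  \<open>{q. padic_norm (l q) \<le> p\<^sup>-\<^sup>k}\<close>, and \<open>1 / cnt W R\<close> that of the covolume of \<open>W \<inter> \<int>\<^sup>m\<close> at scale
  \<open>R\<close>.\<close>

definition lat_index :: "(int ^ 'm::finite \<Rightarrow> 'p::prime_card padic) \<Rightarrow> nat \<Rightarrow> (real ^ 'm) set \<Rightarrow> real \<Rightarrow> real" where
  "lat_index l k W R = Max (insert 1 ((\<lambda>q. real CARD('p) ^ k * padic_norm (l q)) ` pts W R))"

definition covol :: "(int ^ 'm::finite \<Rightarrow> 'p::prime_card padic) \<Rightarrow> nat \<Rightarrow> real \<Rightarrow> (real ^ 'm) set \<Rightarrow> real" where
  "covol l k R W = lat_index l k W R / cnt W R"

lemma lat_index_ge_1: "lat_index l k W R \<ge> 1"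
  unfolding lat_index_def by (rule Max_ge) auto

lemma lat_index_ge:
  fixes l :: "int ^ 'm::finite \<Rightarrow> 'p::prime_card padic"
  shows "q \<in> pts W R \<Longrightarrow> real CARD('p) ^ k * padic_norm (l q) \<le> lat_index l k W R"
  unfolding lat_index_def by (rule Max_ge) auto

lemma lat_index_cases:
  fixes l :: "int ^ 'm::finite \<Rightarrow> 'p::prime_card padic"
  obtains "lat_index l k W R = 1"
  | q where "q \<in> pts W R" "lat_index l k W R = real CARD('p) ^ k * padic_norm (l q)"
proof -
  have "lat_index l k W R \<in> insert 1 ((\<lambda>q. real CARD('p) ^ k * padic_norm (l q)) ` pts W R)"
    unfolding lat_index_def by (rule Max_in) auto
  then show ?thesis using that by blast
qed

lemma lat_index_less_iff:
  fixes l :: "int ^ 'm::finite \<Rightarrow> 'p::prime_card padic"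
  shows "lat_index l k W R < c \<longleftrightarrow> 1 < c \<and> (\<forall>q\<in>pts W R. real CARD('p) ^ k * padic_norm (l q) < c)"
  unfolding lat_index_def by (subst Max_less_iff) auto

text \<open>The analogue of the bound of the covolume after adjoining \<open>v\<close> by the length
  of \<open>v\<close> times the old covolume. With \<open>u\<close> attaining the index
  \<open>I'\<close> of the larger space, the points \<open>red (j u) + t v + w\<close> for
  \<open>j\<close> below about \<open>I' / I\<close>, \<open>t\<close> up to about
  \<open>1 / \<epsilon>\<close> and \<open>w\<close> in \<open>pts W R\<close> are distinct:
  \<open>j\<close> is recovered from the norm of \<open>l\<close>, \<open>t\<close> modulo
  \<open>W\<close>, and then \<open>w\<close>. They lie in the box of size \<open>(m + 3) R\<close>,
  where \<open>m + 1\<close> is for the reduction and 1 each for \<open>t v\<close> and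
  \<open>w\<close>. Rescaling to \<open>R\<close> by \<open>cnt_scale\<close> produces the
  constant.\<close>

lemma covol_submult:
  fixes l :: "int ^ 'm::finite \<Rightarrow> 'p::prime_card padic"
  assumes l: "Modules.additive l" and R: "R > 0" and \<epsilon>: "0 < \<epsilon>" "\<epsilon> \<le> 1"
    and W: "W = span (real_vec ` pts W R)"
    and v: "v \<in> ibox (\<epsilon> * R)" "real_vec v \<notin> W" "padic_norm (l v) \<le> 1 / real CARD('p) ^ k"
  shows "covol l k R (span (insert (real_vec v) W))
     \<le> (2 * real (CARD('m) + 3) + 1) ^ CARD('m) * \<epsilon> * covol l k R W"
proof -
  interpret Modules.additive l by fact
  let ?p = "real CARD('p)" and ?m = "CARD('m)"
  have p: "?p > 1" by (rule CARD_prime_real_gt_1)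
  have pk: "?p ^ k > 0" using p by simp
  have sW: "subspace W" by (subst W) (rule subspace_span)
  define W' where "W' = span (insert (real_vec v) W)"
  have sW': "subspace W'" unfolding W'_def by (rule subspace_span)
  have WW': "W \<subseteq> W'" unfolding W'_def by (meson span_superset subset_insertI subset_trans)
  have vW': "real_vec v \<in> W'" unfolding W'_def by (rule span_base) simp
  define I where "I = lat_index l k W R"
  define I' where "I' = lat_index l k W' R"
  have I: "I \<ge> 1" "I' \<ge> 1" unfolding I_def I'_def by (rule lat_index_ge_1)+
  obtain b where b: "b \<subseteq> real_vec ` pts W R" "independent b" "real_vec ` pts W R \<subseteq> span b"
    by (rule maximal_independent_subset)
  have spb: "span b = W"
    using b W by (metis span_mono span_span subset_antisym span_minimal subspace_span)
  have finb: "finite b" using b(1) by (rule finite_subset) simp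
  have cb: "card b \<le> ?m" using independent_bound[OF b(2)] by simp
  obtain B where B: "B \<subseteq> pts W R" "b = real_vec ` B" using b(1) by (meson subset_imageE)
  have cB: "card B = card b" "finite B"
    unfolding B(2) using B(1) finite_subset[OF B(1)]
    by (auto intro!: card_image[symmetric] inj_on_subset[OF inj_real_vec])
  \<comment> \<open>A basis of \<open>W\<close> among its short integer points, enlarged by
    \<open>v\<close>. On all these vectors \<open>l\<close> has norm at most \<open>I / p^k\<close>,
    so reduction modulo \<open>V\<close> alters \<open>l\<close> by no more than that.\<close>
  define V where "V = insert v B"
  have V: "finite V" "card V \<le> ?m + 1" using cB cb by (auto simp: V_def intro: card_insert_le_m1 order_trans[OF card_insert_le_m1])
  have vR: "v \<in> ibox R"
    using order_trans[of "int_norm v" "\<epsilon> * R" "1 * R"] v(1) mult_right_mono[OF \<epsilon>(2), of R] R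
    by (simp add: ibox_def)
  have VR: "V \<subseteq> ibox R" using B(1) vR by (auto simp: V_def pts_def)
  have spV: "span (real_vec ` V) = W'"
  proof -
    have "span (insert (real_vec v) b) = span (insert (real_vec v) W)"
    proof (rule subset_antisym)
      show "span (insert (real_vec v) b) \<subseteq> span (insert (real_vec v) W)"
        using spb span_superset[of b] by (intro span_mono insert_mono) auto
      have "W \<subseteq> span (insert (real_vec v) b)" unfolding spb[symmetric] by (rule span_mono) auto
      then show "span (insert (real_vec v) W) \<subseteq> span (insert (real_vec v) b)"
        by (intro span_minimal subspace_span) (auto intro: span_base)
    qed
    then show ?thesis by (simp add: V_def W'_def B(2))
  qed
  have lV: "padic_norm (l c) \<le> I / ?p ^ k" if "c \<in> V" for c
  proof (cases "c = v")
    case True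
    then show ?thesis using v(3) I(1) pk divide_right_mono[of 1 I "?p ^ k"] by simp
  next
    case False
    then have "c \<in> pts W R" using that B(1) by (auto simp: V_def)
    then show ?thesis using lat_index_ge[of c W R k l] pk by (simp add: I_def field_simps)
  qed
  have "\<exists>z\<in>pts W' (real (card V) * R). padic_norm (l (q - z)) \<le> I / ?p ^ k" if q: "real_vec q \<in> W'" for q
  proof -
    obtain z where z: "z \<in> pts W' (real (card V) * R)"
      "\<forall>(l :: int ^ 'm \<Rightarrow> 'p padic) \<delta>. Modules.additive l \<longrightarrow> \<delta> \<ge> 0 \<longrightarrow>
        (\<forall>c\<in>V. padic_norm (l c) \<le> \<delta>) \<longrightarrow> padic_norm (l (q - z)) \<le> \<delta>"
      using lattice_reduction[OF V(1) VR less_imp_le[OF R], of q, where 'p='p] q unfolding spV by blast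
    have "I / ?p ^ k \<ge> 0" using I pk by simp
    then show ?thesis using z l lV by blast
  qed
  then obtain red where red: "\<And>q. real_vec q \<in> W' \<Longrightarrow> red q \<in> pts W' (real (card V) * R)"
    "\<And>q. real_vec q \<in> W' \<Longrightarrow> padic_norm (l (q - red q)) \<le> I / ?p ^ k" by metis
  \<comment> \<open>Rounding up serves both ends: \<open>J\<close> is large enough for the count,
    while differences of indices are at most \<open>J - 1\<close>, which is still below
    \<open>I' / I\<close>.\<close>
  define J where "J = nat \<lceil>I' / I\<rceil>"
  have I0: "I' / I > 0" using I by simp
  then have J: "real J \<ge> I' / I" "real J - 1 < I' / I" unfolding J_def by linarith+
  then have J1: "J \<ge> 1" using I0 by (cases J) auto
  \<comment> \<open>If the index of the larger space is the default value 1, no point need attain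
    it; then \<open>J = 1\<close>, only \<open>j = 0\<close> occurs, and any \<open>u\<close> will
    do.\<close>
  have "\<exists>u\<in>pts W' R. J > 1 \<longrightarrow> I' = ?p ^ k * padic_norm (l u)"
  proof (cases "J > 1")
    case True
    then have "I' / I > 1" using J(2) by linarith
    then have "I' > 1" using I by (simp add: field_simps)
    then show ?thesis using lat_index_cases[of l k W' R] unfolding I'_def by (metis less_irrefl)
  next
    case False
    then show ?thesis using zero_in_pts[OF sW', of R] R by auto
  qed
  then obtain u where u: "u \<in> pts W' R" "J > 1 \<Longrightarrow> I' = ?p ^ k * padic_norm (l u)" by blast
  have uW': "real_vec (int j *s u) \<in> W'" for j
    using u(1) by (auto simp: real_vec_smult pts_def intro: subspace_scale[OF sW'])
  define T where "T = nat \<lfloor>1 / \<epsilon>\<rfloor>"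
  have T: "real T \<le> 1 / \<epsilon>" "1 / \<epsilon> \<le> real T + 1" using \<epsilon> zero_le_divide_1_iff[of \<epsilon>] unfolding T_def by linarith+
  define \<Phi> where "\<Phi> = (\<lambda>(j, t, w). red (int j *s u) + int t *s v + w)"
  have sub: "\<Phi> ` ({..<J} \<times> {..T} \<times> pts W R) \<subseteq> pts W' (real (?m + 3) * R)"
  proof safe
    fix j t w assume jtw: "j < J" "t \<le> T" "w \<in> pts W R"
    have "int t *s v \<in> ibox R" unfolding in_ibox
    proof
      fix i
      have "\<bar>real_of_int (v $ i)\<bar> \<le> \<epsilon> * R" using v(1) in_ibox by blast
      then have "real t * \<bar>real_of_int (v $ i)\<bar> \<le> (1 / \<epsilon>) * (\<epsilon> * R)"
        using T(1) jtw(2) \<epsilon> R by (intro mult_mono) auto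
      then show "\<bar>real_of_int ((int t *s v) $ i)\<bar> \<le> R" using \<epsilon> by (simp add: abs_mult)
    qed
    moreover have "red (int j *s u) \<in> ibox (real (card V) * R)" using red(1)[OF uW'] by (simp add: pts_def)
    moreover have "w \<in> ibox R" using jtw by (simp add: pts_def)
    ultimately have "\<Phi> (j, t, w) \<in> ibox (real (card V) * R + R + R)"
      unfolding \<Phi>_def prod.case by (intro ibox_add)
    moreover have "real (card V) * R + R + R \<le> real (?m + 3) * R"
    proof -
      have "real (card V) \<le> real (?m + 1)" using V(2) by (simp only: of_nat_le_iff)
      then have "real (card V) * R \<le> real (?m + 1) * R" using R by (intro mult_right_mono) auto
      then show ?thesis by (simp add: algebra_simps)
    qed
    ultimately have "\<Phi> (j, t, w) \<in> ibox (real (?m + 3) * R)" by (auto simp: ibox_def)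
    moreover have "real_vec (\<Phi> (j, t, w)) \<in> W'"
      using red(1)[OF uW'[of j]] vW' jtw(3) WW'
      by (auto simp: \<Phi>_def real_vec_add real_vec_smult pts_def intro!: subspace_add[OF sW'] subspace_scale[OF sW'])
    ultimately show "\<Phi> (j, t, w) \<in> pts W' (real (?m + 3) * R)" by (simp add: pts_def)
  qed
  have inj: "inj_on \<Phi> ({..<J} \<times> {..T} \<times> pts W R)"
  proof (rule inj_onI)
    fix x x' assume x: "x \<in> {..<J} \<times> {..T} \<times> pts W R" "x' \<in> {..<J} \<times> {..T} \<times> pts W R" "\<Phi> x = \<Phi> x'"
    obtain j t w where xj: "x = (j, t, w)" by (cases x)
    obtain j' t' w' where xj': "x' = (j', t', w')" by (cases x')
    have jtw: "j < J" "t \<le> T" "w \<in> pts W R" "j' < J" "t' \<le> T" "w' \<in> pts W R"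
      and eq: "\<Phi> (j, t, w) = \<Phi> (j', t', w')"
      using x by (auto simp: xj xj')
    have lw: "padic_norm (l w) \<le> I / ?p ^ k" "padic_norm (l w') \<le> I / ?p ^ k"
      using lat_index_ge[of w W R k l] lat_index_ge[of w' W R k l] jtw pk by (simp_all add: I_def field_simps)
    have lt: "padic_norm (l (int t *s v)) \<le> I / ?p ^ k" for t
    proof -
      have "padic_norm (of_int (int t) :: 'p padic) * padic_norm (l v) \<le> 1 * (I / ?p ^ k)"
        using lV[of v] by (intro mult_mono padic_norm_of_int_le_1) (auto simp: V_def)
      then show ?thesis by (simp add: additive_smult[OF l] padic_norm_mult)
    qed
    have jj: "j = j'"
    proof (rule ccontr)
      assume ne: "j \<noteq> j'"
      define a where "a = int j *s u"
      define a' where "a' = int j' *s u"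
      \<comment> \<open>Every bracket has \<open>l\<close> of norm at most \<open>I / p^k\<close>,
        whereas the norm of \<open>l\<close> at \<open>n u\<close> is at least that at
        \<open>u\<close> divided by \<open>n\<close>, which exceeds this bound for \<open>n\<close>
        below \<open>I' / I\<close>.\<close>
      have "a - a' = (a - red a) - (a' - red a') + (int t' *s v - int t *s v) + (w' - w)"
        using eq by (simp add: \<Phi>_def a_def a'_def algebra_simps)
      then have "l (a - a') = (l (a - red a) - l (a' - red a')) + (l (int t' *s v) - l (int t *s v)) + (l w' - l w)"
        by (simp only: add diff)
      also have "padic_norm \<dots> \<le> I / ?p ^ k"
        using red(2)[OF uW'[of j]] red(2)[OF uW'[of j']] lt[of t] lt[of t'] lw
        unfolding a_def a'_def by (intro padic_norm_add_le padic_norm_diff_le)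
      finally have le: "padic_norm (l (a - a')) \<le> I / ?p ^ k" .
      define n where "n = (if j < j' then j' - j else j - j')"
      have n: "n > 0" "real n \<le> real J - 1" using ne jtw by (auto simp: n_def)
      have "a - a' = int n *s u \<or> a - a' = - (int n *s u)"
        unfolding a_def a'_def n_def by (auto simp: vec_eq_iff algebra_simps of_nat_diff)
      then have "padic_norm (l (a - a')) = padic_norm (l (int n *s u))"
        by (elim disjE) (simp_all add: minus)
      also have "\<dots> = padic_norm (of_nat n :: 'p padic) * padic_norm (l u)"
        by (simp add: additive_smult[OF l] padic_norm_mult)
      also have "\<dots> \<ge> 1 / real n * padic_norm (l u)"
        using padic_norm_of_nat_ge[OF n(1)] by (intro mult_right_mono) auto
      finally have 1: "padic_norm (l u) / real n \<le> I / ?p ^ k" using le by simp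
      have "J > 1" using n by linarith
      then have "padic_norm (l u) = I' / ?p ^ k" using u(2) pk by (simp add: field_simps)
      then have "I' / real n \<le> I" using 1 pk by (simp add: field_simps)
      then have "I' / I \<le> real n" using n(1) I by (simp add: field_simps)
      then show False using n(2) J(2) by linarith
    qed
    have eq2: "int t *s v + w = int t' *s v + w'" using eq jj by (simp add: \<Phi>_def)
    have tt: "t = t'"
    proof (rule ccontr)
      assume ne: "t \<noteq> t'"
      have "real_vec (int t *s v + w) = real_vec (int t' *s v + w')" using eq2 by (rule arg_cong)
      then have "(real t - real t') *\<^sub>R real_vec v = real_vec w' - real_vec w"
        by (simp add: real_vec_add real_vec_smult algebra_simps)
      also have "\<dots> \<in> W" using jtw by (intro subspace_diff[OF sW]) (auto simp: pts_def)
      finally have "(1 / (real t - real t')) *\<^sub>R ((real t - real t') *\<^sub>R real_vec v) \<in> W"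
        by (rule subspace_scale[OF sW])
      then show False using ne v(2) by simp
    qed
    show "x = x'" using jj tt eq2 by (simp add: xj xj')
  qed
  have "J * (T + 1) * card (pts W R) = card (\<Phi> ` ({..<J} \<times> {..T} \<times> pts W R))"
    using inj by (simp add: card_image card_cartesian_product algebra_simps)
  also have "\<dots> \<le> card (pts W' (real (?m + 3) * R))" using sub by (intro card_mono) auto
  finally have "real (J * (T + 1) * card (pts W R)) \<le> cnt W' (real (?m + 3) * R)"
    unfolding cnt_def by (simp only: of_nat_le_iff)
  then have "real J * (real T + 1) * cnt W R \<le> cnt W' (real (?m + 3) * R)" by (simp add: cnt_def algebra_simps)
  also have "\<dots> \<le> (2 * real (?m + 3) + 1) ^ ?m * cnt W' R" by (rule cnt_scale[OF sW' R])
  finally have main: "real J * (real T + 1) * cnt W R \<le> (2 * real (?m + 3) + 1) ^ ?m * cnt W' R" .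
  have c1: "cnt W R \<ge> 1" "cnt W' R \<ge> 1" using cnt_ge_1[OF sW, of R] cnt_ge_1[OF sW', of R] R by auto
  have "I' / I * (1 / \<epsilon>) * cnt W R \<le> real J * (real T + 1) * cnt W R"
    using J J1 T I \<epsilon> c1 by (intro mult_right_mono mult_mono) auto
  then have "I' / I * (1 / \<epsilon>) * cnt W R \<le> (2 * real (?m + 3) + 1) ^ ?m * cnt W' R" using main by linarith
  then have "I' / cnt W' R \<le> (2 * real (?m + 3) + 1) ^ ?m * \<epsilon> * (I / cnt W R)"
    using I \<epsilon> c1 by (simp add: field_simps)
  then show ?thesis by (simp add: covol_def I_def I'_def W'_def)
qed


text \<open>Subspaces spanned by their integer points of norm at most \<open>R\<close>: for these,
  reduction modulo such points costs only a factor depending on the dimension, so that counting at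
  the single scale \<open>R\<close> reflects the covolume. The zero space is left out because its
  covolume is 1 and never large by itself.\<close>

definition lattice_spaces :: "real \<Rightarrow> (real ^ 'm::finite) set set" where
  "lattice_spaces R = {W. W \<noteq> {0} \<and> W = span (real_vec ` pts W R)}"

lemma subspace_lattice_spaces: "W \<in> lattice_spaces R \<Longrightarrow> subspace W"
  unfolding lattice_spaces_def by (metis (mono_tags) mem_Collect_eq subspace_span)

text \<open>Members of a chain are told apart by their dimension, which is between 1 and
  \<open>CARD('m)\<close>. This bounds the depth of the induction in
  \<open>nondivergence\<close>.\<close>

lemma lattice_spaces_chain:
  fixes F :: "(real ^ 'm::finite) set set"
  assumes "F \<subseteq> lattice_spaces R" "finite F" "\<forall>s\<in>F. \<forall>t\<in>F. s \<le> t \<or> t \<le> s"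
  shows "card F \<le> CARD('m)"
proof -
  have sub: "subspace s" if "s \<in> F" for s using that assms(1) subspace_lattice_spaces by blast
  have "inj_on dim F"
  proof (rule inj_onI)
    fix s t assume st: "s \<in> F" "t \<in> F" "dim s = dim t"
    then show "s = t" using assms(3) sub subspace_dim_equal by (metis order_refl)
  qed
  moreover have "dim ` F \<subseteq> {1..CARD('m)}"
  proof (rule image_subsetI)
    fix s assume s: "s \<in> F"
    have "dim s \<le> CARD('m)" using dim_subset_UNIV[of s] by simp
    moreover have "dim s \<noteq> 0"
    proof
      assume "dim s = 0"
      then have "s \<subseteq> {0}" by simp
      then show False using s assms(1) subspace_0[OF sub[OF s]] by (auto simp: lattice_spaces_def)
    qed
    ultimately show "dim s \<in> {1..CARD('m)}" unfolding atLeastAtMost_iff by linarith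
  qed
  ultimately have "card F \<le> card {1..CARD('m)}" by (intro card_inj_on_le) auto
  then show ?thesis by simp
qed

lemma lattice_spaces_insert:
  assumes W: "W = span (real_vec ` pts W R)" and v: "v \<in> ibox R" "v \<noteq> 0"
  shows "span (insert (real_vec v) W) \<in> lattice_spaces R"
proof -
  let ?W = "span (insert (real_vec v) W)"
  have v': "real_vec v \<in> ?W" by (rule span_base) simp
  have "v \<in> pts ?W R" using v v' by (simp add: pts_def)
  moreover have "pts W R \<subseteq> pts ?W R" by (auto simp: pts_def intro: span_base)
  ultimately have "insert (real_vec v) W \<subseteq> span (real_vec ` pts ?W R)"
    using W span_mono[of "real_vec ` pts W R" "real_vec ` pts ?W R"] by (auto intro: span_base)
  then have "?W \<subseteq> span (real_vec ` pts ?W R)" by (intro span_minimal subspace_span)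
  moreover have "span (real_vec ` pts ?W R) \<subseteq> ?W"
    by (intro span_minimal subspace_span) (auto simp: pts_def)
  moreover have "?W \<noteq> {0}"
  proof
    assume "?W = {0}"
    then have "real_vec v = 0" using v' by blast
    then show False using v(2) by simp
  qed
  ultimately show ?thesis unfolding lattice_spaces_def by blast
qed

text \<open>A short vector \<open>v\<close> of the lattice of \<open>l\<close> would have a place in the flag: adjoining it to the
  largest member not containing it gives a member or a space comparable with all members, of too
  small covolume.\<close>

lemma no_short_vector:
  fixes l :: "int ^ 'm::finite \<Rightarrow> 'p::prime_card padic"
  assumes l: "Modules.additive l" and R: "R > 0" and \<epsilon>: "0 < \<epsilon>" "\<epsilon> \<le> 1"
    and F: "F \<subseteq> lattice_spaces R" "finite F" "\<forall>s\<in>F. \<forall>t\<in>F. s \<le> t \<or> t \<le> s"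
    and F1: "\<forall>s\<in>F. \<epsilon>' \<le> covol l k R s \<and> covol l k R s < \<rho>"
    and F2: "\<forall>s\<in>lattice_spaces R - F. (\<forall>t\<in>F. s \<le> t \<or> t \<le> s) \<longrightarrow> \<rho> \<le> covol l k R s"
    and \<rho>: "\<epsilon>' \<le> \<rho>" "\<rho> \<le> 1"
    and \<epsilon>': "(2 * real (CARD('m) + 3) + 1) ^ CARD('m) * \<epsilon> < \<epsilon>'"
    and v: "v \<noteq> 0" "v \<in> ibox (\<epsilon> * R)"
  shows "padic_norm (l v) > 1 / real CARD('p) ^ k"
proof (rule ccontr)
  assume "\<not> ?thesis"
  then have lv: "padic_norm (l v) \<le> 1 / real CARD('p) ^ k" by simp
  interpret Modules.additive l by fact
  \<comment> \<open>The zero space guarantees a member without \<open>v\<close> even when every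
    member of the flag contains \<open>v\<close>.\<close>
  define F0 where "F0 = insert {0} {s \<in> F. real_vec v \<notin> s}"
  have sub0: "subspace s" if "s \<in> F" for s using that F(1) subspace_lattice_spaces by blast
  have sub: "subspace s" if "s \<in> F0" for s
    using that sub0 by (auto simp: F0_def subspace_single_0)
  have "finite F0" "F0 \<noteq> {}" using F(2) by (auto simp: F0_def)
  then obtain W where W: "W \<in> F0" "\<And>s. s \<in> F0 \<Longrightarrow> W \<le> s \<Longrightarrow> W = s"
    using finite_has_maximal[of F0] by metis
  have sW: "subspace W" using W(1) sub by blast
  have chain: "W \<le> s \<or> s \<le> W" if "s \<in> F" for s
    using W(1) F(3) that subspace_0[OF sub0[OF that]] by (auto simp: F0_def)
  have vW: "real_vec v \<notin> W" using W(1) v(1) by (auto simp: F0_def)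
  have spW: "W = span (real_vec ` pts W R)"
  proof (cases "W = {0}")
    case True
    then have "real_vec ` pts W R \<subseteq> {0}" by (auto simp: pts_def)
    then have "span (real_vec ` pts W R) \<subseteq> {0}" by (intro span_minimal subspace_single_0)
    then show ?thesis using True span_0 by blast
  next
    case False
    then show ?thesis using W(1) F(1) by (auto simp: F0_def lattice_spaces_def)
  qed
  define W' where "W' = span (insert (real_vec v) W)"
  have "int_norm v \<le> R"
    using order_trans[of "int_norm v" "\<epsilon> * R" "1 * R"] v(2) mult_right_mono[OF \<epsilon>(2), of R] R
    by (simp add: ibox_def)
  then have W'P: "W' \<in> lattice_spaces R"
    unfolding W'_def using v(1) by (intro lattice_spaces_insert[OF spW]) (auto simp: ibox_def)
  \<comment> \<open>A member containing \<open>v\<close> cannot lie inside \<open>W\<close>, hence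
    contains \<open>W\<close> and then \<open>W'\<close>; a member without \<open>v\<close> lies
    inside \<open>W\<close> by maximality.\<close>
  have comp: "W' \<le> s \<or> s \<le> W'" if s: "s \<in> F" for s
  proof (cases "real_vec v \<in> s")
    case True
    have "W \<le> s"
    proof (cases "s \<le> W")
      case True
      then show ?thesis using vW \<open>real_vec v \<in> s\<close> by blast
    qed (use chain s in blast)
    then show ?thesis unfolding W'_def using True sub0[OF s] by (intro disjI1 span_minimal) auto
  next
    case False
    then have "s \<in> F0" using s by (simp add: F0_def)
    then have "s \<le> W" using chain[OF s] W(2)[of s] by blast
    moreover have "W \<le> W'" unfolding W'_def by (meson span_superset subset_insertI subset_trans)
    ultimately show ?thesis by blast
  qed
  have "\<epsilon>' \<le> covol l k R W'"
  proof (cases "W' \<in> F")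
    case True
    then show ?thesis using F1 by blast
  next
    case False
    then have "\<rho> \<le> covol l k R W'" using F2 W'P comp by blast
    then show ?thesis using \<rho> by linarith
  qed
  also have "\<dots> \<le> (2 * real (CARD('m) + 3) + 1) ^ CARD('m) * \<epsilon> * covol l k R W"
    unfolding W'_def using l R \<epsilon> spW v(2) vW lv by (rule covol_submult)
  also have "\<dots> \<le> (2 * real (CARD('m) + 3) + 1) ^ CARD('m) * \<epsilon> * 1"
  proof (intro mult_left_mono)
    show "covol l k R W \<le> 1"
    proof (cases "W \<in> F")
      case True
      then show ?thesis using F1 \<rho> by fastforce
    next
      case False
      then have W0: "W = {0}" using W(1) by (auto simp: F0_def)
      \<comment> \<open>The zero space has one point, and its index is the default value 1, so its
        covolume is exactly 1.\<close>
      have "pts W R = {0}" using R by (auto simp: W0 pts_def ibox_def)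
      then show ?thesis by (simp add: covol_def lat_index_def cnt_def zero)
    qed
  qed (use \<epsilon> in auto)
  finally show False using \<epsilon>' by simp
qed

text \<open>A sublevel set of the covolume is thus given by finitely many conditions on the norms
  \<open>|l(q)|\<close>, from which it inherits measurability and semicontinuity.\<close>

lemma covol_less_iff:
  fixes l :: "int ^ 'm::finite \<Rightarrow> 'p::prime_card padic"
  assumes W: "subspace W" and R: "R > 0"
  shows "covol l k R W < c \<longleftrightarrow> 1 < c * cnt W R \<and>
    (\<forall>q\<in>pts W R. padic_norm (l q) < c * cnt W R / real CARD('p) ^ k)"
proof -
  have "real CARD('p) ^ k > 0" using CARD_prime_ge_2[where 'p='p] by simp
  moreover have "cnt W R > 0" using cnt_ge_1[OF W, of R] R by simp
  ultimately show ?thesis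
    by (simp add: covol_def pos_divide_less_eq lat_index_less_iff pos_less_divide_eq mult.commute)
qed

section \<open>Covolumes as functions on the space\<close>

context besicovitch_measure
begin

lemma usc_finite:
  assumes "finite S" and "y \<in> M"
    and "\<And>q. q \<in> S \<Longrightarrow> \<exists>r>0. \<forall>z\<in>mball y r. Q q z"
  shows "\<exists>r>0. \<forall>q\<in>S. \<forall>z\<in>mball y r. Q q z"
  using assms(1,3)
proof (induction S)
  case empty
  then show ?case by (intro exI[of _ 1]) auto
next
  case (insert x S)
  obtain r1 where r1: "r1 > 0" "\<forall>q\<in>S. \<forall>z\<in>mball y r1. Q q z" using insert by blast
  obtain r2 where r2: "r2 > 0" "\<forall>z\<in>mball y r2. Q x z" using insert by blast
  have "mball y (min r1 r2) \<subseteq> mball y r1" "mball y (min r1 r2) \<subseteq> mball y r2"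
    by (intro mball_subset_concentric; simp)+
  then show ?case using r1 r2 by (intro exI[of _ "min r1 r2"]) (auto simp del: in_mball)
qed

lemma covol_usc:
  fixes l :: "'x \<Rightarrow> int ^ 'm::finite \<Rightarrow> 'p::prime_card padic"
  assumes usc: "\<And>y q c. y \<in> M \<Longrightarrow> padic_norm (l y q) < c \<Longrightarrow> \<exists>r>0. \<forall>z\<in>mball y r. padic_norm (l z q) < c"
    and W: "subspace W" and R: "R > 0" and y: "y \<in> M" "covol (l y) k R W < c"
  shows "\<exists>r>0. \<forall>z\<in>mball y r. covol (l z) k R W < c"
proof -
  note iff = covol_less_iff[OF W R]
  have "\<exists>r>0. \<forall>q\<in>pts W R. \<forall>z\<in>mball y r. padic_norm (l z q) < c * cnt W R / real CARD('p) ^ k"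
    using y unfolding iff by (intro usc_finite usc) auto
  then show ?thesis using y unfolding iff by blast
qed

lemma covol_measurable:
  fixes l :: "'x \<Rightarrow> int ^ 'm::finite \<Rightarrow> 'p::prime_card padic"
  assumes meas: "\<And>q c. {x \<in> M. padic_norm (l x q) < c} \<in> sets \<mu>"
    and W: "subspace W" and R: "R > 0"
  shows "{x \<in> M. covol (l x) k R W < c} \<in> sets \<mu>"
proof -
  note iff = covol_less_iff[OF W R]
  have ne: "pts W R \<noteq> {}" using zero_in_pts[OF W, of R] R by auto
  have "{x \<in> M. covol (l x) k R W < c} = (if 1 < c * cnt W R then
      (\<Inter>q\<in>pts W R. {x \<in> M. padic_norm (l x q) < c * cnt W R / real CARD('p) ^ k}) else {})"
    unfolding iff using ne by auto
  then show ?thesis using meas ne by (auto intro!: sets.finite_INT)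
qed

text \<open>If the maximum at \<open>z\<close> is attained at \<open>q\<close>, the sublevel set of
  the covolume lies in that of \<open>|l(q)|\<close>, and the constants are those of
  \<open>|l(q)|\<close>. If it is the default value 1, the sublevel set is empty for
  \<open>\<epsilon> * cnt W R \<le> 1\<close>, and otherwise the asserted bound exceeds the whole
  ball, as \<open>C \<ge> 1\<close>.\<close>

lemma covol_good:
  fixes l :: "'x \<Rightarrow> int ^ 'm::finite \<Rightarrow> 'p::prime_card padic"
  assumes meas: "\<And>q c. {x \<in> M. padic_norm (l x q) < c} \<in> sets \<mu>"
    and good: "\<And>q. ball_good C \<alpha> U (\<lambda>x. padic_norm (l x q))"
    and C: "C \<ge> 1" and \<alpha>: "\<alpha> > 0" and W: "subspace W" and R: "R > 0"
  shows "ball_good C \<alpha> U (\<lambda>x. covol (l x) k R W)"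
  unfolding ball_good_def
proof (intro ballI allI impI)
  fix x r z \<epsilon> assume x: "x \<in> supp" and r: "0 < r" "mball x r \<subseteq> U"
    and z: "z \<in> mball x r \<inter> supp" and \<epsilon>: "0 < (\<epsilon>::real)" and pos: "0 < covol (l z) k R W"
  have p: "real CARD('p) ^ k > 0" using CARD_prime_ge_2[where 'p='p] by simp
  have c: "cnt W R > 0" using cnt_ge_1[OF W, of R] R by simp
  let ?S = "{y \<in> mball x r. covol (l y) k R W < \<epsilon>}"
  show "emeasure \<mu> ?S \<le> ennreal (C * (\<epsilon> / covol (l z) k R W) powr \<alpha>) * emeasure \<mu> (mball x r)"
  proof (cases rule: lat_index_cases[of "l z" k W R])
    case 1
    then have cz: "covol (l z) k R W = 1 / cnt W R" by (simp add: covol_def)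
    show ?thesis
    proof (cases "\<epsilon> * cnt W R \<le> 1")
      case True
      have "\<not> covol (l y) k R W < \<epsilon>" for y
        using lat_index_ge_1[of "l y" k W R] True c by (simp add: covol_def field_simps)
      then have "?S = {}" by blast
      then show ?thesis by (simp only: emeasure_empty zero_le)
    next
      case False
      have "emeasure \<mu> ?S \<le> 1 * emeasure \<mu> (mball x r)" by (auto intro: emeasure_mono)
      also have "\<dots> \<le> ennreal (C * (\<epsilon> / covol (l z) k R W) powr \<alpha>) * emeasure \<mu> (mball x r)"
      proof (rule mult_right_mono)
        have "1 \<le> (\<epsilon> * cnt W R) powr \<alpha>" using False \<alpha> by (intro ge_one_powr_ge_zero) auto
        then have "1 * 1 \<le> C * (\<epsilon> * cnt W R) powr \<alpha>" using C by (intro mult_mono) auto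
        then show "1 \<le> ennreal (C * (\<epsilon> / covol (l z) k R W) powr \<alpha>)"
          by (simp add: cz ennreal_ge_1)
      qed simp
      finally show ?thesis .
    qed
  next
    case (2 q)
    define e where "e = \<epsilon> * cnt W R / real CARD('p) ^ k"
    have cz: "covol (l z) k R W = real CARD('p) ^ k * padic_norm (l z q) / cnt W R" using 2 by (simp add: covol_def)
    have nz: "padic_norm (l z q) > 0" using pos c p by (simp add: cz zero_less_divide_iff zero_less_mult_iff)
    have "?S \<subseteq> {y \<in> mball x r. padic_norm (l y q) < e}"
    proof safe
      fix y assume "covol (l y) k R W < \<epsilon>"
      then have "lat_index (l y) k W R < \<epsilon> * cnt W R" using c by (simp add: covol_def field_simps)
      then show "padic_norm (l y q) < e"
        using 2(1) p unfolding lat_index_less_iff e_def by (simp add: field_simps)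
    qed
    moreover have "{y \<in> mball x r. padic_norm (l y q) < e} \<in> sets \<mu>"
    proof -
      have "{y \<in> mball x r. padic_norm (l y q) < e} = mball x r \<inter> {y \<in> M. padic_norm (l y q) < e}" by auto
      then show ?thesis using meas by auto
    qed
    ultimately have "emeasure \<mu> ?S \<le> emeasure \<mu> {y \<in> mball x r. padic_norm (l y q) < e}"
      by (rule emeasure_mono)
    also have "\<dots> \<le> ennreal (C * (e / padic_norm (l z q)) powr \<alpha>) * emeasure \<mu> (mball x r)"
      by (rule good[unfolded ball_good_def, rule_format])
        (use x r z nz \<epsilon> c p in \<open>auto simp: e_def\<close>)
    also have "e / padic_norm (l z q) = \<epsilon> / covol (l z) k R W"
      using nz c p by (simp add: cz e_def)
    finally show ?thesis .
  qed
qed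

end

section \<open>Transfer of Diophantine exponents\<close>

definition int_approx :: "(int ^ 'm::finite \<Rightarrow> 'p::prime_card padic) \<Rightarrow> real \<Rightarrow> (int ^ 'm) set" where
  "int_approx l v = {q. padic_norm (l q) \<le> int_norm q powr (- v)}"

text \<open>Finitely many nonzero approximants have \<open>|l(q)|\<close> bounded below by some
  \<open>\<delta> > 0\<close>. Once \<open>p^-k < \<delta>\<close>, a nonzero vector of norm at most
  \<open>p^(k/v)\<close> with \<open>|l(q)| \<le> p^-k\<close> would be an approximant below
  \<open>\<delta>\<close>.\<close>

lemma no_short_vector_of_finite:
  fixes l :: "int ^ 'm::finite \<Rightarrow> 'p::prime_card padic"
  assumes l: "Modules.additive l" and v: "v > 0" and fin: "finite (int_approx l v)"
  shows "\<exists>k0. \<forall>k\<ge>k0. \<forall>q. q \<noteq> 0 \<longrightarrow> int_norm q \<le> real CARD('p) powr (real k / v) \<longrightarrow>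
    padic_norm (l q) > 1 / real CARD('p) ^ k"
proof -
  let ?p = "real CARD('p)"
  have p: "?p > 1" by (rule CARD_prime_real_gt_1)
  let ?S = "int_approx l v - {0}"
  \<comment> \<open>A nonzero zero of \<open>l\<close> would make all its multiples
    approximants.\<close>
  have nz: "padic_norm (l q) > 0" if q: "q \<in> ?S" for q
  proof (rule ccontr)
    assume "\<not> ?thesis"
    then have lq: "l q = 0" using padic_norm_nonneg[of "l q"] padic_norm_eq_0[of "l q"] by linarith
    have "range (\<lambda>n::nat. int n *s q) \<subseteq> int_approx l v"
      by (auto simp: int_approx_def additive_smult[OF l] lq)
    then have "finite (range (\<lambda>n::nat. int n *s q))" using fin finite_subset by blast
    moreover have "inj (\<lambda>n::nat. int n *s q)"
      using q by (intro injI) (auto simp: vec_eq_iff)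
    ultimately show False using finite_imageD infinite_UNIV_nat by blast
  qed
  have "\<exists>\<delta>>0. \<forall>q\<in>?S. \<delta> \<le> padic_norm (l q)"
  proof (cases "?S = {}")
    case False
    have finS: "finite ((\<lambda>q. padic_norm (l q)) ` ?S)" using fin by simp
    have "Min ((\<lambda>q. padic_norm (l q)) ` ?S) \<in> (\<lambda>q. padic_norm (l q)) ` ?S"
      using finS False by (intro Min_in) auto
    then have "Min ((\<lambda>q. padic_norm (l q)) ` ?S) > 0" using nz by (elim imageE) (simp only:)
    then show ?thesis using finS by (intro exI[of _ "Min ((\<lambda>q. padic_norm (l q)) ` ?S)"]) auto
  qed (auto intro: exI[of _ 1])
  then obtain \<delta> where \<delta>: "\<delta> > 0" "\<And>q. q \<in> ?S \<Longrightarrow> \<delta> \<le> padic_norm (l q)" by blast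
  obtain k0 where "(1 / ?p) ^ k0 < \<delta>" using real_arch_pow_inv[of \<delta> "1 / ?p"] \<delta>(1) p by auto
  then have k0: "1 / ?p ^ k0 < \<delta>" by (simp add: power_divide)
  show ?thesis
  proof (intro exI[of _ k0] allI impI)
    fix k :: nat and q :: "int ^ 'm" assume k: "k0 \<le> k" and q: "q \<noteq> 0" "int_norm q \<le> ?p powr (real k / v)"
    show "padic_norm (l q) > 1 / ?p ^ k"
    proof (rule ccontr)
      assume "\<not> ?thesis"
      then have le: "padic_norm (l q) \<le> 1 / ?p ^ k" by simp
      have "int_norm q \<ge> 1" using q(1) by (rule int_norm_ge_1)
      then have "int_norm q powr v \<le> (?p powr (real k / v)) powr v" using q v by (intro powr_mono2) auto
      also have "\<dots> = ?p ^ k" using v p by (simp add: powr_powr powr_realpow)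
      finally have "1 / ?p ^ k \<le> 1 / int_norm q powr v"
        using \<open>int_norm q \<ge> 1\<close> p by (intro divide_left_mono) auto
      then have "q \<in> ?S" using le q by (auto simp: int_approx_def powr_minus_divide)
      then have "\<delta> \<le> 1 / ?p ^ k" using \<delta>(2) le by fastforce
      also have "\<dots> \<le> 1 / ?p ^ k0" using k p by (intro divide_left_mono power_increasing) auto
      finally show False using k0 by linarith
    qed
  qed
qed

text \<open>The converse passage, with \<open>k\<close> the integral part of
  \<open>v log_p |q|\<close>: an approximant \<open>q\<close> of exponent \<open>v\<close> has
  \<open>|l(q)| \<le> p^-k\<close> and norm at most \<open>p^((k+1)/v)\<close>. The successor is the
  loss from rounding to integral \<open>k\<close>.\<close>

lemma finite_of_no_short_vector:
  fixes l :: "int ^ 'm::finite \<Rightarrow> 'p::prime_card padic"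
  assumes v: "v > 0"
    and no: "\<And>k q. k \<ge> k1 \<Longrightarrow> q \<noteq> 0 \<Longrightarrow> int_norm q \<le> real CARD('p) powr (real (Suc k) / v) \<Longrightarrow>
      padic_norm (l q) > 1 / real CARD('p) ^ k"
  shows "finite (int_approx l v)"
proof -
  let ?p = "real CARD('p)"
  have p: "?p > 1" by (rule CARD_prime_real_gt_1)
  have "int_approx l v \<subseteq> ibox (?p powr (real (Suc k1) / v))"
  proof
    fix q assume q: "q \<in> int_approx l v"
    show "q \<in> ibox (?p powr (real (Suc k1) / v))"
    proof (cases "q = 0")
      case False
      then have n1: "int_norm q \<ge> 1" by (rule int_norm_ge_1)
      define k where "k = nat \<lfloor>v * log ?p (int_norm q)\<rfloor>"
      have nn: "v * log ?p (int_norm q) \<ge> 0" using n1 p v by (simp add: zero_le_log_cancel_iff)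
      then have k: "real k \<le> v * log ?p (int_norm q)" "v * log ?p (int_norm q) \<le> real (Suc k)"
        unfolding k_def by (simp, linarith)
      have eq: "int_norm q = ?p powr log ?p (int_norm q)" using n1 p by simp
      have "?p ^ k = ?p powr real k" using p by (simp add: powr_realpow)
      also have "\<dots> \<le> ?p powr (v * log ?p (int_norm q))" using k(1) p by simp
      also have "\<dots> = int_norm q powr v" by (subst (2) eq) (simp add: powr_powr mult.commute)
      finally have "1 / int_norm q powr v \<le> 1 / ?p ^ k"
        using p n1 by (intro divide_left_mono mult_pos_pos) auto
      then have l: "padic_norm (l q) \<le> 1 / ?p ^ k"
        using q by (simp add: int_approx_def powr_minus_divide)
      have "log ?p (int_norm q) \<le> real (Suc k) / v" using k(2) v by (simp add: field_simps)
      then have n: "int_norm q \<le> ?p powr (real (Suc k) / v)" by (subst eq) (use p in simp)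
      have "k < k1" using no[of k q] False n l by (meson leI not_le)
      then have "?p powr (real (Suc k) / v) \<le> ?p powr (real (Suc k1) / v)"
        using p v by (intro powr_mono divide_right_mono) auto
      then show ?thesis using n by (simp add: ibox_def)
    qed (simp add: ibox_def)
  qed
  then show ?thesis using finite_ibox finite_subset by blast
qed

context besicovitch_measure
begin

text \<open>One ball and one set of constants serve all integer vectors at once, as is needed for
  estimates uniform in \<open>k\<close>. The finite measure of the ball turns the relative bounds of
  \<open>nondivergence\<close> into summable ones.\<close>

definition locally_good :: "('x \<Rightarrow> int ^ 'm::finite \<Rightarrow> 'p::prime_card padic) \<Rightarrow> 'x \<Rightarrow> bool" where
  "locally_good l x \<longleftrightarrow> (\<exists>R0 C \<alpha> D. R0 > 0 \<and> C \<ge> 1 \<and> \<alpha> > 0 \<and> D \<ge> 1 \<and>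
     emeasure \<mu> (mball x R0) < \<infinity> \<and> ball_doubling D (mball x R0) \<and>
     (\<forall>q. ball_good C \<alpha> (mball x R0) (\<lambda>y. padic_norm (l y q))))"

text \<open>Covolume below \<open>\<rho>\<close> throughout \<open>B\<close> bounds
  \<open>\<Lambda>\<close> on \<open>pts W R\<close> by \<open>K \<rho> cnt W R / p^k\<close>, while
  there are \<open>cnt W R\<close> points; with \<open>p K \<rho> \<le> 1\<close> the pigeonhole
  principle makes \<open>\<Lambda>\<close> small at a difference of two of them. The difference has
  norm up to \<open>2 R\<close>, whence the range of \<open>no\<close>.\<close>

lemma covol_large:
  fixes l :: "'x \<Rightarrow> int ^ 'm::finite \<Rightarrow> 'p::prime_card padic" and \<Lambda> :: "int ^ 'm \<Rightarrow> 'p padic"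
  assumes \<Lambda>: "Modules.additive \<Lambda>" and K: "K > 0"
    and span: "\<And>q. \<exists>z\<in>B. padic_norm (\<Lambda> q) \<le> K * padic_norm (l z q)"
    and no: "\<And>q. q \<noteq> 0 \<Longrightarrow> int_norm q \<le> 2 * R \<Longrightarrow> padic_norm (\<Lambda> q) > 1 / real CARD('p) ^ k"
    and W: "W \<in> lattice_spaces R" and R: "R > 0"
    and \<rho>: "\<rho> > 0" "real CARD('p) * K * \<rho> \<le> 1"
  shows "\<exists>z\<in>B. \<rho> \<le> covol (l z) k R W"
proof (rule ccontr)
  assume "\<not> ?thesis"
  then have small: "covol (l z) k R W < \<rho>" if "z \<in> B" for z using that by force
  interpret Modules.additive \<Lambda> by fact
  let ?p = "real CARD('p)"
  have p: "?p > 1" by (rule CARD_prime_real_gt_1)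
  then have pk: "?p ^ k > 0" by simp
  have sW: "subspace W" using W by (rule subspace_lattice_spaces)
  have c: "cnt W R \<ge> 1" using cnt_ge_1[OF sW, of R] R by simp
  have "pts W R \<noteq> {0}"
  proof
    assume "pts W R = {0}"
    then have "W = span {0}" using W by (simp add: lattice_spaces_def)
    then show False using W by (simp add: lattice_spaces_def)
  qed
  then obtain q0 where q0: "q0 \<in> pts W R" "q0 \<noteq> 0" using zero_in_pts[OF sW, of R] R by auto
  have "card {0, q0} \<le> card (pts W R)"
    using q0 zero_in_pts[OF sW, of R] R by (intro card_mono) auto
  then have card2: "card (pts W R) \<ge> 2" using q0(2) by simp
  have bd: "padic_norm (\<Lambda> q) \<le> K * (\<rho> * cnt W R / ?p ^ k)" if q: "q \<in> pts W R" for q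
  proof -
    obtain z where z: "z \<in> B" "padic_norm (\<Lambda> q) \<le> K * padic_norm (l z q)" using span by blast
    have "?p ^ k * padic_norm (l z q) \<le> lat_index (l z) k W R" using q by (rule lat_index_ge)
    also have "\<dots> \<le> \<rho> * cnt W R" using small[OF z(1)] c by (simp add: covol_def field_simps)
    finally have "padic_norm (l z q) \<le> \<rho> * cnt W R / ?p ^ k" using pk by (simp add: field_simps)
    then have "K * padic_norm (l z q) \<le> K * (\<rho> * cnt W R / ?p ^ k)"
      using K by (intro mult_left_mono) auto
    then show ?thesis using z(2) by linarith
  qed
  have "?p * (K * (\<rho> * cnt W R / ?p ^ k)) * ?p ^ k = (?p * K * \<rho>) * cnt W R" using pk by simp
  also have "\<dots> \<le> 1 * cnt W R" using \<rho> c by (intro mult_right_mono) auto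
  finally have le: "?p * (K * (\<rho> * cnt W R / ?p ^ k)) * ?p ^ k \<le> card (pts W R)" by (simp add: cnt_def)
  obtain a b where ab: "a \<in> pts W R" "b \<in> pts W R" "a \<noteq> b" "padic_norm (\<Lambda> a - \<Lambda> b) \<le> 1 / ?p ^ k"
    using padic_pigeonhole[where g = \<Lambda>, OF finite_pts card2 bd le] by blast
  have "a - b \<in> ibox (R + R)" using ab by (intro ibox_diff) (auto simp: pts_def)
  then have "padic_norm (\<Lambda> (a - b)) > 1 / ?p ^ k" using ab(3) by (intro no) (auto simp: ibox_def)
  then show False using ab(4) by (simp add: diff)
qed

lemma AE_finite_int_approx:
  fixes l :: "'x \<Rightarrow> int ^ 'm::finite \<Rightarrow> 'p::prime_card padic" and \<Lambda> :: "int ^ 'm \<Rightarrow> 'p padic"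
  assumes l: "\<And>x. Modules.additive (l x)" and \<Lambda>: "Modules.additive \<Lambda>"
    and meas: "\<And>q c. {x \<in> M. padic_norm (l x q) < c} \<in> sets \<mu>"
    and usc: "\<And>y q c. y \<in> M \<Longrightarrow> padic_norm (l y q) < c \<Longrightarrow> \<exists>r>0. \<forall>z\<in>mball y r. padic_norm (l z q) < c"
    and loc: "AE x in \<mu>. locally_good l x"
    and span: "\<And>x r. x \<in> supp \<Longrightarrow> r > 0 \<Longrightarrow>
      \<exists>K>0. \<forall>q. \<exists>z\<in>mball x r \<inter> supp. padic_norm (\<Lambda> q) \<le> K * padic_norm (l z q)"
    and v: "0 < v" "v < w" and fin: "finite (int_approx \<Lambda> v)"
  shows "AE x in \<mu>. finite (int_approx (l x) w)"
proof -
  let ?p = "real CARD('p)" and ?m = "CARD('m)"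
  have p: "?p > 1" by (rule CARD_prime_real_gt_1)
  \<comment> \<open>Halved because the pigeonhole principle produces a vector of norm up to
    \<open>2 R k\<close>.\<close>
  define R where "R = (\<lambda>k::nat. ?p powr (real k / v) / 2)"
  have R: "R k > 0" for k using p by (simp add: R_def)
  define c1 where "c1 = (2 * real (?m + 3) + 1) ^ ?m"
  have c1: "c1 > 0" by (simp add: c1_def)
  define \<theta> where "\<theta> = ?p powr (1 / w - 1 / v)"
  have \<theta>: "0 < \<theta>" "\<theta> < 1"
  proof -
    have "1 / w - 1 / v < 0" using v by (simp add: field_simps)
    then have "?p powr (1 / w - 1 / v) < ?p powr 0" using p by (intro powr_less_mono) auto
    then show "\<theta> < 1" using p by (simp add: \<theta>_def)
    show "0 < \<theta>" using p by (simp add: \<theta>_def)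
  qed
  \<comment> \<open>Chosen so that \<open>e k * R k = p^((k+1)/w)\<close>, the length to be excluded
    for exponent \<open>w\<close>. The decay is exponential because \<open>v < w\<close>.\<close>
  define e where "e = (\<lambda>k::nat. 2 * ?p powr (1 / w) * \<theta> ^ k)"
  have e: "e k > 0" for k using p \<theta> by (simp add: e_def)
  have eR: "e k * R k = ?p powr (real (Suc k) / w)" for k
  proof -
    have "\<theta> ^ k = ?p powr (real k * (1 / w - 1 / v))"
      using p by (simp add: \<theta>_def powr_realpow[symmetric] powr_powr mult.commute)
    then have "e k * R k = ?p powr (1 / w + real k * (1 / w - 1 / v) + real k / v)"
      by (simp add: e_def R_def powr_add)
    also have "1 / w + real k * (1 / w - 1 / v) + real k / v = real (Suc k) / w"
      using v by (simp add: field_simps)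
    finally show ?thesis .
  qed
  have e0: "e \<longlonglongrightarrow> 0"
    unfolding e_def using \<theta> by (intro tendsto_mult_right_zero LIMSEQ_power_zero) auto
  obtain k0 where k0: "\<And>k q. k \<ge> k0 \<Longrightarrow> q \<noteq> 0 \<Longrightarrow> int_norm q \<le> 2 * R k \<Longrightarrow> padic_norm (\<Lambda> q) > 1 / ?p ^ k"
    using no_short_vector_of_finite[OF \<Lambda> v(1) fin] unfolding R_def by auto
  have "AE x in \<mu>. \<exists>r>0. \<exists>H\<in>null_sets \<mu>. {x. infinite (int_approx (l x) w)} \<inter> mball x r \<subseteq> H"
    using loc AE_supp
  proof eventually_elim
    case (elim x0)
    then obtain R0 C \<alpha> D where R0: "R0 > 0" and C: "C \<ge> 1" and \<alpha>: "\<alpha> > 0" and D: "D \<ge> 1"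
      and fm: "emeasure \<mu> (mball x0 R0) < \<infinity>" and dbl: "ball_doubling D (mball x0 R0)"
      and good: "\<And>q. ball_good C \<alpha> (mball x0 R0) (\<lambda>x. padic_norm (l x q))"
      unfolding locally_good_def by blast
    have x0: "x0 \<in> supp" using elim by blast
    \<comment> \<open>Leaves room for the \<open>CARD('m)\<close> triplings in
      \<open>nondivergence\<close>.\<close>
    define r0 where "r0 = R0 / 3 ^ ?m"
    have r0: "r0 > 0" "3 ^ ?m * r0 = R0" using R0 by (simp_all add: r0_def)
    obtain K where K: "K > 0" "\<And>q. \<exists>z\<in>mball x0 r0 \<inter> supp. padic_norm (\<Lambda> q) \<le> K * padic_norm (l z q)"
      using span[OF x0 r0(1)] by blast
    \<comment> \<open>The second entry is the condition of the pigeonhole principle; the first keeps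
      flag members at covolume at most 1, like the zero space.\<close>
    define \<rho> where "\<rho> = min 1 (1 / (?p * K))"
    have \<rho>: "\<rho> > 0" "\<rho> \<le> 1" "?p * K * \<rho> \<le> 1"
    proof -
      have pK: "?p * K > 0" using p K by simp
      have "\<rho> \<le> 1 / (?p * K)" by (simp add: \<rho>_def)
      then show "?p * K * \<rho> \<le> 1" using pK by (simp add: field_simps)
      show "\<rho> > 0" "\<rho> \<le> 1" using pK by (auto simp: \<rho>_def)
    qed
    \<comment> \<open>The factor 2 gives the strict inequality \<open>c1 * e k < e' k\<close> that
      excludes short vectors, \<open>c1\<close> being the constant of
      \<open>covol_submult\<close>.\<close>
    define e' where "e' = (\<lambda>k. 2 * c1 * e k)"
    have e': "e' k > 0" for k using c1 e by (simp add: e'_def)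
    define c2 where "c2 = real ?m * C * (real N * D\<^sup>2) ^ ?m"
    have c2: "c2 \<ge> 0" using C by (simp add: c2_def)
    have "\<exists>A\<in>sets \<mu>. emeasure \<mu> A \<le> ennreal (c2 * (e' k / \<rho>) powr \<alpha>) * emeasure \<mu> (mball x0 r0) \<and>
      (\<forall>x\<in>mball x0 r0 \<inter> supp - A. k \<ge> k0 \<longrightarrow> marked (\<lambda>W x. covol (l x) k (R k) W) (lattice_spaces (R k)) (e' k) \<rho> x)" for k
    proof (cases "k \<ge> k0")
      case True
      have "\<exists>A\<in>sets \<mu>. emeasure \<mu> A \<le> ennreal (real ?m * C * (real N * D\<^sup>2) ^ ?m * (e' k / \<rho>) powr \<alpha>) * emeasure \<mu> (mball x0 r0) \<and>
        (\<forall>x\<in>mball x0 r0 \<inter> supp - A. marked (\<lambda>W x. covol (l x) k (R k) W) (lattice_spaces (R k)) (e' k) \<rho> x)"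
      proof (rule nondivergence)
        show "C > 0" using C by simp
        show "ball_doubling D (mball x0 (3 ^ ?m * r0))" using dbl r0 by simp
        fix F :: "(real ^ 'm) set set" assume "F \<subseteq> lattice_spaces (R k)" "finite F" "\<forall>s\<in>F. \<forall>t\<in>F. s \<le> t \<or> t \<le> s"
        then show "card F \<le> ?m" by (rule lattice_spaces_chain)
      next
        fix W :: "(real ^ 'm) set" assume W: "W \<in> lattice_spaces (R k)"
        have sW: "subspace W" using W by (rule subspace_lattice_spaces)
        show "ball_good C \<alpha> (mball x0 (3 ^ ?m * r0)) (\<lambda>x. covol (l x) k (R k) W)"
          unfolding r0(2) by (rule covol_good[OF meas good C \<alpha> sW R])
        show "{x \<in> M. covol (l x) k (R k) W < c} \<in> sets \<mu>" for c
          by (rule covol_measurable[OF meas sW R])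
        show "\<exists>r>0. \<forall>z\<in>mball y r. covol (l z) k (R k) W < c" if "y \<in> M" "covol (l y) k (R k) W < c" for y c
          using usc sW R that by (rule covol_usc)
        show "\<exists>z\<in>mball x0 r0 \<inter> supp. \<rho> \<le> covol (l z) k (R k) W"
          by (rule covol_large[OF \<Lambda> K k0[OF True] W R \<rho>(1) \<rho>(3)])
      qed (use \<alpha> D e' \<rho> x0 r0 in auto)
      then show ?thesis unfolding c2_def by blast
    qed (auto intro!: bexI[of _ "{}"])
    then obtain A where A: "\<And>k. A k \<in> sets \<mu>"
      "\<And>k. emeasure \<mu> (A k) \<le> ennreal (c2 * (e' k / \<rho>) powr \<alpha>) * emeasure \<mu> (mball x0 r0)"
      "\<And>k x. x \<in> mball x0 r0 \<inter> supp - A k \<Longrightarrow> k \<ge> k0 \<Longrightarrow>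
        marked (\<lambda>W x. covol (l x) k (R k) W) (lattice_spaces (R k)) (e' k) \<rho> x" by metis
    define mB where "mB = measure \<mu> (mball x0 r0)"
    have mB: "emeasure \<mu> (mball x0 r0) = ennreal mB"
    proof -
      have "1 * r0 \<le> 3 ^ ?m * r0" using r0(1) by (intro mult_right_mono) auto
      then have "mball x0 r0 \<subseteq> mball x0 R0" using r0(2) by (intro mball_subset_concentric) simp
      then have "emeasure \<mu> (mball x0 r0) \<le> emeasure \<mu> (mball x0 R0)" by (intro emeasure_mono) auto
      then have "emeasure \<mu> (mball x0 r0) \<noteq> \<infinity>" using fm by (auto simp: top_unique)
      then show ?thesis unfolding mB_def by (intro emeasure_eq_ennreal_measure) auto
    qed
    have mB0: "mB \<ge> 0" by (simp add: mB_def)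
    define g where "g = (\<lambda>k. c2 * (e' k / \<rho>) powr \<alpha> * mB)"
    have Ag: "emeasure \<mu> (A k) \<le> ennreal (g k)" for k
      using A(2)[of k] c2 mB0 unfolding g_def mB by (simp add: ennreal_mult)
    have g0: "g k \<ge> 0" for k using c2 mB0 by (simp add: g_def)
    \<comment> \<open>The constants \<open>c2\<close>, \<open>\<rho>\<close> and
      \<open>\<alpha>\<close> are independent of \<open>k\<close>, so the exceptional sets are
      bounded by a geometric series.\<close>
    have geo: "g k = c2 * mB * ((2 * c1 * (2 * ?p powr (1 / w))) / \<rho>) powr \<alpha> * (\<theta> powr \<alpha>) ^ k" for k
    proof -
      have "e' k / \<rho> = ((2 * c1 * (2 * ?p powr (1 / w))) / \<rho>) * \<theta> ^ k" by (simp add: e'_def e_def)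
      moreover have "(\<theta> ^ k) powr \<alpha> = (\<theta> powr \<alpha>) ^ k"
        using \<theta>(1) by (simp add: powr_realpow[symmetric] powr_powr mult.commute)
      moreover have "0 \<le> (2 * c1 * (2 * ?p powr (1 / w))) / \<rho>" using c1 \<rho> by simp
      ultimately show ?thesis using \<theta>(1) by (simp only: g_def powr_mult zero_le_power less_imp_le) simp
    qed
    have "\<theta> powr \<alpha> < 1 powr \<alpha>" using \<theta> \<alpha> by (intro powr_less_mono2) auto
    then have "summable (\<lambda>k. (\<theta> powr \<alpha>) ^ k)" by (intro summable_geometric) simp
    then have sg: "summable g" unfolding geo[abs_def] by (rule summable_mult)
    have AE1: "AE x in \<mu>. eventually (\<lambda>k. x \<in> space \<mu> - A k) sequentially"
    proof (rule borel_cantelli_AE1)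
      show "A k \<in> sets \<mu>" for k by (rule A)
      show "emeasure \<mu> (A k) < \<infinity>" for k using Ag[of k] by (metis ennreal_less_top infinity_ennreal_def le_less_trans)
      have mA: "measure \<mu> (A k) \<le> g k" for k
        using Ag[of k] g0[of k] by (simp add: measure_def enn2real_leI)
      show "summable (\<lambda>k. measure \<mu> (A k))"
        by (rule summable_comparison_test'[OF sg, of 0]) (use mA in auto)
    qed
    have "eventually (\<lambda>k. e k < 1 \<and> e' k < \<rho>) sequentially"
    proof -
      have "(\<lambda>k. 2 * c1 * e k) \<longlonglongrightarrow> 0" using e0 by (rule tendsto_mult_right_zero)
      then have "eventually (\<lambda>k. e' k < \<rho>) sequentially"
        unfolding e'_def using \<rho>(1) by (rule order_tendstoD(2))
      moreover have "eventually (\<lambda>k. e k < 1) sequentially" using e0 by (rule order_tendstoD(2)) simp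
      ultimately show ?thesis by eventually_elim simp
    qed
    then obtain k1 where k1: "\<And>k. k \<ge> k1 \<Longrightarrow> e k < 1 \<and> e' k < \<rho>"
      unfolding eventually_sequentially by blast
    have "AE x in \<mu>. \<not> (x \<in> mball x0 r0 \<and> infinite (int_approx (l x) w))"
      using AE1 AE_supp
    proof eventually_elim
      case (elim x)
      show ?case
      proof (intro notI, elim conjE)
        assume xB: "x \<in> mball x0 r0" and inf: "infinite (int_approx (l x) w)"
        obtain k2 where k2: "\<And>k. k \<ge> k2 \<Longrightarrow> x \<notin> A k" using elim(1) unfolding eventually_sequentially by auto
        have "finite (int_approx (l x) w)"
        proof (rule finite_of_no_short_vector)
          show "w > 0" using v by simp
          fix k :: nat and q :: "int ^ 'm" assume k: "k \<ge> max k0 (max k1 k2)" and q: "q \<noteq> 0" "int_norm q \<le> ?p powr (real (Suc k) / w)"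
          have "marked (\<lambda>W x. covol (l x) k (R k) W) (lattice_spaces (R k)) (e' k) \<rho> x"
            using k k2 xB elim(2) by (intro A(3)) auto
          then obtain F where F: "F \<subseteq> lattice_spaces (R k)" "finite F" "\<forall>s\<in>F. \<forall>t\<in>F. s \<le> t \<or> t \<le> s"
            "\<forall>s\<in>F. e' k \<le> covol (l x) k (R k) s \<and> covol (l x) k (R k) s < \<rho>"
            "\<forall>s\<in>lattice_spaces (R k) - F. (\<forall>t\<in>F. s \<le> t \<or> t \<le> s) \<longrightarrow> \<rho> \<le> covol (l x) k (R k) s"
            unfolding marked_def by (elim exE conjE)
          show "padic_norm (l x q) > 1 / ?p ^ k"
          proof (rule no_short_vector[OF l R _ _ F])
            show "0 < e k" by (rule e)
            show "e k \<le> 1" "e' k \<le> \<rho>" using k1[of k] k by auto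
            show "\<rho> \<le> 1" by (rule \<rho>)
            show "(2 * real (?m + 3) + 1) ^ ?m * e k < e' k"
              unfolding c1_def[symmetric] e'_def using c1 e[of k] by simp
            show "q \<noteq> 0" by (rule q)
            show "q \<in> ibox (e k * R k)" using q(2) by (simp add: ibox_def eR)
          qed
        qed
        then show False using inf by blast
      qed
    qed
    then obtain H where H: "H \<in> null_sets \<mu>" "{x \<in> space \<mu>. x \<in> mball x0 r0 \<and> infinite (int_approx (l x) w)} \<subseteq> H"
      by (auto elim!: AE_E intro: null_setsI)
    then show ?case using r0(1) by (intro exI[of _ r0] conjI bexI[of _ H]) (auto simp: space_eq)
  qed
  then have "AE x in \<mu>. x \<notin> {x. infinite (int_approx (l x) w)}" by (rule AE_of_local)
  then show ?thesis by simp
qed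

end

section \<open>Haar measure on $\mathbb{Q}_p^s$\<close>

lemma padic_norm_values:
  fixes z :: "'p::prime_card padic"
  assumes "z \<noteq> 0"
  shows "\<exists>k. padic_norm z = real CARD('p) powi k"
proof -
  have pos: "padic_norm z > 0" using assms padic_norm_nonneg[of z] padic_norm_eq_0[of z] by linarith
  obtain q where q: "dist z (of_rat q) < padic_norm z" using padic_dense[OF pos] by blast
  then have eq: "padic_norm (of_rat q :: 'p padic) = padic_norm z"
    by (intro padic_norm_eq_of_diff_less) (simp add: dist_padic_def)
  then have "q \<noteq> 0" using pos by auto
  then show ?thesis using eq unfolding padic_norm_of_rat padic_abs_def by metis
qed

lemma powi_less_iff:
  assumes "(b::real) > 1"
  shows "b powi i < b powi j \<longleftrightarrow> i < j"
  using power_int_strict_increasing[of i j b] power_int_increasing[of j i b] assms by force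

lemma powi_le_iff:
  assumes "(b::real) > 1"
  shows "b powi i \<le> b powi j \<longleftrightarrow> i \<le> j"
  using powi_less_iff[OF assms, of j i] by linarith

lemma powi_scale:
  assumes "(b::real) > 1" "r > 0"
  obtains k where "b powi (k - 1) < r" "r \<le> b powi k"
proof
  let ?k = "\<lceil>log b r\<rceil>"
  have pw: "b powi k = b powr of_int k" for k using assms by (simp add: powr_real_of_int')
  have eq: "r = b powr log b r" using assms by simp
  have "b powr log b r \<le> b powr of_int ?k" using assms by (intro powr_mono) auto
  then show "r \<le> b powi ?k" using eq pw by simp
  have "of_int (?k - 1) < log b r" by linarith
  then have "b powr of_int (?k - 1) < b powr log b r" using assms by (intro powr_less_mono)
  then show "b powi (?k - 1) < r" using eq pw by simp
qed

lemma padic_norm_less_powi_iff: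
  fixes z :: "'p::prime_card padic"
  shows "padic_norm z < real CARD('p) powi (k + 1) \<longleftrightarrow> padic_norm z \<le> real CARD('p) powi k"
proof -
  have p: "real CARD('p) > 1" by (rule CARD_prime_real_gt_1)
  show ?thesis
  proof (cases "z = 0")
    case False
    then obtain j where "padic_norm z = real CARD('p) powi j" using padic_norm_values by blast
    then show ?thesis using powi_less_iff[OF p] powi_le_iff[OF p] by simp
  qed (use p in simp)
qed

lemma padic_norm_less_iff_powi:
  fixes z :: "'p::prime_card padic"
  assumes "real CARD('p) powi (k - 1) < r" "r \<le> real CARD('p) powi k"
  shows "padic_norm z < r \<longleftrightarrow> padic_norm z < real CARD('p) powi k"
  using padic_norm_less_powi_iff[of z "k - 1"] assms by auto

section \<open>Ultrametric balls in Q_p^s\<close>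

definition pball :: "nat \<Rightarrow> (nat \<Rightarrow> 'p::prime_card padic) \<Rightarrow> real \<Rightarrow> (nat \<Rightarrow> 'p padic) set" where
  "pball s x r = {y \<in> padic_space s. \<forall>i<s. padic_norm (x i - y i) < r}"

text \<open>Inserting 0 covers the case \<open>s = 0\<close>. The distance separates points of
  \<open>padic_space s\<close> because their remaining coordinates vanish.\<close>

definition pdist :: "nat \<Rightarrow> (nat \<Rightarrow> 'p::prime_card padic) \<Rightarrow> (nat \<Rightarrow> 'p padic) \<Rightarrow> real" where
  "pdist s x y = Max (insert 0 ((\<lambda>i. padic_norm (x i - y i)) ` {..<s}))"

lemma pdist_less_iff: "pdist s x y < r \<longleftrightarrow> 0 < r \<and> (\<forall>i<s. padic_norm (x i - y i) < r)"
  unfolding pdist_def by (subst Max_less_iff) auto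

lemma pdist_le_iff: "pdist s x y \<le> r \<longleftrightarrow> 0 \<le> r \<and> (\<forall>i<s. padic_norm (x i - y i) \<le> r)"
  unfolding pdist_def by (subst Max_le_iff) auto

lemma pdist_nonneg: "pdist s x y \<ge> 0"
  unfolding pdist_def by (rule Max_ge) auto

lemma pdist_component: "i < s \<Longrightarrow> padic_norm (x i - y i) \<le> pdist s x y"
  using pdist_le_iff[of s x y "pdist s x y"] by auto

lemma pdist_ultra: "pdist s x z \<le> max (pdist s x y) (pdist s y z)"
  unfolding pdist_le_iff
proof (intro conjI allI impI)
  show "0 \<le> max (pdist s x y) (pdist s y z)" using pdist_nonneg[of s x y] by simp
  fix i assume "i < s"
  then show "padic_norm (x i - z i) \<le> max (pdist s x y) (pdist s y z)"
    using padic_norm_ultra[of "x i - y i" "y i - z i"] pdist_component[of i s x y] pdist_component[of i s y z]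
    by simp
qed

interpretation pspace: Metric_space "padic_space s" "pdist s :: _ \<Rightarrow> (nat \<Rightarrow> 'p::prime_card padic) \<Rightarrow> _" for s
proof
  fix x y z :: "nat \<Rightarrow> 'p padic"
  show "0 \<le> pdist s x y" by (rule pdist_nonneg)
  show "pdist s x y = pdist s y x" unfolding pdist_def by (simp add: padic_norm_minus_commute)
  show "pdist s x z \<le> pdist s x y + pdist s y z"
    using pdist_ultra[of s x z y] pdist_nonneg[of s x y] pdist_nonneg[of s y z] by simp
  assume xy: "x \<in> padic_space s" "y \<in> padic_space s"
  show "pdist s x y = 0 \<longleftrightarrow> x = y"
  proof
    assume 0: "pdist s x y = 0"
    show "x = y"
    proof
      fix i
      show "x i = y i"
      proof (cases "i < s")
        case True
        then have "padic_norm (x i - y i) = 0"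
          using pdist_component[of i s x y] padic_norm_nonneg[of "x i - y i"] 0 by linarith
        then show ?thesis by simp
      next
        case False
        then show ?thesis using xy by (simp add: padic_space_def)
      qed
    qed
  next
    assume "x = y"
    then have "pdist s x y \<le> 0" unfolding pdist_le_iff by simp
    then show "pdist s x y = 0" using pdist_nonneg[of s x y] by linarith
  qed
qed

lemma mball_eq_pball: "x \<in> padic_space s \<Longrightarrow> r > 0 \<Longrightarrow> pspace.mball s x r = pball s x r"
  by (auto simp: pball_def pdist_less_iff)

lemma centre_in_pball: "x \<in> padic_space s \<Longrightarrow> r > 0 \<Longrightarrow> x \<in> pball s x r"
  by (simp add: pball_def)

lemma pball_subset: "pball s x r \<subseteq> padic_space s"
  by (auto simp: pball_def)

text \<open>By the ultrametric inequality the distances to \<open>x\<close> and to \<open>y\<close>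
  are below \<open>r\<close> simultaneously.\<close>

lemma pball_eq:
  assumes "y \<in> pball s x r"
  shows "pball s y r = pball s x r"
proof -
  have y: "padic_norm (x i - y i) < r" if "i < s" for i using assms that by (simp add: pball_def)
  have "padic_norm (y i - z i) < r \<longleftrightarrow> padic_norm (x i - z i) < r" if "i < s" for i and z :: "nat \<Rightarrow> 'a padic"
  proof -
    have "padic_norm (x i - z i) \<le> max (padic_norm (x i - y i)) (padic_norm (y i - z i))"
      using padic_norm_ultra[of "x i - y i" "y i - z i"] by simp
    moreover have "padic_norm (y i - z i) \<le> max (padic_norm (x i - z i)) (padic_norm (x i - y i))"
      using padic_norm_diff_ultra[of "x i - z i" "x i - y i"] by simp
    ultimately show ?thesis using y[OF that] by linarith
  qed
  then show ?thesis unfolding pball_def by blast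
qed

lemma pball_powi:
  fixes x :: "nat \<Rightarrow> 'p::prime_card padic"
  assumes "real CARD('p) powi (k - 1) < r" "r \<le> real CARD('p) powi k"
  shows "pball s x r = pball s x (real CARD('p) powi k)"
  unfolding pball_def using padic_norm_less_iff_powi[OF assms] by auto

definition rat_points :: "nat \<Rightarrow> (nat \<Rightarrow> 'p::prime_card padic) set" where
  "rat_points s = (\<lambda>xs i. if i < s then of_rat (xs ! i) else 0) ` (UNIV :: rat list set)"

lemma countable_rat_points: "countable (rat_points s)"
  unfolding rat_points_def by (intro countable_image) auto

lemma rat_points_subset: "rat_points s \<subseteq> padic_space s"
  by (auto simp: rat_points_def padic_space_def)

lemma rat_points_dense:
  fixes x :: "nat \<Rightarrow> 'p::prime_card padic"
  assumes "r > 0"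
  obtains q where "q \<in> rat_points s" "q \<in> pball s x r"
proof -
  have "\<forall>i. \<exists>h. dist (x i) (of_rat h) < r" using padic_dense[OF assms] by blast
  then obtain h where h: "\<And>i. dist (x i) (of_rat (h i)) < r" by metis
  let ?q = "\<lambda>i. if i < s then of_rat (map h [0..<s] ! i) else (0 :: 'p padic)"
  have "?q \<in> rat_points s" unfolding rat_points_def by blast
  moreover have "?q \<in> pball s x r" using h by (auto simp: pball_def padic_space_def dist_padic_def)
  ultimately show ?thesis using that by blast
qed

lemma continuous_on_coordinate: "continuous_on S (\<lambda>x :: nat \<Rightarrow> 'p::prime_card padic. x i)"
  by (rule continuous_on_subset[OF continuous_on_product_coordinates]) auto

text \<open>The link between the metric \<open>pdist\<close> and the product topology on sequences:
  a ball is the trace of an open cylinder.\<close>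

definition cylinder :: "nat \<Rightarrow> (nat \<Rightarrow> 'p::prime_card padic) \<Rightarrow> real \<Rightarrow> (nat \<Rightarrow> 'p padic) set" where
  "cylinder s x r = (\<Inter>i\<in>{..<s}. {y. dist (x i) (y i) < r})"

lemma open_cylinder: "open (cylinder s x r)"
  unfolding cylinder_def
  by (intro open_INT ballI open_Collect_less continuous_on_dist continuous_on_const continuous_on_coordinate) auto

lemma pball_cylinder: "pball s x r = padic_space s \<inter> cylinder s x r"
  by (auto simp: pball_def cylinder_def dist_padic_def)

lemma pball_sets: "pball s x r \<in> sets (restrict_space borel (padic_space s))"
  unfolding pball_cylinder sets_restrict_space by (intro imageI borel_open open_cylinder)

text \<open>Two balls that meet are nested, so the largest balls of the family around the points of
  \<open>E\<close> are equal or disjoint, and the multiplicity is 1. If the balls around some point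
  have unbounded radii, one of them covers the bounded set \<open>E\<close>. Radii may be taken to
  be powers of \<open>p\<close>, and a rational point in each ball shows that countably many balls
  occur.\<close>

lemma pspace_besicovitch:
  fixes E :: "(nat \<Rightarrow> 'p::prime_card padic) set"
  assumes E: "pspace.mbounded s E"
    and B: "\<B> \<subseteq> {pspace.mball s x r | x r. x \<in> padic_space s \<and> r > 0}"
    and c: "\<forall>x\<in>E. \<exists>r>0. pspace.mball s x r \<in> \<B>"
  shows "\<exists>\<C>\<subseteq>\<B>. countable \<C> \<and> E \<subseteq> \<Union>\<C> \<and>
        (\<forall>x. finite {B \<in> \<C>. x \<in> B} \<and> card {B \<in> \<C>. x \<in> B} \<le> 1)"
proof -
  let ?p = "real CARD('p)"
  have p: "?p > 1" by (rule CARD_prime_real_gt_1)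
  define P where "P = (\<lambda>(x :: nat \<Rightarrow> 'p padic) k. pball s x (?p powi k))"
  have pP: "?p powi k > 0" for k using p by simp
  have EM: "x \<in> padic_space s" if "x \<in> E" for x using E that pspace.mbounded_subset_mspace by blast
  have Kne: "\<exists>k. P x k \<in> \<B>" if x: "x \<in> E" for x
  proof -
    obtain r where r: "r > 0" "pspace.mball s x r \<in> \<B>" using c x by blast
    obtain k where "?p powi (k - 1) < r" "r \<le> ?p powi k" using powi_scale[OF p r(1)] by blast
    then have "P x k \<in> \<B>" using r EM[OF x] by (simp add: P_def mball_eq_pball pball_powi)
    then show ?thesis by blast
  qed
  show ?thesis
  proof (cases "\<exists>x\<in>E. \<forall>n. \<exists>k\<ge>n. P x k \<in> \<B>")
    case True
    then obtain x where x: "x \<in> E" "\<And>n. \<exists>k\<ge>n. P x k \<in> \<B>" by blast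
    obtain b where b: "\<And>y. y \<in> E \<Longrightarrow> pdist s x y \<le> b"
      using E x(1) unfolding pspace.mbounded_alt by blast
    obtain n where "b < ?p ^ n" using real_arch_pow[OF p] by blast
    then have n: "b < ?p powi int n" by simp
    obtain k where k: "k \<ge> int n" "P x k \<in> \<B>" using x(2) by blast
    have "?p powi int n \<le> ?p powi k" using k(1) powi_le_iff[OF p] by blast
    then have "E \<subseteq> P x k"
    proof (intro subsetI)
      fix y assume y: "y \<in> E"
      have "pdist s x y < ?p powi k" using b[OF y] n \<open>?p powi int n \<le> ?p powi k\<close> by linarith
      then show "y \<in> P x k" using EM[OF y] by (simp add: P_def pball_def pdist_less_iff)
    qed
    moreover have "{B \<in> {P x k}. y \<in> B} \<subseteq> {P x k}" for y by blast
    then have "finite {B \<in> {P x k}. y \<in> B} \<and> card {B \<in> {P x k}. y \<in> B} \<le> 1" for y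
      using card_mono[of "{P x k}" "{B \<in> {P x k}. y \<in> B}"] finite_subset[of "{B \<in> {P x k}. y \<in> B}" "{P x k}"] by simp
    ultimately show ?thesis using k(2) by (intro exI[of _ "{P x k}"]) simp
  next
    case False
    have "\<exists>k. P x k \<in> \<B> \<and> (\<forall>j. P x j \<in> \<B> \<longrightarrow> j \<le> k)" if x: "x \<in> E" for x
    proof -
      obtain n where "\<not> (\<exists>k\<ge>n. P x k \<in> \<B>)" using False x by blast
      then have n: "\<And>k. P x k \<in> \<B> \<Longrightarrow> k < n" by (meson not_le)
      obtain k0 where k0: "P x k0 \<in> \<B>" using Kne x by blast
      let ?S = "{k \<in> {k0..n}. P x k \<in> \<B>}"
      have "?S \<subseteq> {k0..n}" by blast
      then have "finite ?S" using finite_atLeastAtMost_int finite_subset by blast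
      then have S: "finite ?S" "k0 \<in> ?S" using k0 n[OF k0] by auto
      have "Max ?S \<in> ?S" using S by (intro Max_in) auto
      moreover have "j \<le> Max ?S" if j: "P x j \<in> \<B>" for j
      proof (cases "j \<ge> k0")
        case True
        then show ?thesis using S j n[OF j] by (intro Max_ge) auto
      next
        case False
        then show ?thesis using Max_ge[OF S] by linarith
      qed
      ultimately show ?thesis by blast
    qed
    then obtain \<kappa> where \<kappa>: "\<And>x. x \<in> E \<Longrightarrow> P x (\<kappa> x) \<in> \<B>"
      "\<And>x j. x \<in> E \<Longrightarrow> P x j \<in> \<B> \<Longrightarrow> j \<le> \<kappa> x" by metis
    let ?C = "(\<lambda>x. P x (\<kappa> x)) ` E"
    \<comment> \<open>The larger ball is also a ball around \<open>y\<close>, so the maximality of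
      \<open>\<kappa> y\<close> makes the radii equal.\<close>
    have le: "P x (\<kappa> x) = P y (\<kappa> y)"
      if x: "x \<in> E" "y \<in> E" "z \<in> P x (\<kappa> x)" "z \<in> P y (\<kappa> y)" "\<kappa> y \<le> \<kappa> x" for x y z
    proof -
      have "?p powi \<kappa> y \<le> ?p powi \<kappa> x" using x(5) powi_le_iff[OF p] by blast
      then have "z \<in> P y (\<kappa> x)" using x(4) unfolding P_def pball_def by (auto intro: order.strict_trans2)
      then have eq: "P y (\<kappa> x) = P x (\<kappa> x)" using x(3) pball_eq unfolding P_def by metis
      then have "\<kappa> x \<le> \<kappa> y" using \<kappa>(1)[OF x(1)] by (intro \<kappa>(2)[OF x(2)]) simp
      then show ?thesis using eq x(5) by simp
    qed
    have disj: "B = B'" if "B \<in> ?C" "B' \<in> ?C" "z \<in> B" "z \<in> B'" for B B' z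
      using that le by (elim imageE) (metis linear)
    have "?C \<subseteq> (\<lambda>(q, k). P q k) ` (rat_points s \<times> UNIV)"
    proof (rule image_subsetI)
      fix x assume "x \<in> E"
      obtain q where q: "q \<in> rat_points s" "q \<in> pball s x (?p powi \<kappa> x)" using rat_points_dense[OF pP] by blast
      then have "P x (\<kappa> x) = P q (\<kappa> x)" unfolding P_def using pball_eq by blast
      then show "P x (\<kappa> x) \<in> (\<lambda>(q, k). P q k) ` (rat_points s \<times> UNIV)" using q(1) by auto
    qed
    then have "countable ?C"
      by (rule countable_subset) (intro countable_image countable_SIGMA countable_rat_points, auto)
    moreover have "?C \<subseteq> \<B>" using \<kappa>(1) by blast
    moreover have "E \<subseteq> \<Union>?C" using centre_in_pball[OF EM pP] by (auto simp: P_def)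
    moreover have "finite {B \<in> ?C. z \<in> B} \<and> card {B \<in> ?C. z \<in> B} \<le> 1" for z
    proof (cases "{B \<in> ?C. z \<in> B} = {}")
      case True
      then show ?thesis by (simp only: finite.emptyI card.empty zero_le simp_thms)
    next
      case False
      then obtain B where B: "B \<in> ?C" "z \<in> B" by blast
      then have "{B \<in> ?C. z \<in> B} = {B}" using disj by blast
      then show ?thesis by (simp only: finite.emptyI finite_insert card_1_singleton_iff) auto
    qed
    ultimately show ?thesis by blast
  qed
qed


lemma translate_pball:
  assumes "v \<in> padic_space s"
  shows "(\<lambda>x i. v i + x i) ` pball s x r = pball s (\<lambda>i. v i + x i) r"
proof (rule subset_antisym)
  show "(\<lambda>x i. v i + x i) ` pball s x r \<subseteq> pball s (\<lambda>i. v i + x i) r"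
    using assms by (auto simp: pball_def padic_space_def)
  show "pball s (\<lambda>i. v i + x i) r \<subseteq> (\<lambda>x i. v i + x i) ` pball s x r"
  proof
    fix y assume "y \<in> pball s (\<lambda>i. v i + x i) r"
    then have "(\<lambda>i. y i - v i) \<in> pball s x r"
      using assms by (auto simp: pball_def padic_space_def algebra_simps)
    then show "y \<in> (\<lambda>x i. v i + x i) ` pball s x r"
      by (intro image_eqI[of _ _ "\<lambda>i. y i - v i"]) simp_all
  qed
qed

text \<open>A closed subset of a complete space, totally bounded by the finite coverings of
  \<open>padic_cover\<close>.\<close>

lemma compact_padic_ball: "compact {z :: 'p::prime_card padic. padic_norm z \<le> r}"
  unfolding compact_eq_totally_bounded complete_eq_closed
proof (intro conjI allI impI)
  show "closed {z :: 'p padic. padic_norm z \<le> r}"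
    by (intro closed_Collect_le continuous_on_padic_norm continuous_on_id continuous_on_const)
  fix e :: real assume e: "e > 0"
  let ?p = "real CARD('p)"
  have p: "?p > 1" by (rule CARD_prime_real_gt_1)
  obtain k where k: "?p powi (k - 1) < e" using powi_scale[OF p e] by blast
  define i where "i = k - 1"
  have pi: "?p powi i > 0" using p by simp
  obtain j where "r / ?p powi i < ?p ^ j" using real_arch_pow[OF p] by blast
  then have j: "r \<le> ?p powi (i + int j)" using p pi by (simp add: power_int_add field_simps)
  show "\<exists>K. finite K \<and> {z :: 'p padic. padic_norm z \<le> r} \<subseteq> (\<Union>x\<in>K. ball x e)"
  proof (intro exI conjI subsetI)
    show "finite ((\<lambda>a. padic_scale (i + int j) * of_nat a :: 'p padic) ` {..<CARD('p) ^ j})" by simp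
    fix z :: "'p padic" assume "z \<in> {z. padic_norm z \<le> r}"
    then obtain a where a: "a < CARD('p) ^ j" "padic_norm (z - padic_scale (i + int j) * of_nat a) \<le> ?p powi i"
      using padic_cover[of z i j] j by force
    then have "z \<in> ball (padic_scale (i + int j) * of_nat a) e"
      using k by (simp add: i_def dist_padic_def padic_norm_minus_commute)
    then show "z \<in> (\<Union>x\<in>(\<lambda>a. padic_scale (i + int j) * of_nat a :: 'p padic) ` {..<CARD('p) ^ j}. ball x e)"
      using a(1) by blast
  qed
qed

lemma compact_closed_pball:
  "compact {y \<in> padic_space s. \<forall>i<s. padic_norm (y i :: 'p::prime_card padic) \<le> r}"
proof -
  let ?S = "\<lambda>i. if i < s then {z :: 'p padic. padic_norm z \<le> r} else {0}"
  have "compactin (product_topology (\<lambda>i::nat. euclidean :: 'p padic topology) UNIV) (PiE UNIV ?S)"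
    unfolding compactin_PiE by (simp add: compactin_euclidean_iff compact_padic_ball)
  then have "compact (PiE UNIV ?S)" by (simp add: euclidean_product_topology compactin_euclidean_iff)
  also have "PiE UNIV ?S = {y \<in> padic_space s. \<forall>i<s. padic_norm (y i) \<le> r}"
    by (auto simp: PiE_iff padic_space_def split: if_splits)
  finally show ?thesis .
qed

lemma zero_in_padic_space: "(\<lambda>_. 0) \<in> padic_space s"
  by (simp add: padic_space_def)

section \<open>Consequences of translation invariance\<close>

context
  fixes s :: nat and \<eta> :: "(nat \<Rightarrow> 'p::prime_card padic) measure"
  assumes haar: "haar_measure s \<eta>"
begin

lemma haar_sets: "sets \<eta> = sets (restrict_space borel (padic_space s))"
  using haar by (simp add: haar_measure_def)

lemma haar_space: "space \<eta> = padic_space s"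
  using sets_eq_imp_space_eq[OF haar_sets] by (simp add: space_restrict_space)

lemma haar_translate:
  "v \<in> padic_space s \<Longrightarrow> A \<in> sets \<eta> \<Longrightarrow> emeasure \<eta> ((\<lambda>x i. v i + x i) ` A) = emeasure \<eta> A"
  using haar by (simp add: haar_measure_def)

lemma haar_pball_sets [measurable]: "pball s x r \<in> sets \<eta>"
  unfolding haar_sets by (rule pball_sets)

lemma haar_pball_eq:
  assumes "x \<in> padic_space s"
  shows "emeasure \<eta> (pball s x r) = emeasure \<eta> (pball s (\<lambda>_. 0) r)"
proof -
  have "(\<lambda>y i. x i + y i) ` pball s (\<lambda>_. 0) r = pball s x r"
    using translate_pball[OF assms, of "\<lambda>_. 0" r] by (simp only: add_0_right)
  then show ?thesis using haar_translate[OF assms haar_pball_sets, of "\<lambda>_. 0" r] by (simp only:)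
qed

text \<open>If one ball were null, so would be its translates, and those around the rational points
  cover the space.\<close>

lemma haar_pball_pos:
  assumes "x \<in> padic_space s" "r > 0"
  shows "emeasure \<eta> (pball s x r) > 0"
proof (rule ccontr)
  assume "\<not> ?thesis"
  then have z: "emeasure \<eta> (pball s y r) = 0" if "y \<in> padic_space s" for y
    using haar_pball_eq[OF assms(1), of r] haar_pball_eq[OF that, of r] by (simp add: zero_less_iff_neq_zero)
  have "(\<Union>q\<in>rat_points s. pball s q r) \<in> null_sets \<eta>"
    using z rat_points_subset by (intro null_sets_UN' countable_rat_points) (auto intro!: null_setsI)
  moreover have "(padic_space s :: (nat \<Rightarrow> 'p padic) set) \<subseteq> (\<Union>q\<in>rat_points s. pball s q r)"
  proof
    fix y :: "nat \<Rightarrow> 'p padic" assume y: "y \<in> padic_space s"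
    obtain q where q: "q \<in> rat_points s" "q \<in> pball s y r" using rat_points_dense[OF assms(2)] by blast
    then have "pball s q r = pball s y r" using pball_eq by blast
    then show "y \<in> (\<Union>q\<in>rat_points s. pball s q r)" using q(1) centre_in_pball[OF y assms(2)] by blast
  qed
  ultimately have "emeasure \<eta> (padic_space s) \<le> 0"
    by (metis emeasure_mono null_setsD1 null_setsD2)
  then show False using haar by (simp add: haar_measure_def)
qed

lemma haar_pball_finite:
  assumes "x \<in> padic_space s"
  shows "emeasure \<eta> (pball s x r) < \<infinity>"
proof -
  let ?K = "{y \<in> padic_space s. \<forall>i<s. padic_norm (y i :: 'p padic) \<le> r}"
  have cK: "compact ?K" by (rule compact_closed_pball)
  have "?K = ?K \<inter> padic_space s" by blast
  then have "?K \<in> sets \<eta>"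
    unfolding haar_sets sets_restrict_space using borel_closed[OF compact_imp_closed[OF cK]]
    by (metis (no_types, lifting) imageI inf_commute)
  moreover have "pball s (\<lambda>_. 0) r \<subseteq> ?K" by (auto simp: pball_def)
  ultimately have "emeasure \<eta> (pball s (\<lambda>_. 0) r) \<le> emeasure \<eta> ?K" by (intro emeasure_mono)
  also have "\<dots> < \<infinity>" using haar cK by (auto simp: haar_measure_def)
  finally show ?thesis by (simp add: haar_pball_eq[OF assms])
qed

interpretation besicovitch_measure "padic_space s" "pdist s" \<eta> 1
proof
  show "space \<eta> = padic_space s" by (rule haar_space)
  show "pspace.mball s x r \<in> sets \<eta>" for x r
  proof (cases "x \<in> padic_space s \<and> r > 0")
    case True
    then show ?thesis by (simp add: mball_eq_pball)
  next
    case False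
    then have "pspace.mball s x r = {}" by (auto simp: pspace.mball_eq_empty)
    then show ?thesis by (simp only: sets.empty_sets)
  qed
  show "(1::nat) \<le> 1" by simp
qed (rule pspace_besicovitch)

lemma haar_besicovitch_measure: "besicovitch_measure (padic_space s) (pdist s) \<eta> 1"
  by unfold_locales

lemma haar_supp: "supp = padic_space s"
proof (rule subset_antisym[OF supp_subset subsetI])
  fix x :: "nat \<Rightarrow> 'p padic" assume x: "x \<in> padic_space s"
  have "emeasure \<eta> (pspace.mball s x r) > 0" if "r > 0" for r
    unfolding mball_eq_pball[OF x that] by (rule haar_pball_pos[OF x that])
  then show "x \<in> supp" using x unfolding supp_def by blast
qed

text \<open>If \<open>p^k < r \<le> p^(k+1)\<close>, then \<open>3 r \<le> p^(k+3)\<close> because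
  \<open>3 \<le> p\<^sup>2\<close>. In each of the \<open>s\<close> coordinates \<open>p^3\<close>
  translates suffice to pass from radius \<open>p^(k+3)\<close> to \<open>p^k\<close>.\<close>

lemma haar_doubling: "ball_doubling (real (CARD('p) ^ 3) ^ s) U"
  unfolding ball_doubling_def haar_supp
proof (intro ballI allI impI)
  fix x :: "nat \<Rightarrow> 'p padic" and r :: real assume x: "x \<in> padic_space s" and r: "r > 0"
  let ?p = "real CARD('p)"
  have p: "?p \<ge> 2" by (rule CARD_prime_ge_2)
  then have p1: "?p > 1" by linarith
  obtain k' where k': "?p powi (k' - 1) < r" "r \<le> ?p powi k'" using powi_scale[OF p1 r] by blast
  define k where "k = k' - 1"
  have k: "?p powi k < r" "3 * r \<le> ?p powi (k + int 3)"
  proof -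
    show "?p powi k < r" using k' by (simp add: k_def)
    have "3 * r \<le> 3 * ?p powi k'" using k' by simp
    also have "\<dots> \<le> ?p ^ 2 * ?p powi k'"
      using p1 power_mono[OF p, of 2] by (intro mult_right_mono) auto
    also have "\<dots> = ?p powi (k + int 3)"
      using p1 power_int_add[of ?p 2 k'] by (simp add: k_def)
    finally show "3 * r \<le> ?p powi (k + int 3)" .
  qed
  define \<pi> :: "'p padic" where "\<pi> = padic_scale (k + int 3)"
  define S where "S = PiE {..<s} (\<lambda>_. {..<CARD('p) ^ 3})"
  define t where "t = (\<lambda>(f :: nat \<Rightarrow> nat) i. if i < s then x i + \<pi> * of_nat (f i) else 0)"
  have tM: "t f \<in> padic_space s" for f by (simp add: t_def padic_space_def)
  have finS: "finite S" "card S = (CARD('p) ^ 3) ^ s" unfolding S_def by (auto intro: finite_PiE simp: card_PiE)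
  have "pball s x (3 * r) \<subseteq> (\<Union>f\<in>S. pball s (t f) r)"
  proof
    fix y assume y: "y \<in> pball s x (3 * r)"
    have "\<exists>a<CARD('p) ^ 3. padic_norm ((y i - x i) - \<pi> * of_nat a) \<le> ?p powi k" if "i < s" for i
    proof -
      have "padic_norm (x i - y i) < 3 * r" using y that by (simp add: pball_def)
      then have "padic_norm (y i - x i) < 3 * r" by (simp only: padic_norm_minus_commute[of "y i" "x i"])
      then have "padic_norm (y i - x i) \<le> ?p powi (k + int 3)" using k(2) by linarith
      then show ?thesis unfolding \<pi>_def by (rule padic_cover)
    qed
    then obtain f where f: "\<And>i. i < s \<Longrightarrow> f i < CARD('p) ^ 3"
      "\<And>i. i < s \<Longrightarrow> padic_norm ((y i - x i) - \<pi> * of_nat (f i)) \<le> ?p powi k" by metis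
    define g where "g = restrict f {..<s}"
    have "g \<in> S" using f(1) by (auto simp: S_def g_def)
    moreover have "y \<in> pball s (t g) r"
    proof -
      have "padic_norm (t g i - y i) < r" if "i < s" for i
      proof -
        have "padic_norm (t g i - y i) = padic_norm ((y i - x i) - \<pi> * of_nat (f i))"
          using that padic_norm_minus[of "t g i - y i"] by (simp add: t_def g_def algebra_simps)
        then show ?thesis using f(2)[OF that] k(1) by linarith
      qed
      then show ?thesis using y by (simp add: pball_def)
    qed
    ultimately show "y \<in> (\<Union>f\<in>S. pball s (t f) r)" by blast
  qed
  then have "emeasure \<eta> (pball s x (3 * r)) \<le> emeasure \<eta> (\<Union>f\<in>S. pball s (t f) r)"
    using finS by (intro emeasure_mono) auto
  also have "\<dots> \<le> (\<Sum>f\<in>S. emeasure \<eta> (pball s (t f) r))"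
    using finS by (intro emeasure_subadditive_finite) auto
  also have "\<dots> = (\<Sum>f\<in>S. emeasure \<eta> (pball s x r))"
    by (intro sum.cong refl) (simp add: haar_pball_eq[OF tM] haar_pball_eq[OF x])
  also have "\<dots> = ennreal (real (CARD('p) ^ 3) ^ s) * emeasure \<eta> (pball s x r)"
    by (simp add: finS ennreal_of_nat_eq_real_of_nat)
  finally show "emeasure \<eta> (pspace.mball s x (3 * r)) \<le> ennreal (real (CARD('p) ^ 3) ^ s) * emeasure \<eta> (pspace.mball s x r)"
    using x r by (simp add: mball_eq_pball)
qed

text \<open>If \<open>f\<close> takes a value of norm \<open>m\<close> at \<open>z\<close> and one of norm below \<open>e \<le> m\<close> at \<open>y\<close>, some
  coordinate direction \<open>\<tau> = y\<^sub>i - z\<^sub>i\<close> changes \<open>f\<close> by at least \<open>m\<close>, and the translates of the sublevel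
  set by \<open>j \<tau>\<close>, \<open>j \<le> m / e\<close>, are disjoint.\<close>

lemma haar_affine_good:
  fixes c0 :: "'p padic" and c :: "nat \<Rightarrow> 'p padic"
  defines "f \<equiv> \<lambda>x. c0 + (\<Sum>i<s. c i * x i)"
  assumes meas: "\<And>e. {x \<in> padic_space s. padic_norm (f x) < e} \<in> sets \<eta>"
  shows "ball_good 2 1 U (\<lambda>x. padic_norm (f x))"
  unfolding ball_good_def haar_supp
proof (intro ballI allI impI)
  fix x z :: "nat \<Rightarrow> 'p padic" and r e :: real
  assume x: "x \<in> padic_space s" and r: "0 < r" and z: "z \<in> pspace.mball s x r \<inter> padic_space s"
    and e: "0 < e" and fz: "0 < padic_norm (f z)"
  define m where "m = padic_norm (f z)"
  define A where "A = {y \<in> pball s x r. padic_norm (f y) < e}"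
  have zb: "z \<in> pball s x r" using z x r by (simp add: mball_eq_pball)
  have As: "A \<in> sets \<eta>"
  proof -
    have "A = pball s x r \<inter> {y \<in> padic_space s. padic_norm (f y) < e}" by (auto simp: A_def pball_def)
    then show ?thesis using meas by auto
  qed
  have AB: "A \<subseteq> pball s x r" by (auto simp: A_def)
  have "emeasure \<eta> A \<le> ennreal (2 * (e / m)) * emeasure \<eta> (pball s x r)"
  proof (cases "emeasure \<eta> A = 0 \<or> e > m")
    case True
    then show ?thesis
    proof
      assume "e > m"
      have "emeasure \<eta> A \<le> 1 * emeasure \<eta> (pball s x r)" using AB by (auto intro: emeasure_mono)
      also have "\<dots> \<le> ennreal (2 * (e / m)) * emeasure \<eta> (pball s x r)"
        using \<open>e > m\<close> fz by (intro mult_right_mono) (auto simp: m_def ennreal_ge_1 field_simps)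
      finally show ?thesis .
    qed simp
  next
    case False
    then have "A \<noteq> {}" and em: "e \<le> m" by auto
    then obtain y where y: "y \<in> pball s x r" "padic_norm (f y) < e" by (auto simp: A_def)
    \<comment> \<open>Otherwise \<open>f y - f z\<close> has norm below \<open>m\<close>, which
      forces \<open>f y\<close> to have norm exactly \<open>m\<close>, against its being below
      \<open>e \<le> m\<close>.\<close>
    have "\<exists>i<s. padic_norm (c i * (y i - z i)) \<ge> m"
    proof (rule ccontr)
      assume "\<not> ?thesis"
      then have lt: "\<And>i. i < s \<Longrightarrow> padic_norm (c i * (y i - z i)) < m" by force
      have fd: "f y - f z = (\<Sum>i<s. c i * (y i - z i))"
        by (simp add: f_def sum_subtractf algebra_simps)
      define B where "B = Max (insert 0 ((\<lambda>i. padic_norm (c i * (y i - z i))) ` {..<s}))"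
      have "B < m" unfolding B_def using lt fz m_def by (subst Max_less_iff) auto
      moreover have "padic_norm (f y - f z) \<le> B"
        unfolding fd by (rule padic_norm_sum_le) (auto simp: B_def intro!: Max_ge)
      ultimately have "padic_norm (f z - f y) < padic_norm (f z)"
        by (simp add: m_def padic_norm_minus_commute)
      then have "padic_norm (f y) = m" unfolding m_def by (rule padic_norm_eq_of_diff_less)
      then show False using y(2) em by linarith
    qed
    then obtain i where i: "i < s" "padic_norm (c i * (y i - z i)) \<ge> m" by blast
    define \<tau> where "\<tau> = (\<lambda>k. if k = i then y i - z i else 0)"
    have ni: "padic_norm (y i - z i) < r"
    proof -
      have "padic_norm (x i - y i) < r" "padic_norm (x i - z i) < r"
        using y(1) zb i(1) by (auto simp: pball_def)
      then show ?thesis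
        using padic_norm_diff_ultra[of "x i - z i" "x i - y i"] by simp
    qed
    \<comment> \<open>Rounding down loses at most a factor 2, which is the constant \<open>C\<close>
      of the lemma.\<close>
    define J where "J = nat \<lfloor>m / e\<rfloor>"
    have "m / e \<ge> 1" using em e by simp
    then have "\<lfloor>m / e\<rfloor> \<ge> 1" by simp
    then have "real J = of_int \<lfloor>m / e\<rfloor>" "(of_int \<lfloor>m / e\<rfloor> :: real) \<ge> 1" by (simp_all add: J_def)
    then have J: "real J \<le> m / e" "m / e \<le> 2 * real J" by linarith+
    define v where "v = (\<lambda>(j::nat) k. of_nat j * \<tau> k)"
    have vM: "v j \<in> padic_space s" for j using i(1) by (auto simp: v_def \<tau>_def padic_space_def)
    have fv: "f (\<lambda>k. v j k + a k) = f a + of_nat j * (c i * (y i - z i))" for j a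
    proof -
      have "(\<Sum>k<s. c k * (v j k + a k)) = (\<Sum>k<s. c k * a k) + (\<Sum>k<s. c k * v j k)"
        by (simp add: sum.distrib algebra_simps)
      also have "(\<Sum>k<s. c k * v j k) = (\<Sum>k<s. if k = i then of_nat j * (c i * (y i - z i)) else 0)"
        by (intro sum.cong) (auto simp: v_def \<tau>_def)
      also have "\<dots> = of_nat j * (c i * (y i - z i))" using i(1) by simp
      finally show ?thesis by (simp add: f_def algebra_simps)
    qed
    let ?A = "\<lambda>j. (\<lambda>a k. v j k + a k) ` A"
    have Ae: "emeasure \<eta> (?A j) = emeasure \<eta> A" for j by (rule haar_translate[OF vM As])
    have Aj: "?A j \<in> sets \<eta>" for j
      using False Ae[of j] by (intro emeasure_neq_0_sets) simp
    \<comment> \<open>As \<open>y\<close> and \<open>z\<close> lie in the ball,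
      \<open>\<tau>\<close> has norm below \<open>r\<close>; natural multiples are no longer, and
      translations by them preserve the ball.\<close>
    have Asub: "?A j \<subseteq> pball s x r" for j
    proof safe
      fix a assume a: "a \<in> A"
      then have ax: "\<And>k. k < s \<Longrightarrow> padic_norm (x k - a k) < r" "a \<in> padic_space s" by (auto simp: A_def pball_def)
      have vr: "padic_norm (v j k) < r" for k
      proof -
        have "padic_norm (of_nat j :: 'p padic) * padic_norm (\<tau> k) \<le> 1 * padic_norm (\<tau> k)"
          by (intro mult_right_mono padic_norm_of_nat_le_1) auto
        moreover have "padic_norm (\<tau> k) < r" using ni r by (simp add: \<tau>_def)
        ultimately show ?thesis by (simp add: v_def padic_norm_mult)
      qed
      have "padic_norm (x k - (v j k + a k)) < r" if "k < s" for k
      proof -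
        have "x k - (v j k + a k) = (x k - a k) - v j k" by simp
        then have "padic_norm (x k - (v j k + a k)) \<le> max (padic_norm (x k - a k)) (padic_norm (v j k))"
          using padic_norm_diff_ultra by metis
        then show ?thesis using ax(1)[OF that] vr[of k] by linarith
      qed
      then show "(\<lambda>k. v j k + a k) \<in> pball s x r"
        using vM[of j] ax(2) by (auto simp: pball_def padic_space_def)
    qed
    have disj: "disjoint_family_on ?A {..<J}"
      unfolding disjoint_family_on_def
    proof (intro ballI impI)
      fix j j' assume jj: "j \<in> {..<J}" "j' \<in> {..<J}" "j \<noteq> j'"
      show "?A j \<inter> ?A j' = {}"
      proof (rule ccontr)
        assume "?A j \<inter> ?A j' \<noteq> {}"
        then obtain a a' where a: "a \<in> A" "a' \<in> A" "(\<lambda>k. v j k + a k) = (\<lambda>k. v j' k + a' k)" by blast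
        let ?C = "c i * (y i - z i)"
        have "f a + of_nat j * ?C = f a' + of_nat j' * ?C" using fv[of j a] fv[of j' a'] a(3) by simp
        then have "(of_nat j - of_nat j') * ?C = f a' - f a" by (simp add: algebra_simps)
        moreover have "padic_norm (f a' - f a) < e"
          using a padic_norm_diff_ultra[of "f a'" "f a"] by (auto simp: A_def)
        ultimately have lt: "padic_norm (of_nat j - of_nat j' :: 'p padic) * padic_norm ?C < e"
          by (metis padic_norm_mult)
        define n where "n = (if j < j' then j' - j else j - j')"
        have n: "n > 0" "n < J" using jj by (auto simp: n_def)
        have "(of_nat j - of_nat j' :: 'p padic) = of_nat n \<or> (of_nat j - of_nat j' :: 'p padic) = - of_nat n"
          by (auto simp: n_def of_nat_diff)
        then have "padic_norm (of_nat j - of_nat j' :: 'p padic) = padic_norm (of_nat n :: 'p padic)" by auto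
        then have "1 / real n * m \<le> padic_norm (of_nat j - of_nat j' :: 'p padic) * padic_norm ?C"
          using padic_norm_of_nat_ge[OF n(1), where 'p='p] i(2) fz by (intro mult_mono) (auto simp: m_def)
        then have "m / real n < e" using lt by simp
        then have "m / e < real n" using n(1) e by (simp add: field_simps)
        then show False using n(2) J(1) by linarith
      qed
    qed
    have "ennreal (real J) * emeasure \<eta> A = (\<Sum>j<J. emeasure \<eta> (?A j))"
      by (simp add: Ae ennreal_of_nat_eq_real_of_nat)
    also have "\<dots> = emeasure \<eta> (\<Union>j<J. ?A j)"
      using Aj disj by (intro sum_emeasure) auto
    also have "\<dots> \<le> emeasure \<eta> (pball s x r)" using Asub by (intro emeasure_mono) auto
    finally have JA: "ennreal (real J) * emeasure \<eta> A \<le> emeasure \<eta> (pball s x r)" .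
    have J0: "real J > 0" using J \<open>m / e \<ge> 1\<close> by linarith
    have m0: "m > 0" using fz by (simp add: m_def)
    have "emeasure \<eta> A = ennreal (1 / real J) * (ennreal (real J) * emeasure \<eta> A)"
      using J0 by (simp add: mult.assoc[symmetric] ennreal_mult[symmetric])
    also have "\<dots> \<le> ennreal (2 * (e / m)) * emeasure \<eta> (pball s x r)"
    proof (intro mult_mono JA ennreal_leI)
      show "1 / real J \<le> 2 * (e / m)" using J(2) J0 m0 e by (simp add: field_simps)
    qed auto
    finally show ?thesis .
  qed
  then show "emeasure \<eta> {y \<in> pspace.mball s x r. padic_norm (f y) < e}
      \<le> ennreal (2 * (e / padic_norm (f z)) powr 1) * emeasure \<eta> (pspace.mball s x r)"
    using x r e fz by (simp add: A_def m_def mball_eq_pball)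
qed

end

section \<open>Existence of Haar measure\<close>

lemma digit_sum_unique:
  fixes d :: "nat \<Rightarrow> nat"
  assumes "\<And>l. l < k \<Longrightarrow> d l < p" "j < k"
  shows "(\<Sum>l<k. d l * p ^ l) div p ^ j mod p = d j"
  using assms
proof (induction k)
  case (Suc k)
  have p: "p > 0" using Suc.prems(1)[of j] Suc.prems(2) by auto
  have lt: "(\<Sum>l<k. d l * p ^ l) < p ^ k" if "\<And>l. l < k \<Longrightarrow> d l < p" for k
    using that
  proof (induction k)
    case (Suc k)
    have "(\<Sum>l<k. d l * p ^ l) < p ^ k" using Suc by simp
    moreover have "(d k + 1) * p ^ k \<le> p * p ^ k" using Suc.prems[of k] by (intro mult_right_mono) auto
    ultimately show ?case by simp
  qed simp
  show ?case
  proof (cases "j = k")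
    case True
    have "(\<Sum>l<k. d l * p ^ l) < p ^ k" using Suc.prems(1) by (intro lt) simp
    then show ?thesis using True Suc.prems(1)[of k] p by simp
  next
    case False
    then have j: "j < k" using Suc.prems(2) by simp
    then have "p ^ k = p ^ (k - j - 1) * p * p ^ j"
      by (metis (no_types, lifting) Suc_diff_Suc add.commute diff_diff_left le_add_diff_inverse2 less_imp_le
          mult.commute plus_1_eq_Suc power_Suc power_add)
    then have "(\<Sum>l<Suc k. d l * p ^ l) div p ^ j = (d k * p ^ (k - j - 1) * p) + (\<Sum>l<k. d l * p ^ l) div p ^ j"
      using p by (simp add: mult.assoc[symmetric])
    then show ?thesis using Suc.IH Suc.prems(1) j by simp
  qed
qed simp

lemma digit_sum_mod:
  fixes A :: nat
  shows "(\<Sum>l<k. (A div p ^ l mod p) * p ^ l) = A mod p ^ k"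
proof (induction k)
  case (Suc k)
  have "A mod p ^ Suc k = p ^ k * (A div p ^ k mod p) + A mod p ^ k"
    using mod_mult2_eq[of A "p ^ k" p] by (simp add: mult.commute)
  then show ?case using Suc by (simp add: mult.commute)
qed simp

text \<open>A positive difference \<open>n\<close> below \<open>p^k\<close> has norm at least
  \<open>1 / n\<close>, hence above \<open>p^-k\<close>.\<close>

lemma of_nat_eq_of_padic_close:
  assumes "A < CARD('p) ^ k" "B < CARD('p) ^ k"
    and "padic_norm (of_nat A - of_nat B :: 'p::prime_card padic) \<le> 1 / real CARD('p) ^ k"
  shows "A = B"
proof (rule ccontr)
  assume ne: "A \<noteq> B"
  define n where "n = (if A < B then B - A else A - B)"
  have n: "n > 0" "n < CARD('p) ^ k" using ne assms(1,2) by (auto simp: n_def)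
  have "(of_nat A - of_nat B :: 'p padic) = of_nat n \<or> (of_nat A - of_nat B :: 'p padic) = - of_nat n"
    by (auto simp: n_def of_nat_diff)
  then have "padic_norm (of_nat A - of_nat B :: 'p padic) = padic_norm (of_nat n :: 'p padic)" by auto
  then have "1 / real n \<le> 1 / real CARD('p) ^ k" using padic_norm_of_nat_ge[OF n(1), where 'p='p] assms(3) by linarith
  then have "real (CARD('p) ^ k) \<le> real n" using n(1) CARD_prime_ge_2[where 'p='p] by (simp add: field_simps)
  then show False using n(2) by linarith
qed

text \<open>Norms being powers of \<open>p\<close> or 0, an open ball of this radius is a closed
  ball of radius \<open>p^-k\<close>, that is, a coset of p^k Z_p^s.\<close>

abbreviation radius :: "'p::prime_card itself \<Rightarrow> nat \<Rightarrow> real" where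
  "radius _ k \<equiv> real CARD('p) powi (1 - int k)"

lemma padic_norm_less_radius: 
  "padic_norm (z :: 'p::prime_card padic) < radius TYPE('p) k \<longleftrightarrow> padic_norm z \<le> 1 / real CARD('p) ^ k"
  using padic_norm_less_powi_iff[of z "- int k"] by (simp add: power_int_minus inverse_eq_divide add.commute)

text \<open>A generator of the Borel sets on which Haar measure is explicit. The empty set is
  included for stability under intersections.\<close>

definition small_balls :: "nat \<Rightarrow> (nat \<Rightarrow> 'p::prime_card padic) set set" where
  "small_balls s = insert {} {pball s x (radius TYPE('p) k) | x k. x \<in> padic_space s}"

lemma small_balls_subset: "small_balls s \<subseteq> Pow (padic_space s)"
  using pball_subset by (auto simp: small_balls_def)

lemma small_balls_I:
  fixes x :: "nat \<Rightarrow> 'p::prime_card padic"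
  shows "x \<in> padic_space s \<Longrightarrow> pball s x (radius TYPE('p) k) \<in> small_balls s"
  unfolding small_balls_def by blast

lemma radius_pos: "radius TYPE('p::prime_card) k > 0"
  using CARD_prime_ge_2[where 'p='p] by simp

lemma Int_stable_small_balls: "Int_stable (small_balls s :: (nat \<Rightarrow> 'p::prime_card padic) set set)"
proof (rule Int_stableI)
  fix A B :: "(nat \<Rightarrow> 'p padic) set" assume AB: "A \<in> small_balls s" "B \<in> small_balls s"
  show "A \<inter> B \<in> small_balls s"
  proof (cases "A \<inter> B = {}")
    case True
    then show ?thesis by (simp add: small_balls_def)
  next
    case False
    then obtain z where z: "z \<in> A" "z \<in> B" by blast
    have mem: "\<exists>k. X = pball s z (radius TYPE('p) k)" if "X \<in> small_balls s" "z \<in> X" for X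
      using that pball_eq by (auto simp: small_balls_def) blast
    obtain k where k: "A = pball s z (radius TYPE('p) k)" using mem AB z by blast
    obtain j where j: "B = pball s z (radius TYPE('p) j)" using mem AB z by blast
    have "A \<subseteq> B \<or> B \<subseteq> A"
    proof -
      have "radius TYPE('p) k \<le> radius TYPE('p) j \<or> radius TYPE('p) j \<le> radius TYPE('p) k" by linarith
      then show ?thesis unfolding k j pball_def by (auto intro: order.strict_trans2)
    qed
    then show ?thesis using AB by (metis inf.absorb1 inf.absorb2)
  qed
qed

lemma open_contains_small_ball:
  fixes U :: "(nat \<Rightarrow> 'p::prime_card padic) set"
  assumes U: "open U" and x: "x \<in> U" "x \<in> padic_space s"
  shows "\<exists>k. pball s x (radius TYPE('p) k) \<subseteq> U"
proof -
  let ?p = "real CARD('p)"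
  have p: "?p > 1" by (rule CARD_prime_real_gt_1)
  have "openin (product_topology (\<lambda>_::nat. euclidean :: 'p padic topology) UNIV) U"
    using U by (simp add: euclidean_product_topology)
  then obtain X where X: "x \<in> PiE UNIV X" "\<And>i. openin euclidean (X i)" "PiE UNIV X \<subseteq> U"
    using product_topology_open_contains_basis[of "\<lambda>_. euclidean" UNIV U x] x(1) by auto
  have "\<exists>e>0. ball (x i) e \<subseteq> X i" for i
    using X(1) X(2)[of i] open_contains_ball_eq[of "X i" "x i"] by (auto simp: PiE_iff)
  then obtain e where e: "\<And>i. e i > 0" "\<And>i. ball (x i) (e i) \<subseteq> X i" by metis
  define m where "m = Min (insert 1 (e ` {..<s}))"
  have m: "m > 0" "\<And>i. i < s \<Longrightarrow> m \<le> e i" unfolding m_def using e(1) by (auto intro!: Min_le)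
  obtain k where "(1 / ?p) ^ k < m" using real_arch_pow_inv[OF m(1), of "1 / ?p"] p by auto
  then have k: "1 / ?p ^ k < m" by (simp add: power_divide)
  have "pball s x (radius TYPE('p) k) \<subseteq> PiE UNIV X"
  proof
    fix y assume y: "y \<in> pball s x (radius TYPE('p) k)"
    have "y i \<in> X i" for i
    proof (cases "i < s")
      case True
      then have "padic_norm (x i - y i) \<le> 1 / ?p ^ k"
        using y padic_norm_less_radius[of "x i - y i" k] by (simp add: pball_def)
      then have "y i \<in> ball (x i) (e i)" using k m(2)[OF True] by (simp add: dist_padic_def)
      then show ?thesis using e(2) by blast
    next
      case False
      then have "y i = x i" using y x(2) by (simp add: pball_def padic_space_def)
      then show ?thesis using X(1) by (auto simp: PiE_iff)
    qed
    then show "y \<in> PiE UNIV X" by auto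
  qed
  then show ?thesis using X(3) by blast
qed

text \<open>An open set is the union of the small balls around rational points that it contains, and
  there are countably many of these.\<close>

lemma sets_padic_space:
  "sets (restrict_space borel (padic_space s)) = sigma_sets (padic_space s) (small_balls s :: (nat \<Rightarrow> 'p::prime_card padic) set set)"
    (is "sets ?B = ?\<Sigma>")
proof (rule subset_antisym)
  have "small_balls s \<subseteq> sets ?B" using pball_sets by (auto simp: small_balls_def)
  then show "?\<Sigma> \<subseteq> sets ?B" using sets.sigma_sets_subset[of "small_balls s" ?B] by (simp add: space_restrict_space)
  have "padic_space s \<inter> S \<in> ?\<Sigma>" if "S \<in> sets borel" for S :: "(nat \<Rightarrow> 'p padic) set"
  proof -
    have "S \<in> sigma_sets UNIV {S. open S}" using that by (simp add: borel_def)
    then show ?thesis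
    proof (induction rule: sigma_sets.induct)
      case (Basic U)
      let ?I = "{(q, k). q \<in> rat_points s \<and> pball s q (radius TYPE('p) k) \<subseteq> U}"
      have "padic_space s \<inter> U = (\<Union>(q, k)\<in>?I. pball s q (radius TYPE('p) k))"
      proof (intro subset_antisym subsetI)
        fix x assume x: "x \<in> padic_space s \<inter> U"
        then obtain k where k: "pball s x (radius TYPE('p) k) \<subseteq> U"
          using open_contains_small_ball[of U x s] Basic by auto
        obtain q where q: "q \<in> rat_points s" "q \<in> pball s x (radius TYPE('p) k)"
          using rat_points_dense[OF radius_pos] by blast
        then have "pball s q (radius TYPE('p) k) = pball s x (radius TYPE('p) k)" using pball_eq by blast
        moreover have "x \<in> pball s x (radius TYPE('p) k)" using x radius_pos by (intro centre_in_pball) auto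
        ultimately show "x \<in> (\<Union>(q, k)\<in>?I. pball s q (radius TYPE('p) k))" using q(1) k by fastforce
      next
        fix x assume "x \<in> (\<Union>(q, k)\<in>?I. pball s q (radius TYPE('p) k))"
        then show "x \<in> padic_space s \<inter> U" using pball_subset by blast
      qed
      moreover have "countable ?I"
        by (rule countable_subset[of _ "rat_points s \<times> UNIV"]) (auto intro: countable_SIGMA countable_rat_points)
      moreover have "(case z of (q, k) \<Rightarrow> pball s q (radius TYPE('p) k)) \<in> ?\<Sigma>" if "z \<in> ?I" for z
      proof -
        obtain q k where qk: "z = (q, k)" "q \<in> rat_points s" using \<open>z \<in> ?I\<close> by blast
        then have "q \<in> padic_space s" using rat_points_subset by blast
        then show ?thesis unfolding qk(1) prod.case by (intro sigma_sets.Basic small_balls_I)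
      qed
      ultimately have "countable ?I" and eq: "padic_space s \<inter> U = (\<Union>(q, k)\<in>?I. pball s q (radius TYPE('p) k))"
        and mem: "\<And>z. z \<in> ?I \<Longrightarrow> (case z of (q, k) \<Rightarrow> pball s q (radius TYPE('p) k)) \<in> ?\<Sigma>"
        by blast+
      show ?case
        unfolding eq using \<open>countable ?I\<close>
        by (intro sigma_sets_UNION countable_image) (use mem in blast)+
    next
      case Empty
      then show ?case by (simp add: sigma_sets.Empty)
    next
      case (Compl S)
      have "padic_space s \<inter> (UNIV - S) = padic_space s - (padic_space s \<inter> S)" by blast
      then show ?case using Compl sigma_sets.Compl by metis
    next
      case (Union A)
      have "padic_space s \<inter> (\<Union>i. A i) = (\<Union>i. padic_space s \<inter> A i)" by blast
      then show ?case using Union sigma_sets.Union[of "\<lambda>i. padic_space s \<inter> A i"] by simp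
    qed
  qed
  then show "sets ?B \<subseteq> ?\<Sigma>" by (auto simp: sets_restrict_space)
qed

section \<open>Haar measure from independent random digits\<close>

definition digit_space :: "nat \<Rightarrow> (nat \<times> nat \<Rightarrow> nat) measure" where
  "digit_space p = PiM UNIV (\<lambda>_. uniform_count_measure {..<p})"

text \<open>The point of Z_p^s with digit \<open>\<omega> (i, l)\<close> at place \<open>l\<close>
  of coordinate \<open>i\<close>. Under independent uniform digits its distribution is the
  normalised Haar measure of Z_p^s.\<close>

definition digit_point :: "nat \<Rightarrow> (nat \<times> nat \<Rightarrow> nat) \<Rightarrow> nat \<Rightarrow> 'p::prime_card padic" where
  "digit_point s \<omega> i = (if i < s then lim (\<lambda>k. \<Sum>l<k. of_nat (\<omega> (i, l) * CARD('p) ^ l)) else 0)"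

lemma digit_point_approx:
  assumes i: "i < s"
  shows "padic_norm (digit_point s \<omega> i - of_nat (\<Sum>l<k. \<omega> (i, l) * CARD('p) ^ l) :: 'p::prime_card padic)
    \<le> 1 / real CARD('p) ^ k"
proof -
  let ?p = "real CARD('p)"
  have p: "?p > 1" by (rule CARD_prime_real_gt_1)
  define S where "S = (\<lambda>k. \<Sum>l<k. of_nat (\<omega> (i, l) * CARD('p) ^ l) :: 'p padic)"
  have tail: "padic_norm (S m - S n) \<le> 1 / ?p ^ n" if "n \<le> m" for m n
  proof -
    have "S m - S n = (\<Sum>l\<in>{n..<m}. of_nat (\<omega> (i, l) * CARD('p) ^ l))"
      using that by (simp add: S_def sum_diff_nat_ivl lessThan_atLeast0)
    also have "padic_norm \<dots> \<le> 1 / ?p ^ n"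
    proof (rule padic_norm_sum_le)
      fix l assume "l \<in> {n..<m}"
      then have nl: "n \<le> l" by simp
      have "padic_norm (of_nat (\<omega> (i, l) * CARD('p) ^ l) :: 'p padic)
          = padic_norm (of_nat (\<omega> (i, l)) :: 'p padic) * (1 / ?p) ^ l"
        by (simp add: padic_norm_mult padic_norm_power padic_norm_CARD)
      also have "\<dots> \<le> 1 * (1 / ?p) ^ l" by (intro mult_right_mono padic_norm_of_nat_le_1) auto
      also have "\<dots> = 1 / ?p ^ l" by (simp add: power_divide)
      also have "\<dots> \<le> 1 / ?p ^ n" using nl p by (intro divide_left_mono power_increasing) auto
      finally show "padic_norm (of_nat (\<omega> (i, l) * CARD('p) ^ l) :: 'p padic) \<le> 1 / ?p ^ n" .
    qed simp
    finally show ?thesis .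
  qed
  have "Cauchy S"
    unfolding Cauchy_altdef2
  proof (intro allI impI)
    fix e :: real assume "e > 0"
    then obtain N where "(1 / ?p) ^ N < e" using real_arch_pow_inv[of e "1 / ?p"] p by auto
    then have "dist (S n) (S N) < e" if "n \<ge> N" for n
      using tail[OF that] by (simp add: dist_padic_def power_divide)
    then show "\<exists>N. \<forall>n\<ge>N. dist (S n) (S N) < e" by blast
  qed
  then have "S \<longlonglongrightarrow> lim S" by (simp add: Cauchy_convergent convergent_LIMSEQ_iff[symmetric])
  then have lim: "S \<longlonglongrightarrow> digit_point s \<omega> i" using i by (simp add: digit_point_def S_def)
  obtain N where N: "\<And>n. n \<ge> N \<Longrightarrow> dist (S n) (digit_point s \<omega> i) < 1 / ?p ^ k"
    using lim p unfolding lim_sequentially by (metis divide_pos_pos less_trans zero_less_one zero_less_power)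
  have "padic_norm (digit_point s \<omega> i - S (max N k)) \<le> 1 / ?p ^ k"
    using N[of "max N k"] by (simp add: dist_padic_def padic_norm_minus_commute[of "S _"])
  then have "padic_norm ((digit_point s \<omega> i - S (max N k)) + (S (max N k) - S k)) \<le> 1 / ?p ^ k"
    using tail[of k "max N k"] by (intro padic_norm_add_le) auto
  then show ?thesis by (simp add: S_def)
qed

lemma digit_point_in_space: "(digit_point s \<omega> :: nat \<Rightarrow> 'p::prime_card padic) \<in> padic_space s"
  by (simp add: padic_space_def digit_point_def)

lemma prob_digit: "prob_space (uniform_count_measure {..<CARD('p::prime_card)})"
  using CARD_prime_gt_1[where 'p='p] by (intro prob_space_uniform_count_measure) (auto simp: lessThan_empty_iff)

lemma digit_space_cylinder:
  fixes dg :: "nat \<times> nat \<Rightarrow> nat"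
  assumes J: "finite J" and dg: "\<And>j. j \<in> J \<Longrightarrow> dg j < CARD('p::prime_card)"
  defines "A \<equiv> {\<omega> \<in> space (digit_space CARD('p)). \<forall>j\<in>J. \<omega> j \<in> {dg j}}"
  shows "A \<in> sets (digit_space CARD('p))"
    "emeasure (digit_space CARD('p)) A = ennreal ((1 / real CARD('p)) ^ card J)"
proof -
  interpret product_prob_space "\<lambda>_. uniform_count_measure {..<CARD('p)}" "UNIV :: (nat \<times> nat) set"
    unfolding product_prob_space_def product_prob_space_axioms_def product_sigma_finite_def
    using prob_digit[where 'p='p] prob_space_imp_sigma_finite by blast
  have s: "{dg j} \<in> sets (uniform_count_measure {..<CARD('p)})" if "j \<in> J" for j
    using dg[OF that] by (simp add: sets_uniform_count_measure)
  show "A \<in> sets (digit_space CARD('p))"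
    unfolding A_def digit_space_def using J s by measurable
  have "emeasure (digit_space CARD('p)) A = (\<Prod>j\<in>J. emeasure (uniform_count_measure {..<CARD('p)}) {dg j})"
    unfolding A_def digit_space_def using J s by (intro emeasure_PiM_Collect) auto
  also have "\<dots> = (\<Prod>j\<in>J. ennreal (1 / real CARD('p)))"
    using dg by (intro prod.cong refl) (simp add: emeasure_uniform_count_measure)
  also have "\<dots> = ennreal ((1 / real CARD('p)) ^ card J)" by (simp add: ennreal_power)
  finally show "emeasure (digit_space CARD('p)) A = ennreal ((1 / real CARD('p)) ^ card J)" .
qed

text \<open>A small ball inside Z_p^s prescribes the first \<open>k\<close> digits of each of the
  \<open>s\<close> coordinates; any other small ball misses Z_p^s.\<close>

lemma digit_point_ball:
  fixes a :: "nat \<Rightarrow> 'p::prime_card padic" and s k :: nat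
  defines "A \<equiv> {\<omega> \<in> space (digit_space CARD('p)). digit_point s \<omega> \<in> pball s a (radius TYPE('p) k)}"
  shows "A \<in> sets (digit_space CARD('p))"
    "emeasure (digit_space CARD('p)) A
      = (if \<forall>i<s. padic_norm (a i) \<le> 1 then ennreal ((1 / real CARD('p)) ^ (s * k)) else 0)"
proof -
  let ?p = "real CARD('p)" and ?D = "\<lambda>\<omega> i. \<Sum>l<k. \<omega> (i, l) * CARD('p) ^ l :: nat"
  have p: "?p > 1" by (rule CARD_prime_real_gt_1)
  have mem: "digit_point s \<omega> \<in> pball s a (radius TYPE('p) k) \<longleftrightarrow>
      (\<forall>i<s. padic_norm (a i - of_nat (?D \<omega> i)) \<le> 1 / ?p ^ k)" for \<omega>
  proof -
    have "padic_norm (a i - digit_point s \<omega> i) \<le> 1 / ?p ^ k \<longleftrightarrow> padic_norm (a i - of_nat (?D \<omega> i)) \<le> 1 / ?p ^ k"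
      if "i < s" for i
      using digit_point_approx[OF that, of \<omega> k, where 'p='p]
        padic_norm_add_le[of "a i - digit_point s \<omega> i" "1 / ?p ^ k" "digit_point s \<omega> i - of_nat (?D \<omega> i)"]
        padic_norm_diff_le[of "a i - of_nat (?D \<omega> i)" "1 / ?p ^ k" "digit_point s \<omega> i - of_nat (?D \<omega> i)"]
      by (auto simp del: of_nat_sum)
    then show ?thesis using digit_point_in_space[of s \<omega>, where 'p='p] padic_norm_less_radius[where 'p='p]
      by (auto simp: pball_def simp del: of_nat_sum)
  qed
  have "A \<in> sets (digit_space CARD('p)) \<and> emeasure (digit_space CARD('p)) A
      = (if \<forall>i<s. padic_norm (a i) \<le> 1 then ennreal ((1 / ?p) ^ (s * k)) else 0)"
  proof (cases "\<forall>i<s. padic_norm (a i) \<le> 1")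
    case False
    have "A = {}"
    proof (rule ccontr)
      assume "A \<noteq> {}"
      then obtain \<omega> where w: "\<forall>i<s. padic_norm (a i - of_nat (?D \<omega> i)) \<le> 1 / ?p ^ k" unfolding A_def mem by blast
      have "padic_norm (a i) \<le> 1" if "i < s" for i
      proof -
        have "1 / ?p ^ k \<le> 1" using p by simp
        then have "padic_norm (a i - of_nat (?D \<omega> i)) \<le> 1" using w that by (meson order_trans)
        then have "padic_norm ((a i - of_nat (?D \<omega> i)) + of_nat (?D \<omega> i)) \<le> 1"
          by (intro padic_norm_add_le padic_norm_of_nat_le_1)
        then show ?thesis by simp
      qed
      then show False using False by blast
    qed
    then show ?thesis using False by simp
  next
    case True
    have "\<forall>i<s. \<exists>c<CARD('p) ^ k. padic_norm (a i - of_nat c) \<le> 1 / ?p ^ k" using padic_residue True by blast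
    then obtain c where c: "\<And>i. i < s \<Longrightarrow> c i < CARD('p) ^ k" "\<And>i. i < s \<Longrightarrow> padic_norm (a i - of_nat (c i)) \<le> 1 / ?p ^ k"
      by metis
    let ?J = "{..<s} \<times> {..<k}" and ?dg = "\<lambda>(i, l). c i div CARD('p) ^ l mod CARD('p)"
    have "A = {\<omega> \<in> space (digit_space CARD('p)). \<forall>j\<in>?J. \<omega> j \<in> {?dg j}}"
    proof -
      have "digit_point s \<omega> \<in> pball s a (radius TYPE('p) k) \<longleftrightarrow> (\<forall>j\<in>?J. \<omega> j \<in> {?dg j})"
        if \<omega>: "\<omega> \<in> space (digit_space CARD('p))" for \<omega>
      proof -
        have wd: "\<omega> j < CARD('p)" for j using \<omega> by (cases j) (auto simp: digit_space_def space_PiM PiE_iff space_uniform_count_measure)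
        have "padic_norm (a i - of_nat (?D \<omega> i)) \<le> 1 / ?p ^ k \<longleftrightarrow> (\<forall>l<k. \<omega> (i, l) = c i div CARD('p) ^ l mod CARD('p))"
          if i: "i < s" for i
        proof
          assume le: "padic_norm (a i - of_nat (?D \<omega> i)) \<le> 1 / ?p ^ k"
          have dgd: "?D \<omega> i div CARD('p) ^ l mod CARD('p) = \<omega> (i, l)" if "l < k" for l
            by (rule digit_sum_unique[OF wd that])
          have "?D \<omega> i = (\<Sum>l<k. (?D \<omega> i div CARD('p) ^ l mod CARD('p)) * CARD('p) ^ l)"
            by (intro sum.cong refl) (simp add: dgd)
          also have "\<dots> = ?D \<omega> i mod CARD('p) ^ k" by (rule digit_sum_mod)
          finally have "?D \<omega> i = ?D \<omega> i mod CARD('p) ^ k" .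
          then have Dlt: "?D \<omega> i < CARD('p) ^ k"
            by (metis mod_less_divisor zero_less_power zero_less_card_finite)
          have "padic_norm ((a i - of_nat (?D \<omega> i)) - (a i - of_nat (c i))) \<le> 1 / ?p ^ k"
            by (intro padic_norm_diff_le le c(2) i)
          then have "padic_norm (of_nat (c i) - of_nat (?D \<omega> i) :: 'p padic) \<le> 1 / ?p ^ k"
            by (simp add: algebra_simps del: of_nat_sum)
          then have "c i = ?D \<omega> i" by (rule of_nat_eq_of_padic_close[OF c(1)[OF i] Dlt])
          then show "\<forall>l<k. \<omega> (i, l) = c i div CARD('p) ^ l mod CARD('p)" using dgd by simp
        next
          assume "\<forall>l<k. \<omega> (i, l) = c i div CARD('p) ^ l mod CARD('p)"
          then have "?D \<omega> i = (\<Sum>l<k. (c i div CARD('p) ^ l mod CARD('p)) * CARD('p) ^ l)"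
            by (intro sum.cong) auto
          also have "\<dots> = c i" using c(1)[OF i] by (simp add: digit_sum_mod)
          finally show "padic_norm (a i - of_nat (?D \<omega> i)) \<le> 1 / ?p ^ k" using c(2)[OF i] by (simp only:)
        qed
        then show ?thesis unfolding mem by auto
      qed
      then show ?thesis unfolding A_def by blast
    qed
    then show ?thesis
      using digit_space_cylinder[of ?J ?dg, where 'p='p] True by (simp add: case_prod_beta card_cartesian_product)
  qed
  then show "A \<in> sets (digit_space CARD('p))" "emeasure (digit_space CARD('p)) A
      = (if \<forall>i<s. padic_norm (a i) \<le> 1 then ennreal ((1 / ?p) ^ (s * k)) else 0)" by auto
qed


lemma digit_point_measurable:
  "(digit_point s :: _ \<Rightarrow> nat \<Rightarrow> 'p::prime_card padic)
    \<in> measurable (digit_space CARD('p)) (restrict_space borel (padic_space s))"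
proof (rule measurable_sigma_sets[OF sets_padic_space small_balls_subset])
  show "digit_point s \<in> space (digit_space CARD('p)) \<rightarrow> padic_space s"
    using digit_point_in_space by blast
  fix B :: "(nat \<Rightarrow> 'p padic) set" assume "B \<in> small_balls s"
  then consider "B = {}" | x k where "B = pball s x (radius TYPE('p) k)" by (auto simp: small_balls_def)
  then show "digit_point s -` B \<inter> space (digit_space CARD('p)) \<in> sets (digit_space CARD('p))"
  proof cases
    case 2
    have "digit_point s -` B \<inter> space (digit_space CARD('p))
        = {\<omega> \<in> space (digit_space CARD('p)). digit_point s \<omega> \<in> B}" by blast
    then show ?thesis using digit_point_ball(1)[of s x k] 2 by simp
  qed simp
qed

lemma translate_measurable:
  assumes v: "v \<in> padic_space s"
  shows "(\<lambda>x i. v i + x i) \<in> measurable (restrict_space borel (padic_space s))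
    (restrict_space borel (padic_space s) :: (nat \<Rightarrow> 'p::prime_card padic) measure)"
proof (rule measurable_sigma_sets[OF sets_padic_space small_balls_subset])
  let ?B = "restrict_space borel (padic_space s) :: (nat \<Rightarrow> 'p padic) measure"
  have sp: "space ?B = padic_space s" by (simp add: space_restrict_space)
  show "(\<lambda>x i. v i + x i) \<in> space ?B \<rightarrow> padic_space s"
    using v unfolding sp by (auto simp: padic_space_def)
  fix B :: "(nat \<Rightarrow> 'p padic) set" assume "B \<in> small_balls s"
  then consider "B = {}" | x k where "B = pball s x (radius TYPE('p) k)" by (auto simp: small_balls_def)
  then show "(\<lambda>x i. v i + x i) -` B \<inter> space ?B \<in> sets ?B"
  proof cases
    case 2
    have "(\<lambda>x i. v i + x i) -` B \<inter> space ?B = pball s (\<lambda>i. x i - v i) (radius TYPE('p) k)"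
      using v unfolding sp 2 by (auto simp: pball_def padic_space_def algebra_simps)
    then show ?thesis by (simp add: pball_sets)
  qed simp
qed

text \<open>The cosets of Z_p^s are the balls of \<open>radius TYPE('p) 0\<close>. A rational point
  chosen as a function of the coset, not of a centre, is a unique representative, and density makes
  the choices countable in number.\<close>

lemma coset_representatives:
  obtains R :: "(nat \<Rightarrow> 'p::prime_card padic) set" where "countable R" "R \<subseteq> padic_space s"
    "\<And>x. x \<in> padic_space s \<Longrightarrow> \<exists>!r. r \<in> R \<and> x \<in> pball s r (radius TYPE('p) 0)"
proof -
  let ?P = "\<lambda>x :: nat \<Rightarrow> 'p padic. pball s x (radius TYPE('p) 0)"
  have "\<exists>q. q \<in> rat_points s \<and> q \<in> ?P x" for x using rat_points_dense[OF radius_pos] by metis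
  then have "\<exists>q. q \<in> rat_points s \<and> q \<in> B" if "B \<in> range ?P" for B using that by blast
  then obtain rep where rep: "\<And>B. B \<in> range ?P \<Longrightarrow> rep B \<in> rat_points s" "\<And>B. B \<in> range ?P \<Longrightarrow> rep B \<in> B"
    by metis
  show ?thesis
  proof (rule that[of "rep ` range ?P"])
    show "countable (rep ` range ?P)"
      by (rule countable_subset[OF _ countable_rat_points[of s]]) (use rep(1) in blast)
    show "rep ` range ?P \<subseteq> padic_space s" using rep(1) rat_points_subset by blast
    fix x :: "nat \<Rightarrow> 'p padic" assume x: "x \<in> padic_space s"
    show "\<exists>!r. r \<in> rep ` range ?P \<and> x \<in> ?P r"
    proof (rule ex1I[of _ "rep (?P x)"])
      have "rep (?P x) \<in> ?P x" using rep(2) by blast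
      then have "?P (rep (?P x)) = ?P x" by (rule pball_eq)
      then show "rep (?P x) \<in> rep ` range ?P \<and> x \<in> ?P (rep (?P x))"
        using centre_in_pball[OF x radius_pos] by blast
      fix r assume r: "r \<in> rep ` range ?P \<and> x \<in> ?P r"
      then obtain y where y: "r = rep (?P y)" by blast
      have "r \<in> ?P y" using rep(2) y by blast
      then have "?P r = ?P y" by (rule pball_eq)
      moreover have "?P x = ?P r" using r pball_eq by blast
      ultimately show "r = rep (?P x)" using y by simp
    qed
  qed
qed

text \<open>Haar measure is the sum over the cosets of Z_p^s of translated digit measures, obtained
  as the image of counting measure times digit measure. A small ball has mass
  \<open>p^-(s k)\<close> wherever its centre lies, so invariance holds on small balls and extends
  by uniqueness of measures.\<close>

lemma haar_measure_exists: "\<exists>\<eta> :: (nat \<Rightarrow> 'p::prime_card padic) measure. haar_measure s \<eta>"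
proof -
  let ?B = "restrict_space borel (padic_space s) :: (nat \<Rightarrow> 'p padic) measure"
  let ?\<Omega> = "digit_space CARD('p)" and ?p = "real CARD('p)"
  have p: "?p > 1" by (rule CARD_prime_real_gt_1)
  have sp: "space ?B = padic_space s" by (simp add: space_restrict_space)
  obtain R :: "(nat \<Rightarrow> 'p padic) set" where R: "countable R" "R \<subseteq> padic_space s"
    "\<And>x. x \<in> padic_space s \<Longrightarrow> \<exists>!r. r \<in> R \<and> x \<in> pball s r (radius TYPE('p) 0)"
    using coset_representatives by blast
  define F where "F = (\<lambda>(r, \<omega>) i. r i + (digit_point s \<omega> i :: 'p padic))"
  define \<eta> where "\<eta> = distr (count_space R \<Otimes>\<^sub>M ?\<Omega>) ?B F"
  have F: "F \<in> measurable (count_space R \<Otimes>\<^sub>M ?\<Omega>) ?B"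
  proof (rule measurable_pair_measure_countable1[OF R(1)])
    fix r assume "r \<in> R"
    then have "r \<in> padic_space s" using R by blast
    then have "(\<lambda>\<omega>. (\<lambda>x i. r i + x i) (digit_point s \<omega>)) \<in> measurable ?\<Omega> ?B"
      by (intro measurable_compose[OF digit_point_measurable translate_measurable])
    then show "(\<lambda>\<omega>. F (r, \<omega>)) \<in> measurable ?\<Omega> ?B" by (simp add: F_def)
  qed
  interpret \<Omega>: prob_space ?\<Omega>
    unfolding digit_space_def by (intro prob_space_PiM prob_digit)
  have setsB: "sets \<eta> = sets ?B" by (simp add: \<eta>_def)
  have ball: "emeasure \<eta> (pball s a (radius TYPE('p) k)) = ennreal ((1 / ?p) ^ (s * k))"
    if a: "a \<in> padic_space s" for a k
  proof -
    let ?b = "pball s a (radius TYPE('p) k)"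
    let ?X = "F -` ?b \<inter> space (count_space R \<Otimes>\<^sub>M ?\<Omega>)"
    have X: "?X \<in> sets (count_space R \<Otimes>\<^sub>M ?\<Omega>)" using F pball_sets by (rule measurable_sets)
    obtain r0 where r0: "r0 \<in> R" "a \<in> pball s r0 (radius TYPE('p) 0)"
      "\<And>r. r \<in> R \<Longrightarrow> a \<in> pball s r (radius TYPE('p) 0) \<Longrightarrow> r = r0" using R(3)[OF a] by blast
    have "emeasure \<eta> ?b = emeasure (count_space R \<Otimes>\<^sub>M ?\<Omega>) ?X"
      unfolding \<eta>_def by (rule emeasure_distr[OF F pball_sets])
    also have "\<dots> = (\<integral>\<^sup>+r. emeasure ?\<Omega> (Pair r -` ?X) \<partial>count_space R)"
      by (rule \<Omega>.emeasure_pair_measure_alt[OF X])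
    \<comment> \<open>A small ball lies in a single coset of Z_p^s, so only the representative
      \<open>r0\<close> of that coset contributes.\<close>
    also have "\<dots> = (\<integral>\<^sup>+r. ennreal ((1 / ?p) ^ (s * k)) * indicator {r0} r \<partial>count_space R)"
    proof (intro nn_integral_cong)
      fix r assume "r \<in> space (count_space R)"
      then have r: "r \<in> R" "r \<in> padic_space s" using R by auto
      have "Pair r -` ?X = {\<omega> \<in> space ?\<Omega>. digit_point s \<omega> \<in> pball s (\<lambda>i. a i - r i) (radius TYPE('p) k)}"
        using r digit_point_in_space[of s, where 'p='p]
        by (auto simp: F_def space_pair_measure pball_def padic_space_def algebra_simps)
      then have "emeasure ?\<Omega> (Pair r -` ?X)
          = (if \<forall>i<s. padic_norm (a i - r i) \<le> 1 then ennreal ((1 / ?p) ^ (s * k)) else 0)"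
        using digit_point_ball(2)[of s "\<lambda>i. a i - r i" k] by simp
      moreover have "(\<forall>i<s. padic_norm (a i - r i) \<le> 1) \<longleftrightarrow> a \<in> pball s r (radius TYPE('p) 0)"
        using a padic_norm_less_radius[of _ 0, where 'p='p]
        by (auto simp: pball_def padic_norm_minus_commute)
      moreover have "a \<in> pball s r (radius TYPE('p) 0) \<longleftrightarrow> r = r0" using r0 r(1) by blast
      ultimately show "emeasure ?\<Omega> (Pair r -` ?X) = ennreal ((1 / ?p) ^ (s * k)) * indicator {r0} r"
        by (auto simp: indicator_def)
    qed
    also have "\<dots> = ennreal ((1 / ?p) ^ (s * k)) * emeasure (count_space R) {r0}"
      using r0(1) by (intro nn_integral_cmult_indicator) auto
    also have "\<dots> = ennreal ((1 / ?p) ^ (s * k))" using r0(1) by simp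
    finally show ?thesis .
  qed
  have spe: "space \<eta> = padic_space s" by (simp add: \<eta>_def sp)
  have "haar_measure s \<eta>"
    unfolding haar_measure_def
  proof (intro conjI allI ballI impI)
    show "sets \<eta> = sets ?B" by (rule setsB)
    have "0 < emeasure \<eta> (pball s (\<lambda>_. 0) (radius TYPE('p) 0))"
      using ball[OF zero_in_padic_space, of 0] by simp
    also have "\<dots> \<le> emeasure \<eta> (padic_space s)"
      using sets.top[of \<eta>] unfolding spe by (intro emeasure_mono pball_subset) auto
    finally show "0 < emeasure \<eta> (padic_space s)" .
  next
    fix K :: "(nat \<Rightarrow> 'p padic) set" assume K: "compact K \<and> K \<subseteq> padic_space s"
    let ?c = "\<lambda>x :: nat \<Rightarrow> 'p padic. cylinder s x (radius TYPE('p) 0)"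
    have "\<exists>D\<subseteq>K. finite D \<and> K \<subseteq> (\<Union>x\<in>D. ?c x)"
    proof (rule compactE_image[of K K ?c])
      show "K \<subseteq> (\<Union>x\<in>K. ?c x)"
        using radius_pos[of 0, where 'p='p] by (auto simp: cylinder_def)
    qed (use K open_cylinder in auto)
    then obtain D where D: "D \<subseteq> K" "finite D" "K \<subseteq> (\<Union>x\<in>D. ?c x)" by blast
    have "K \<subseteq> (\<Union>x\<in>D. pball s x (radius TYPE('p) 0))" using D(3) K by (auto simp: pball_cylinder)
    then have "emeasure \<eta> K \<le> emeasure \<eta> (\<Union>x\<in>D. pball s x (radius TYPE('p) 0))"
      using D(2) pball_sets setsB by (intro emeasure_mono sets.finite_UN) auto
    also have "\<dots> \<le> (\<Sum>x\<in>D. emeasure \<eta> (pball s x (radius TYPE('p) 0)))"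
      using D(2) pball_sets setsB by (intro emeasure_subadditive_finite) auto
    also have "\<dots> = (\<Sum>x\<in>D. ennreal ((1 / ?p) ^ (s * 0)))"
      using D(1) K by (intro sum.cong refl ball) auto
    also have "\<dots> < \<infinity>" using D(2) by (simp add: ennreal_of_nat_eq_real_of_nat)
    finally show "emeasure \<eta> K < \<infinity>" .
  next
    fix v :: "nat \<Rightarrow> 'p padic" and A assume v: "v \<in> padic_space s" and A: "A \<in> sets \<eta>"
    let ?T = "\<lambda>(x :: nat \<Rightarrow> 'p padic) i. - v i + x i"
    have v': "(\<lambda>i. - v i) \<in> padic_space s" using v by (simp add: padic_space_def)
    have T: "?T \<in> measurable \<eta> ?B"
      using translate_measurable[OF v'] setsB by (simp cong: measurable_cong_sets)
    have img: "(\<lambda>x i. v i + x i) ` A = ?T -` A \<inter> space \<eta>" if "A \<subseteq> padic_space s" for A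
    proof (intro subset_antisym subsetI)
      fix y assume "y \<in> (\<lambda>x i. v i + x i) ` A"
      then show "y \<in> ?T -` A \<inter> space \<eta>" using that v by (auto simp: spe padic_space_def)
    next
      fix y assume y: "y \<in> ?T -` A \<inter> space \<eta>"
      show "y \<in> (\<lambda>x i. v i + x i) ` A"
        by (rule image_eqI[of _ _ "?T y"]) (use y in auto)
    qed
    have "distr \<eta> ?B ?T = \<eta>"
    proof (rule measure_eqI_generator_eq_countable[OF Int_stable_small_balls small_balls_subset])
      fix X :: "(nat \<Rightarrow> 'p padic) set" assume X: "X \<in> small_balls s"
      then have Xs: "X \<in> sets ?B" using pball_sets by (auto simp: small_balls_def)
      have "emeasure (distr \<eta> ?B ?T) X = emeasure \<eta> (?T -` X \<inter> space \<eta>)" by (rule emeasure_distr[OF T Xs])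
      also have "\<dots> = emeasure \<eta> ((\<lambda>x i. v i + x i) ` X)"
        using X small_balls_subset by (subst img) auto
      also have "\<dots> = emeasure \<eta> X"
      proof -
        consider "X = {}" | x k where "X = pball s x (radius TYPE('p) k)" "x \<in> padic_space s"
          using X by (auto simp: small_balls_def)
        then show ?thesis
        proof cases
          case 2
          have "(\<lambda>i. v i + x i) \<in> padic_space s" using v 2(2) by (simp add: padic_space_def)
          then show ?thesis unfolding 2(1) translate_pball[OF v] by (simp only: ball ball[OF 2(2)])
        qed simp
      qed
      finally show "emeasure (distr \<eta> ?B ?T) X = emeasure \<eta> X" .
    next
      show "sets (distr \<eta> ?B ?T) = sigma_sets (padic_space s) (small_balls s)"
        using sets_padic_space[of s, where 'p='p] by simp
      show "sets \<eta> = sigma_sets (padic_space s) (small_balls s)"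
        using sets_padic_space[of s, where 'p='p] setsB by simp
      let ?A = "(\<lambda>q. pball s q (radius TYPE('p) 0)) ` (rat_points s :: (nat \<Rightarrow> 'p padic) set)"
      show "?A \<subseteq> small_balls s" using small_balls_I rat_points_subset by blast
      show "countable ?A" by (intro countable_image countable_rat_points)
      show "\<Union>?A = padic_space s"
      proof (intro subset_antisym subsetI)
        fix x :: "nat \<Rightarrow> 'p padic" assume x: "x \<in> padic_space s"
        obtain q where q: "q \<in> rat_points s" "q \<in> pball s x (radius TYPE('p) 0)"
          using rat_points_dense[OF radius_pos] by blast
        then have "pball s q (radius TYPE('p) 0) = pball s x (radius TYPE('p) 0)" using pball_eq by blast
        then show "x \<in> \<Union>?A" using q(1) centre_in_pball[OF x radius_pos] by blast
      qed (use pball_subset in blast)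
      fix X assume "X \<in> ?A"
      then obtain q where q: "q \<in> rat_points s" "X = pball s q (radius TYPE('p) 0)" by blast
      then have q': "q \<in> padic_space s" using rat_points_subset by blast
      have "emeasure (distr \<eta> ?B ?T) X = emeasure \<eta> (?T -` X \<inter> space \<eta>)"
        unfolding q(2) by (rule emeasure_distr[OF T pball_sets])
      also have "\<dots> = emeasure \<eta> ((\<lambda>x i. v i + x i) ` X)" unfolding q(2) by (subst img[OF pball_subset]) simp
      also have "\<dots> = ennreal ((1 / ?p) ^ (s * 0))"
        unfolding q(2) translate_pball[OF v] using v q' by (intro ball) (auto simp: padic_space_def)
      finally show "emeasure (distr \<eta> ?B ?T) X \<noteq> \<infinity>" by simp
    qed
    then have "emeasure \<eta> A = emeasure (distr \<eta> ?B ?T) A" by simp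
    also have "\<dots> = emeasure \<eta> (?T -` A \<inter> space \<eta>)" using A setsB by (intro emeasure_distr T) simp
    also have "\<dots> = emeasure \<eta> ((\<lambda>x i. v i + x i) ` A)"
      using sets.sets_into_space[OF A] spe by (subst img) auto
    finally show "emeasure \<eta> ((\<lambda>x i. v i + x i) ` A) = emeasure \<eta> A" by simp
  qed
  then show ?thesis by blast
qed

section \<open>Exponents of pushforward measures\<close>

text \<open>The index \<open>None\<close> turns the constant term into an ordinary coordinate, so
  that the form is additive on a single lattice.\<close>

definition lin_form :: "'p::prime_card padic ^ 'n \<Rightarrow> int ^ ('n option) \<Rightarrow> 'p padic" where
  "lin_form y q = of_int (q $ None) + (\<Sum>i\<in>UNIV. of_int (q $ Some i) * y $ i)"

lemma additive_lin_form: "Modules.additive (lin_form y)"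
  by unfold_locales (simp add: lin_form_def sum.distrib algebra_simps)

lemma sup_norm_int_norm:
  fixes Q :: "int ^ ('n::finite option)"
  shows "sup_norm (Q $ None, \<chi> i. Q $ Some i) = int_norm Q"
proof -
  have "range (\<lambda>j. \<bar>real_of_int (Q $ j)\<bar>)
      = insert \<bar>real_of_int (Q $ None)\<bar> (range (\<lambda>i. \<bar>real_of_int (Q $ Some i)\<bar>))"
    unfolding UNIV_option_conv by (simp add: image_image)
  then show ?thesis by (simp add: int_norm_def)
qed

lemma dioph_exponent_int_approx:
  fixes y :: "'p::prime_card padic ^ 'n"
  shows "dioph_exponent y = Sup (ereal ` {v. v > 0 \<and> infinite (int_approx (lin_form y) v)})"
proof -
  let ?d = "\<lambda>Q :: int ^ ('n option). (Q $ None, \<chi> i. Q $ Some i)"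
  have inj: "inj ?d"
  proof (rule injI)
    fix Q Q' assume eq: "?d Q = ?d Q'"
    have "Q $ j = Q' $ j" for j using eq by (cases j) (auto simp: vec_eq_iff)
    then show "Q = Q'" by (simp add: vec_eq_iff)
  qed
  have "{(q0, q). padic_norm (of_int q0 + (\<Sum>i\<in>UNIV. of_int (q $ i) * y $ i)) \<le> sup_norm (q0, q) powr (- v)}
      = ?d ` int_approx (lin_form y) v" for v
  proof (intro subset_antisym subsetI)
    fix z assume z: "z \<in> {(q0, q). padic_norm (of_int q0 + (\<Sum>i\<in>UNIV. of_int (q $ i) * y $ i)) \<le> sup_norm (q0, q) powr (- v)}"
    obtain q0 q where zq: "z = (q0, q)" by (cases z)
    define Q where "Q = (\<chi> j. case j of None \<Rightarrow> q0 | Some i \<Rightarrow> q $ i)"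
    have dQ: "?d Q = (q0, q)" by (simp add: Q_def vec_eq_iff)
    have "Q \<in> int_approx (lin_form y) v"
      using z sup_norm_int_norm[of Q] unfolding dQ zq by (simp add: int_approx_def lin_form_def Q_def)
    then show "z \<in> ?d ` int_approx (lin_form y) v" unfolding zq dQ[symmetric] by (rule imageI)
  next
    fix z assume "z \<in> ?d ` int_approx (lin_form y) v"
    then show "z \<in> {(q0, q). padic_norm (of_int q0 + (\<Sum>i\<in>UNIV. of_int (q $ i) * y $ i)) \<le> sup_norm (q0, q) powr (- v)}"
      by (auto simp: int_approx_def lin_form_def sup_norm_int_norm simp del: sup_norm.simps)
  qed
  then show ?thesis
    unfolding dioph_exponent_def by (simp add: finite_image_iff inj_on_subset[OF inj])
qed

lemma int_approx_mono:
  assumes "0 < v" "v \<le> w"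
  shows "int_approx l w \<subseteq> int_approx l v"
proof
  fix q assume q: "q \<in> int_approx l w"
  show "q \<in> int_approx l v"
  proof (cases "q = 0")
    case True
    then show ?thesis using q by (simp add: int_approx_def)
  next
    case False
    then have "int_norm q powr (- w) \<le> int_norm q powr (- v)"
      using int_norm_ge_1[of q] assms by (intro powr_mono) auto
    then show ?thesis using q by (simp add: int_approx_def)
  qed
qed

text \<open>The vectors \<open>(p^k, 0, ..., 0)\<close> have norm \<open>p^k\<close> and their
  values have norm \<open>p^-k\<close>. This keeps every threshold above an exponent
  positive.\<close>

lemma dioph_exponent_ge_1:
  fixes y :: "'p::prime_card padic ^ 'n"
  shows "dioph_exponent y \<ge> 1"
proof -
  let ?p = "CARD('p)"
  have p: "real ?p > 1" by (rule CARD_prime_real_gt_1)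
  let ?q = "\<lambda>k::nat. (\<chi> j. if j = None then int ?p ^ k else 0) :: int ^ ('n option)"
  have "?q k \<in> int_approx (lin_form y) 1" for k
  proof -
    have "lin_form y (?q k) = of_nat ?p ^ k" by (simp add: lin_form_def)
    then have 1: "padic_norm (lin_form y (?q k)) = 1 / real ?p ^ k"
      by (simp add: padic_norm_power padic_norm_CARD power_divide)
    have "int_norm (?q k) = real ?p ^ k"
    proof (rule antisym)
      show "int_norm (?q k) \<le> real ?p ^ k" unfolding int_norm_le_iff by simp
      show "real ?p ^ k \<le> int_norm (?q k)" using int_norm_component[of "?q k" None] by simp
    qed
    then show ?thesis using 1 p by (simp add: int_approx_def powr_minus_divide)
  qed
  then have "range ?q \<subseteq> int_approx (lin_form y) 1" by blast
  moreover have "infinite (range ?q)"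
  proof -
    have "inj ?q"
    proof (rule injI)
      fix k j assume "?q k = ?q j"
      then have "int ?p ^ k = int ?p ^ j" by (auto simp: vec_eq_iff dest: spec[of _ None])
      then show "k = j" using CARD_prime_gt_1[where 'p='p] by simp
    qed
    then show ?thesis using finite_imageD infinite_UNIV_nat by blast
  qed
  ultimately have "infinite (int_approx (lin_form y) 1)" using finite_subset by blast
  then have "ereal 1 \<le> dioph_exponent y"
    unfolding dioph_exponent_int_approx by (intro Sup_upper imageI) simp
  then show ?thesis by (simp add: one_ereal_def)
qed

lemma dioph_exponent_less_imp_finite:
  assumes "dioph_exponent y < ereal v" "v > 0"
  shows "finite (int_approx (lin_form y) v)"
proof (rule ccontr)
  assume "infinite (int_approx (lin_form y) v)"
  then have "ereal v \<le> dioph_exponent y"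
    unfolding dioph_exponent_int_approx using assms(2) by (intro Sup_upper imageI) simp
  then show False using assms(1) by simp
qed

text \<open>Approximability is monotone in the exponent, so rational thresholds suffice; they turn
  the condition into a countable union.\<close>

lemma dioph_exponent_greater_iff:
  "dioph_exponent y > ereal u \<longleftrightarrow> (\<exists>v::rat. real_of_rat v > max u 0 \<and> infinite (int_approx (lin_form y) (real_of_rat v)))"
proof
  assume "dioph_exponent y > ereal u"
  then have "max (ereal u) 0 < dioph_exponent y"
    using dioph_exponent_ge_1[of y] by (auto simp: max_def intro: less_le_trans[of 0 1])
  then obtain v where v: "ereal (max u 0) < ereal v" "v > 0" "infinite (int_approx (lin_form y) v)"
    unfolding dioph_exponent_int_approx less_Sup_iff by (auto simp: zero_ereal_def max_def split: if_splits)
  obtain r :: rat where r: "max u 0 < real_of_rat r" "real_of_rat r < v"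
    using v(1) of_rat_dense[of "max u 0" v] by auto
  then have "int_approx (lin_form y) v \<subseteq> int_approx (lin_form y) (real_of_rat r)"
    by (intro int_approx_mono) auto
  then have "infinite (int_approx (lin_form y) (real_of_rat r))" using v(3) finite_subset by blast
  then show "\<exists>v::rat. real_of_rat v > max u 0 \<and> infinite (int_approx (lin_form y) (real_of_rat v))" using r by blast
next
  assume "\<exists>v::rat. real_of_rat v > max u 0 \<and> infinite (int_approx (lin_form y) (real_of_rat v))"
  then obtain v :: rat where v: "real_of_rat v > max u 0" "infinite (int_approx (lin_form y) (real_of_rat v))" by blast
  then have "ereal (real_of_rat v) \<le> dioph_exponent y"
    unfolding dioph_exponent_int_approx by (intro Sup_upper imageI) simp
  then show "dioph_exponent y > ereal u" using v(1) by (auto intro: less_le_trans[of _ "ereal (real_of_rat v)"])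
qed

section \<open>Measurability of the exponent\<close>

lemma continuous_on_lin_form [continuous_intros]:
  "continuous_on S f \<Longrightarrow> continuous_on S (\<lambda>x. lin_form (f x) q)"
  unfolding lin_form_def
  by (intro continuous_on_add continuous_on_sum continuous_on_mult' continuous_on_const
      continuous_on_component)

text \<open>Boxes are finite, and unboundedness, unlike infinitude, is expressed by countable unions
  and intersections.\<close>

lemma infinite_int_norm_iff:
  fixes S :: "(int ^ 'm::finite) set"
  shows "infinite S \<longleftrightarrow> (\<forall>n::nat. \<exists>q. q \<in> S \<and> int_norm q > real n)"
proof
  assume inf: "infinite S"
  show "\<forall>n::nat. \<exists>q. q \<in> S \<and> int_norm q > real n"
  proof
    fix n :: nat
    have "\<not> S \<subseteq> ibox (real n)" using inf finite_ibox finite_subset by blast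
    then show "\<exists>q. q \<in> S \<and> int_norm q > real n" by (auto simp: ibox_def not_le)
  qed
next
  assume R: "\<forall>n::nat. \<exists>q. q \<in> S \<and> int_norm q > real n"
  show "infinite S"
  proof
    assume fin: "finite S"
    obtain n where n: "Max (insert 0 (int_norm ` S)) < real n" using reals_Archimedean2 by blast
    obtain q where q: "q \<in> S" "int_norm q > real n" using R by blast
    have "int_norm q \<le> Max (insert 0 (int_norm ` S))" using fin q by (intro Max_ge) auto
    then show False using q n by linarith
  qed
qed

lemma dioph_exponent_measurable: "{y :: 'p::prime_card padic ^ 'n. dioph_exponent y > ereal u} \<in> sets borel"
proof -
  have cl: "{y :: 'p padic ^ 'n. q \<in> int_approx (lin_form y) v} \<in> sets borel" for q v
    unfolding int_approx_def
    by (intro borel_closed) (simp, intro closed_Collect_le continuous_intros)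
  have "{y :: 'p padic ^ 'n. dioph_exponent y > ereal u} = (\<Union>v\<in>{v::rat. real_of_rat v > max u 0}.
      \<Inter>n::nat. \<Union>q\<in>{q. int_norm q > real n}. {y. q \<in> int_approx (lin_form y) (real_of_rat v)})"
    unfolding dioph_exponent_greater_iff infinite_int_norm_iff by blast
  also have "\<dots> \<in> sets borel"
  proof (intro sets.countable_UN'')
    fix v :: rat
    have "(\<Union>q\<in>{q. int_norm q > real n}. {y :: 'p padic ^ 'n. q \<in> int_approx (lin_form y) (real_of_rat v)}) \<in> sets borel" for n
      by (intro sets.countable_UN'' cl) auto
    then show "(\<Inter>n::nat. \<Union>q\<in>{q. int_norm q > real n}. {y :: 'p padic ^ 'n. q \<in> int_approx (lin_form y) (real_of_rat v)}) \<in> sets borel"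
      by (intro sets.countable_INT) auto
  qed auto
  finally show ?thesis .
qed

text \<open>The points at which integer forms are controlled by their values on \<open>B\<close>,
  with a constant independent of the form. As this set is affine and contains \<open>B\<close>, it
  contains the affine span, without the choice of a finite affine basis.\<close>

definition dominated :: "('p::prime_card padic ^ 'n) set \<Rightarrow> ('p padic ^ 'n) set" where
  "dominated B = {y. \<exists>K>0. \<forall>q. \<exists>z\<in>B. padic_norm (lin_form y q) \<le> K * padic_norm (lin_form z q)}"

lemma dominated_superset: "B \<subseteq> dominated B"
  unfolding dominated_def by (auto intro!: exI[of _ 1])

text \<open>By the ultrametric inequality one of the three terms bounds the sum, so a single witness
  \<open>z\<close> suffices. Three terms cover both operations of a subspace:
  \<open>a + x + y\<close> is \<open>(a + x) + (a + y) - a\<close>, and \<open>a + c x\<close> is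
  \<open>c (a + x) + (1 - c) a\<close>.\<close>

lemma dominated_combination:
  fixes y1 y2 y3 :: "'p::prime_card padic ^ 'n"
  assumes y: "y1 \<in> dominated B" "y2 \<in> dominated B" "y3 \<in> dominated B" and c: "c1 + c2 + c3 = 1"
  shows "c1 *s y1 + c2 *s y2 + c3 *s y3 \<in> dominated B"
proof -
  obtain K1 where K1: "K1 > 0" "\<And>q. \<exists>z\<in>B. padic_norm (lin_form y1 q) \<le> K1 * padic_norm (lin_form z q)"
    using y(1) by (auto simp: dominated_def)
  obtain K2 where K2: "K2 > 0" "\<And>q. \<exists>z\<in>B. padic_norm (lin_form y2 q) \<le> K2 * padic_norm (lin_form z q)"
    using y(2) by (auto simp: dominated_def)
  obtain K3 where K3: "K3 > 0" "\<And>q. \<exists>z\<in>B. padic_norm (lin_form y3 q) \<le> K3 * padic_norm (lin_form z q)"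
    using y(3) by (auto simp: dominated_def)
  define K where "K = padic_norm c1 * K1 + padic_norm c2 * K2 + padic_norm c3 * K3 + 1"
  have Ks: "padic_norm c1 * K1 \<le> K" "padic_norm c2 * K2 \<le> K" "padic_norm c3 * K3 \<le> K" "K > 0"
    using K1(1) K2(1) K3(1) padic_norm_nonneg[of c1] padic_norm_nonneg[of c2] padic_norm_nonneg[of c3]
    by (auto simp: K_def intro!: add_nonneg_nonneg add_nonneg_pos mult_nonneg_nonneg)
  have "\<exists>z\<in>B. padic_norm (lin_form (c1 *s y1 + c2 *s y2 + c3 *s y3) q) \<le> K * padic_norm (lin_form z q)" for q
  proof -
    have "of_int (q $ None) = (c1 + c2 + c3) * (of_int (q $ None) :: 'p padic)" using c by simp
    then have eq: "lin_form (c1 *s y1 + c2 *s y2 + c3 *s y3) q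
        = c1 * lin_form y1 q + c2 * lin_form y2 q + c3 * lin_form y3 q"
      by (simp add: lin_form_def distrib_left distrib_right sum.distrib sum_distrib_left mult_ac add_ac)
    have bd: "\<exists>z\<in>B. x \<le> K * padic_norm (lin_form z q)"
      if t: "x \<le> padic_norm (c * lin_form y' q)" "\<exists>z\<in>B. padic_norm (lin_form y' q) \<le> K' * padic_norm (lin_form z q)"
        "padic_norm c * K' \<le> K" for x c K' and y' :: "'p padic ^ 'n"
    proof -
      obtain z where z: "z \<in> B" "padic_norm (lin_form y' q) \<le> K' * padic_norm (lin_form z q)" using t(2) by blast
      have "x \<le> padic_norm c * padic_norm (lin_form y' q)" using t(1) by (simp add: padic_norm_mult)
      also have "\<dots> \<le> padic_norm c * (K' * padic_norm (lin_form z q))" using z(2) by (intro mult_left_mono) auto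
      also have "\<dots> = (padic_norm c * K') * padic_norm (lin_form z q)" by simp
      also have "\<dots> \<le> K * padic_norm (lin_form z q)" using t(3) by (intro mult_right_mono) auto
      finally show ?thesis using z(1) by blast
    qed
    let ?x = "padic_norm (lin_form (c1 *s y1 + c2 *s y2 + c3 *s y3) q)"
    have "?x \<le> max (max (padic_norm (c1 * lin_form y1 q)) (padic_norm (c2 * lin_form y2 q))) (padic_norm (c3 * lin_form y3 q))"
      unfolding eq using padic_norm_ultra[of "c1 * lin_form y1 q + c2 * lin_form y2 q" "c3 * lin_form y3 q"]
        padic_norm_ultra[of "c1 * lin_form y1 q" "c2 * lin_form y2 q"] by linarith
    then consider "?x \<le> padic_norm (c1 * lin_form y1 q)" | "?x \<le> padic_norm (c2 * lin_form y2 q)"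
      | "?x \<le> padic_norm (c3 * lin_form y3 q)" by linarith
    then show ?thesis
      using bd[OF _ K1(2) Ks(1)] bd[OF _ K2(2) Ks(2)] bd[OF _ K3(2) Ks(3)] by cases
  qed
  then show ?thesis using Ks(4) by (auto simp: dominated_def)
qed

lemma affine_subspace_dominated:
  fixes B :: "('p::prime_card padic ^ 'n) set"
  assumes "B \<noteq> {}"
  shows "affine_subspace (dominated B)"
proof -
  obtain a where a: "a \<in> dominated B" using assms dominated_superset by blast
  let ?S = "{x. a + x \<in> dominated B}"
  have "vec.subspace ?S"
  proof (rule vec.subspaceI)
    show "0 \<in> ?S" using a by simp
    fix x y assume xy: "x \<in> ?S" "y \<in> ?S"
    have "1 *s (a + x) + 1 *s (a + y) + (- 1) *s a \<in> dominated B"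
      using xy a by (intro dominated_combination) auto
    then show "x + y \<in> ?S" by (simp add: algebra_simps)
  next
    fix c x assume x: "x \<in> ?S"
    have "c *s (a + x) + (1 - c) *s a + 0 *s a \<in> dominated B"
      using x a by (intro dominated_combination) auto
    then show "c *s x \<in> ?S"
      by (simp add: vec_eq_iff algebra_simps vec.scale_right_distrib vec.scale_left_diff_distrib)
  qed
  moreover have "dominated B = (\<lambda>x. a + x) ` ?S"
  proof (intro subset_antisym subsetI)
    fix y assume "y \<in> dominated B"
    then show "y \<in> (\<lambda>x. a + x) ` ?S" by (intro image_eqI[of _ _ "y - a"]) auto
  qed auto
  ultimately show ?thesis unfolding affine_subspace_def by blast
qed

lemma affine_span_subset_dominated:
  assumes "B \<noteq> {}"
  shows "affine_span B \<subseteq> dominated B"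
  using affine_subspace_dominated[OF assms] dominated_superset[of B] by (auto simp: affine_span_def)

context besicovitch_measure
begin

text \<open>The bound is proved for each rational \<open>w\<close> above the exponent of
  \<open>y0\<close>. Countably many exceptional null sets are discarded before \<open>w\<close>
  decreases to that exponent.\<close>

lemma exponent_le_AE:
  fixes f :: "'x \<Rightarrow> 'p::prime_card padic ^ 'n"
  assumes meas: "\<And>q c. {x \<in> M. padic_norm (lin_form (f x) q) < c} \<in> sets \<mu>"
    and usc: "\<And>y q c. y \<in> M \<Longrightarrow> padic_norm (lin_form (f y) q) < c \<Longrightarrow>
      \<exists>r>0. \<forall>z\<in>mball y r. padic_norm (lin_form (f z) q) < c"
    and loc: "AE x in \<mu>. locally_good (\<lambda>x. lin_form (f x)) x"
    and dom: "\<And>x r. x \<in> supp \<Longrightarrow> r > 0 \<Longrightarrow> y0 \<in> dominated (f ` (mball x r \<inter> supp))"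
  shows "AE x in \<mu>. dioph_exponent (f x) \<le> dioph_exponent y0"
proof -
  have "AE x in \<mu>. dioph_exponent y0 < ereal (real_of_rat w) \<longrightarrow> dioph_exponent (f x) \<le> ereal (real_of_rat w)" for w :: rat
  proof (cases "dioph_exponent y0 < ereal (real_of_rat w)")
    case True
    then obtain v where v: "dioph_exponent y0 < ereal v" "ereal v < ereal (real_of_rat w)" using ereal_dense2 by blast
    have "1 < ereal v" using dioph_exponent_ge_1 v(1) by (rule le_less_trans)
    then have v0: "v > 0" by (simp add: one_ereal_def)
    have "AE x in \<mu>. finite (int_approx (lin_form (f x)) (real_of_rat w))"
    proof (rule AE_finite_int_approx[OF additive_lin_form additive_lin_form[of y0] meas usc loc])
      fix x r assume "x \<in> supp" "(0::real) < r"
      then show "\<exists>K>0. \<forall>q. \<exists>z\<in>mball x r \<inter> supp. padic_norm (lin_form y0 q) \<le> K * padic_norm (lin_form (f z) q)"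
        using dom[of x r] by (simp add: dominated_def)
    qed (use v v0 dioph_exponent_less_imp_finite in auto)
    then show ?thesis
    proof eventually_elim
      case (elim x)
      show ?case
      proof (rule ccontr)
        assume "\<not> ?thesis"
        then have "ereal (real_of_rat w) < dioph_exponent (f x)" by auto
        then obtain u :: rat where u: "real_of_rat u > max (real_of_rat w) 0" "infinite (int_approx (lin_form (f x)) (real_of_rat u))"
          unfolding dioph_exponent_greater_iff by blast
        have "int_approx (lin_form (f x)) (real_of_rat u) \<subseteq> int_approx (lin_form (f x)) (real_of_rat w)"
        proof (rule int_approx_mono)
          have "v < real_of_rat w" using v(2) by simp
          then show "0 < (real_of_rat w :: real)" using v0 by (rule less_trans[rotated])
          show "(real_of_rat w :: real) \<le> real_of_rat u" using u(1) by simp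
        qed
        then show False using elim u(2) finite_subset by blast
      qed
    qed
  qed auto
  then have "AE x in \<mu>. \<forall>w::rat. dioph_exponent y0 < ereal (real_of_rat w) \<longrightarrow> dioph_exponent (f x) \<le> ereal (real_of_rat w)"
    unfolding AE_all_countable by blast
  then show ?thesis
  proof eventually_elim
    case (elim x)
    show ?case
    proof (rule ccontr)
      assume "\<not> ?thesis"
      then have "dioph_exponent y0 < dioph_exponent (f x)" by simp
      from ereal_dense3[OF this] obtain r :: rat where "dioph_exponent y0 < ereal (real_of_rat r)" "ereal (real_of_rat r) < dioph_exponent (f x)"
        by blast
      then show False using elim by (meson not_le)
    qed
  qed
qed

text \<open>A circle of inequalities: the infimum over \<open>L\<close> is at most that over the
  values of \<open>f\<close> on the support, which is at most the exponent of the image measure,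
  since almost every point lies in the support; the latter is at most the exponent of any point of
  \<open>L\<close> by \<open>exponent_le_AE\<close>.\<close>

lemma measure_exponent_eq:
  fixes f :: "'x \<Rightarrow> 'p::prime_card padic ^ 'n"
  assumes f: "f \<in> borel_measurable \<mu>" and nz: "emeasure \<mu> M \<noteq> 0" and L: "f ` M \<subseteq> L"
    and meas: "\<And>q c. {x \<in> M. padic_norm (lin_form (f x) q) < c} \<in> sets \<mu>"
    and usc: "\<And>y q c. y \<in> M \<Longrightarrow> padic_norm (lin_form (f y) q) < c \<Longrightarrow>
      \<exists>r>0. \<forall>z\<in>mball y r. padic_norm (lin_form (f z) q) < c"
    and loc: "AE x in \<mu>. locally_good (\<lambda>x. lin_form (f x)) x"
    and dom: "\<And>x r. x \<in> supp \<Longrightarrow> r > 0 \<Longrightarrow> L \<subseteq> dominated (f ` (mball x r \<inter> supp))"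
  shows "measure_exponent (distr \<mu> borel f) = (INF y\<in>L. dioph_exponent y)"
    "(INF y\<in>L. dioph_exponent y) = (INF x\<in>supp. dioph_exponent (f x))"
proof -
  let ?S = "\<lambda>u. {y :: 'p padic ^ 'n. dioph_exponent y > ereal u}"
  have em: "emeasure (distr \<mu> borel f) (?S u) = emeasure \<mu> {x \<in> space \<mu>. dioph_exponent (f x) > ereal u}" for u
  proof -
    have "f -` ?S u \<inter> space \<mu> = {x \<in> space \<mu>. dioph_exponent (f x) > ereal u}" by blast
    then show ?thesis using emeasure_distr[OF f dioph_exponent_measurable[of u]] by simp
  qed
  have ms: "{x \<in> space \<mu>. dioph_exponent (f x) > ereal u} \<in> sets \<mu>" for u
  proof -
    have "f -` ?S u \<inter> space \<mu> \<in> sets \<mu>" using f dioph_exponent_measurable by (rule measurable_sets)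
    moreover have "f -` ?S u \<inter> space \<mu> = {x \<in> space \<mu>. dioph_exponent (f x) > ereal u}" by blast
    ultimately show ?thesis by simp
  qed
  have up: "measure_exponent (distr \<mu> borel f) \<le> dioph_exponent y0" if y0: "y0 \<in> L" for y0
    unfolding measure_exponent_def
  proof (intro Sup_least, elim imageE, clarify)
    fix u assume u: "0 < emeasure (distr \<mu> borel f) (?S u)"
    have dom': "y0 \<in> dominated (f ` (mball x r \<inter> supp))" if "x \<in> supp" "r > 0" for x r
      using dom[OF that] y0 by (rule subsetD)
    have AE: "AE x in \<mu>. dioph_exponent (f x) \<le> dioph_exponent y0"
      using meas usc loc dom' by (rule exponent_le_AE)
    show "ereal u \<le> dioph_exponent y0"
    proof (rule ccontr)
      assume "\<not> ?thesis"
      then have "AE x in \<mu>. \<not> dioph_exponent (f x) > ereal u"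
        using AE by (auto elim!: eventually_mono)
      then have "emeasure \<mu> {x \<in> space \<mu>. dioph_exponent (f x) > ereal u} = 0"
        using AE_iff_measurable[OF ms[of u], of "\<lambda>x. \<not> dioph_exponent (f x) > ereal u"] by simp
      then show False using u by (simp add: em)
    qed
  qed
  have low: "(INF x\<in>supp. dioph_exponent (f x)) \<le> measure_exponent (distr \<mu> borel f)"
  proof (rule ccontr)
    assume "\<not> ?thesis"
    then have "measure_exponent (distr \<mu> borel f) < (INF x\<in>supp. dioph_exponent (f x))" by simp
    from ereal_dense2[OF this] obtain u where u: "measure_exponent (distr \<mu> borel f) < ereal u" "ereal u < (INF x\<in>supp. dioph_exponent (f x))"
      by blast
    have "\<not> 0 < emeasure (distr \<mu> borel f) (?S u)"
    proof
      assume "0 < emeasure (distr \<mu> borel f) (?S u)"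
      then have "ereal u \<le> measure_exponent (distr \<mu> borel f)"
        unfolding measure_exponent_def by (intro Sup_upper imageI) simp
      then show False using u(1) by simp
    qed
    then have "emeasure \<mu> {x \<in> space \<mu>. dioph_exponent (f x) > ereal u} = 0" unfolding em by simp
    then have "AE x in \<mu>. \<not> dioph_exponent (f x) > ereal u"
      using AE_iff_measurable[OF ms[of u], of "\<lambda>x. \<not> dioph_exponent (f x) > ereal u"] by simp
    moreover have "AE x in \<mu>. dioph_exponent (f x) > ereal u"
      using AE_supp
    proof eventually_elim
      case (elim x)
      then have "(INF x\<in>supp. dioph_exponent (f x)) \<le> dioph_exponent (f x)" by (rule INF_lower)
      then show ?case using u(2) by simp
    qed
    ultimately have "AE x in \<mu>. False" by eventually_elim simp
    then have "emeasure \<mu> (space \<mu>) = 0" 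
      using AE_iff_measurable[of "space \<mu>" \<mu> "\<lambda>_. False"] by simp
    then show False using nz space_eq by simp
  qed
  have mid: "(INF y\<in>L. dioph_exponent y) \<le> (INF x\<in>supp. dioph_exponent (f x))"
    using L supp_subset by (intro INF_greatest INF_lower) auto
  have "measure_exponent (distr \<mu> borel f) \<le> (INF y\<in>L. dioph_exponent y)"
    using up by (intro INF_greatest)
  then show "measure_exponent (distr \<mu> borel f) = (INF y\<in>L. dioph_exponent y)"
    "(INF y\<in>L. dioph_exponent y) = (INF x\<in>supp. dioph_exponent (f x))"
    using low mid by auto
qed

end

section \<open>Affine subspaces and Federer measures\<close>

context besicovitch_measure
begin

lemma ball_good_cong:
  assumes "ball_good C \<alpha> U g" "\<And>x. x \<in> M \<Longrightarrow> g x = h x"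
  shows "ball_good C \<alpha> U h"
  unfolding ball_good_def
proof (intro ballI allI impI)
  fix x r z \<epsilon> assume x: "x \<in> supp" "0 < (r::real)" "mball x r \<subseteq> U" and z: "z \<in> mball x r \<inter> supp"
    and e: "0 < (\<epsilon>::real)" "0 < h z"
  have "{y \<in> mball x r. h y < \<epsilon>} = {y \<in> mball x r. g y < \<epsilon>}" using assms(2) by auto
  moreover have "h z = g z" using z assms(2) by auto
  ultimately show "emeasure \<mu> {y \<in> mball x r. h y < \<epsilon>}
      \<le> ennreal (C * (\<epsilon> / h z) powr \<alpha>) * emeasure \<mu> (mball x r)"
    using assms(1)[unfolded ball_good_def, rule_format, OF x z e(1)] e(2) by (simp only:)
qed

end

lemma affine_iso_exists:
  fixes L :: "('p::prime_card padic ^ 'n) set"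
  assumes "affine_subspace L"
  shows "\<exists>\<phi>. affine_iso (affine_dim L) \<phi> L"
proof -
  obtain a S where S: "vec.subspace S" and L: "L = (\<lambda>x. a + x) ` S"
    using assms unfolding affine_subspace_def by blast
  have diff: "{x - y | x y. x \<in> L \<and> y \<in> L} = S"
  proof (intro subset_antisym subsetI)
    fix z assume "z \<in> {x - y | x y. x \<in> L \<and> y \<in> L}"
    then show "z \<in> S" unfolding L using vec.subspace_diff[OF S] by auto
  next
    fix z assume "z \<in> S"
    then have "z = (a + z) - (a + 0)" "a + z \<in> L" "a + 0 \<in> L" using vec.subspace_0[OF S] by (auto simp: L)
    then show "z \<in> {x - y | x y. x \<in> L \<and> y \<in> L}" by blast
  qed
  obtain B where B: "B \<subseteq> S" "vec.independent B" "S \<subseteq> vec.span B" "card B = vec.dim S"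
    using vec.basis_exists by blast
  have finB: "finite B" using B(2) by (rule vec.finiteI_independent)
  have spB: "vec.span B = S" using B(1,3) S by (metis subset_antisym vec.span_minimal)
  let ?s = "affine_dim L"
  have cs: "card B = ?s" using B(4) by (simp add: affine_dim_def diff)
  obtain b where b: "bij_betw b {..<?s} B"
    using finB cs ex_bij_betw_nat_finite[OF finB] by (auto simp: lessThan_atLeast0)
  define \<phi> where "\<phi> = (\<lambda>x :: nat \<Rightarrow> 'p padic. a + (\<Sum>i<?s. x i *s b i))"
  define idx where "idx = inv_into {..<?s} b"
  have idx: "idx v < ?s" "b (idx v) = v" if "v \<in> B" for v
    using that b by (auto simp: idx_def bij_betw_def f_inv_into_f inv_into_into[of v b "{..<?s}", simplified])
  have idx_b: "idx (b i) = i" if "i < ?s" for i using that b by (simp add: idx_def bij_betw_def)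
  have sumB: "(\<Sum>i<?s. x i *s b i) = (\<Sum>v\<in>B. x (idx v) *s v)" for x :: "nat \<Rightarrow> 'p padic"
  proof -
    have "(\<Sum>i<?s. x i *s b i) = (\<Sum>i<?s. x (idx (b i)) *s b i)" by (intro sum.cong) (auto simp: idx_b)
    also have "\<dots> = (\<Sum>v\<in>B. x (idx v) *s v)" by (rule sum.reindex_bij_betw[OF b])
    finally show ?thesis .
  qed
  have "bij_betw \<phi> (padic_space ?s) L"
    unfolding bij_betw_def
  proof
    show "inj_on \<phi> (padic_space ?s)"
    proof (rule inj_onI)
      fix x y assume xy: "x \<in> padic_space ?s" "y \<in> padic_space ?s" "\<phi> x = \<phi> y"
      have "(\<Sum>v\<in>B. (x (idx v) - y (idx v)) *s v) = 0"
        using xy(3) by (simp add: \<phi>_def sumB vec.scale_left_diff_distrib sum_subtractf)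
      then have "x (idx v) - y (idx v) = 0" if "v \<in> B" for v
        using vec.independentD[OF B(2) finB subset_refl _ that, of "\<lambda>v. x (idx v) - y (idx v)"] by blast
      then have "x i = y i" if "i < ?s" for i
        using idx_b[OF that] b that by (metis bij_betwE eq_iff_diff_eq_0 lessThan_iff)
      moreover have "x i = y i" if "\<not> i < ?s" for i using xy that by (simp add: padic_space_def)
      ultimately show "x = y" by blast
    qed
    show "\<phi> ` padic_space ?s = L"
    proof (intro subset_antisym subsetI)
      fix y assume "y \<in> \<phi> ` padic_space ?s"
      then obtain x where y: "y = a + (\<Sum>v\<in>B. x (idx v) *s v)" by (auto simp: \<phi>_def sumB)
      have "(\<Sum>v\<in>B. x (idx v) *s v) \<in> S"
        unfolding spB[symmetric] by (intro vec.span_sum vec.span_scale vec.span_base)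
      then show "y \<in> L" unfolding L y by blast
    next
      fix y assume "y \<in> L"
      then obtain z where z: "z \<in> S" "y = a + z" unfolding L by blast
      obtain u where u: "z = (\<Sum>v\<in>B. u v *s v)"
        using z(1) unfolding spB[symmetric] vec.span_finite[OF finB] by blast
      define x where "x = (\<lambda>i. if i < ?s then u (b i) else 0)"
      have "(\<Sum>v\<in>B. x (idx v) *s v) = z"
        unfolding u by (intro sum.cong refl) (simp add: x_def idx)
      then have "\<phi> x = y" by (simp add: \<phi>_def sumB z)
      moreover have "x \<in> padic_space ?s" by (simp add: x_def padic_space_def)
      ultimately show "y \<in> \<phi> ` padic_space ?s" by blast
    qed
  qed
  then have "affine_iso ?s \<phi> L" unfolding affine_iso_def \<phi>_def by blast
  then show ?thesis by blast
qed

text \<open>The general result applied to the affine parametrisation of \<open>L\<close>: Haar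
  measure is doubling, affine functions are good, and the image of any ball spans \<open>L\<close>
  affinely.\<close>

lemma haar_measure_exponent:
  fixes L :: "('p::prime_card padic ^ 'n) set"
  assumes iso: "affine_iso s \<phi> L" and haar: "haar_measure s \<eta>"
  shows "measure_exponent (distr \<eta> borel \<phi>) = (INF y\<in>L. dioph_exponent y)"
proof -
  interpret besicovitch_measure "padic_space s" "pdist s" \<eta> 1
    using haar by (rule haar_besicovitch_measure)
  let ?B = "restrict_space borel (padic_space s) :: (nat \<Rightarrow> 'p padic) measure"
  obtain a b where \<phi>: "\<And>x. x \<in> padic_space s \<Longrightarrow> \<phi> x = a + (\<Sum>i<s. x i *s b i)"
    and bij: "bij_betw \<phi> (padic_space s) L" using iso unfolding affine_iso_def by blast
  \<comment> \<open>The formula is continuous on all sequences, whereas \<open>\<phi>\<close> is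
    only known to agree with it on \<open>padic_space s\<close>.\<close>
  define \<psi> where "\<psi> = (\<lambda>x :: nat \<Rightarrow> 'p padic. a + (\<Sum>i<s. x i *s b i))"
  have \<phi>\<psi>: "\<phi> x = \<psi> x" if "x \<in> padic_space s" for x using \<phi>[OF that] by (simp add: \<psi>_def)
  have comp: "\<psi> x $ j = a $ j + (\<Sum>i<s. x i * b i $ j)" for x j
    by (simp add: \<psi>_def)
  have "\<psi> = (\<lambda>x. \<chi> j. a $ j + (\<Sum>i<s. x i * b i $ j))" by (simp add: fun_eq_iff vec_eq_iff comp)
  then have cont: "continuous_on UNIV \<psi>"
    by (simp only:) (intro continuous_on_vec_lambda continuous_on_add continuous_on_sum continuous_on_mult'
      continuous_on_const continuous_on_product_coordinates)
  have f: "\<phi> \<in> borel_measurable \<eta>"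
  proof -
    have "\<psi> \<in> borel_measurable ?B"
      using borel_measurable_continuous_onI[OF cont] by (intro measurable_restrict_space1)
    then have "\<psi> \<in> borel_measurable \<eta>" using haar_sets[OF haar] by (simp cong: measurable_cong_sets)
    then show ?thesis by (subst measurable_cong[of \<eta> \<phi> \<psi>]) (use \<phi>\<psi> space_eq in auto)
  qed
  have op: "open {x. padic_norm (lin_form (\<psi> x) q) < c}" for q c
    by (intro open_Collect_less continuous_on_const continuous_on_padic_norm continuous_on_lin_form cont)
  have aff: "lin_form (\<psi> x) q = lin_form a q + (\<Sum>i<s. (\<Sum>j\<in>UNIV. of_int (q $ Some j) * b i $ j) * x i)" for x q
  proof -
    have "(\<Sum>j\<in>UNIV. of_int (q $ Some j) * (\<Sum>i<s. x i * b i $ j))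
        = (\<Sum>i<s. \<Sum>j\<in>UNIV. of_int (q $ Some j) * (x i * b i $ j))"
      unfolding sum_distrib_left by (rule sum.swap)
    also have "\<dots> = (\<Sum>i<s. (\<Sum>j\<in>UNIV. of_int (q $ Some j) * b i $ j) * x i)"
      unfolding sum_distrib_right by (simp add: mult_ac)
    finally show ?thesis by (simp add: lin_form_def comp distrib_left sum.distrib add.assoc)
  qed
  have meas: "{x \<in> padic_space s. padic_norm (lin_form (\<phi> x) q) < c} \<in> sets \<eta>" for q c
  proof -
    have "{x \<in> padic_space s. padic_norm (lin_form (\<phi> x) q) < c}
        = padic_space s \<inter> {x. padic_norm (lin_form (\<psi> x) q) < c}" using \<phi>\<psi> by auto
    then show ?thesis unfolding haar_sets[OF haar] sets_restrict_space using op by auto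
  qed
  have good: "ball_good 2 1 U (\<lambda>x. padic_norm (lin_form (\<phi> x) q))" for U q
  proof (rule ball_good_cong)
    show "ball_good 2 1 U (\<lambda>x. padic_norm (lin_form a q + (\<Sum>i<s. (\<Sum>j\<in>UNIV. of_int (q $ Some j) * b i $ j) * x i)))"
    proof (rule haar_affine_good[OF haar])
      fix e
      have "{x \<in> padic_space s. padic_norm (lin_form a q + (\<Sum>i<s. (\<Sum>j\<in>UNIV. of_int (q $ Some j) * b i $ j) * x i)) < e}
        = {x \<in> padic_space s. padic_norm (lin_form (\<phi> x) q) < e}"
        using \<phi>\<psi> aff by auto
      then show "{x \<in> padic_space s. padic_norm (lin_form a q + (\<Sum>i<s. (\<Sum>j\<in>UNIV. of_int (q $ Some j) * b i $ j) * x i)) < e} \<in> sets \<eta>"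
        using meas by simp
    qed
  qed (simp add: \<phi>\<psi> aff)
  have p1: "real (CARD('p) ^ 3) ^ s \<ge> 1"
  proof -
    have "1 \<le> CARD('p) ^ 3" using CARD_prime_gt_1[where 'p='p] by simp
    then have "1 \<le> (CARD('p) ^ 3) ^ s" by (rule one_le_power)
    then show ?thesis by (metis of_nat_1 of_nat_le_iff of_nat_power)
  qed
  show ?thesis
  proof (rule measure_exponent_eq(1)[OF f _ _ meas])
    show "emeasure \<eta> (padic_space s) \<noteq> 0" using haar by (auto simp: haar_measure_def)
    show "\<phi> ` padic_space s \<subseteq> L" using bij by (auto simp: bij_betw_def)
  next
    fix y q c assume y: "y \<in> padic_space s" "padic_norm (lin_form (\<phi> y) q) < c"
    then obtain k where k: "pball s y (radius TYPE('p) k) \<subseteq> {x. padic_norm (lin_form (\<psi> x) q) < c}"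
      using open_contains_small_ball[OF op, of y q c s] \<phi>\<psi> by auto
    have "\<forall>z\<in>pspace.mball s y (radius TYPE('p) k). padic_norm (lin_form (\<phi> z) q) < c"
      unfolding mball_eq_pball[OF y(1) radius_pos] using k pball_subset \<phi>\<psi> by fastforce
    then show "\<exists>r>0. \<forall>z\<in>pspace.mball s y r. padic_norm (lin_form (\<phi> z) q) < c" using radius_pos by blast
  next
    show "AE x in \<eta>. locally_good (\<lambda>x. lin_form (\<phi> x)) x"
      using AE_space
    proof eventually_elim
      case (elim x)
      then have x: "x \<in> padic_space s" using space_eq by simp
      show ?case
        unfolding locally_good_def
        using good haar_doubling[OF haar] haar_pball_finite[OF haar x, of 1] p1 mball_eq_pball[OF x, of 1]
        by (intro exI[of _ 1] exI[of _ 2] exI[of _ "real (CARD('p) ^ 3) ^ s"] conjI allI) auto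
    qed
  next
    fix x and r :: real assume x: "x \<in> supp" and r: "r > 0"
    have xM: "x \<in> padic_space s" using x supp_subset by blast
    let ?D = "dominated (\<phi> ` (pspace.mball s x r \<inter> supp))"
    show "L \<subseteq> ?D"
    proof
      fix y assume "y \<in> L"
      then obtain z where z: "z \<in> padic_space s" "y = \<phi> z" using bij by (auto simp: bij_betw_def)
      define m where "m = pdist s x z + 1"
      have m: "m > 0" "\<And>i. i < s \<Longrightarrow> padic_norm (x i - z i) < m"
      proof -
        show "m > 0" unfolding m_def using pdist_nonneg[of s x z] by linarith
        show "padic_norm (x i - z i) < m" if "i < s" for i
          unfolding m_def using pdist_component[OF that, of x z] by linarith
      qed
      have p: "real CARD('p) > 1" by (rule CARD_prime_real_gt_1)
      have "r / m > 0" using r m by simp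
      then obtain k where k: "real CARD('p) powi (k - 1) < r / m" using powi_scale[OF p] by metis
      \<comment> \<open>A homothety with centre \<open>x\<close> and small ratio \<open>c\<close>
        moves \<open>z\<close> to a point \<open>w\<close> of the ball; inverting it exhibits
        \<open>\<phi> z\<close> as an affine combination of \<open>\<phi> w\<close> and
        \<open>\<phi> x\<close>.\<close>
      define c :: "'p padic" where "c = padic_scale (k - 1)"
      have c: "padic_norm c < r / m" "c \<noteq> 0" using k by (auto simp: c_def padic_norm_scale)
      define w where "w = (\<lambda>i. x i + c * (z i - x i))"
      have wM: "w \<in> padic_space s" using xM z(1) by (simp add: w_def padic_space_def)
      have "padic_norm (x i - w i) < r" if "i < s" for i
      proof -
        have "padic_norm (x i - w i) = padic_norm c * padic_norm (x i - z i)"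
          using padic_norm_minus[of "x i - w i"] by (simp add: w_def padic_norm_mult padic_norm_minus_commute)
        also have "\<dots> \<le> padic_norm c * m" using m(2)[OF that] by (intro mult_left_mono) auto
        also have "\<dots> < r" using c(1) m(1) by (simp add: field_simps)
        finally show ?thesis .
      qed
      then have "w \<in> pball s x r" using wM by (simp add: pball_def)
      then have "\<phi> w \<in> ?D" "\<phi> x \<in> ?D"
        using dominated_superset[of "\<phi> ` (pspace.mball s x r \<inter> supp)"] haar_supp[OF haar]
          mball_eq_pball[OF xM r] wM xM centre_in_pball[OF xM r] by blast+
      then have "(1 / c) *s \<phi> w + (1 - 1 / c) *s \<phi> x + 0 *s \<phi> x \<in> ?D"
        by (intro dominated_combination) auto
      moreover have "(1 / c) *s \<phi> w + (1 - 1 / c) *s \<phi> x + 0 *s \<phi> x = y"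
      proof -
        have "\<psi> w = \<psi> x + c *s (\<psi> z - \<psi> x)"
          by (simp add: vec_eq_iff comp w_def sum_subtractf[symmetric] sum.distrib[symmetric] sum_distrib_left algebra_simps)
        then show ?thesis using c(2)
          by (simp add: z(2) \<phi>\<psi>[OF wM] \<phi>\<psi>[OF xM] \<phi>\<psi>[OF z(1)] vec_eq_iff field_simps)
      qed
      ultimately show "y \<in> ?D" by simp
    qed
  qed
qed

text \<open>Every admissible choice of isomorphism and Haar measure gives the same infimum, and a
  choice exists, so the definite description denotes it.\<close>

lemma affine_exponent_eq:
  fixes L :: "('p::prime_card padic ^ 'n) set"
  assumes "affine_subspace L"
  shows "affine_exponent L = (INF y\<in>L. dioph_exponent y)"
  unfolding affine_exponent_def
proof (rule the_equality)
  obtain \<phi> where \<phi>: "affine_iso (affine_dim L) \<phi> L" using affine_iso_exists[OF assms] by blast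
  obtain \<eta> :: "(nat \<Rightarrow> 'p padic) measure" where \<eta>: "haar_measure (affine_dim L) \<eta>" using haar_measure_exists by blast
  show "\<exists>\<phi> \<eta>. affine_iso (affine_dim L) \<phi> L \<and> haar_measure (affine_dim L) \<eta> \<and>
      (INF y\<in>L. dioph_exponent y) = measure_exponent (distr \<eta> borel \<phi>)"
    using \<phi> \<eta> haar_measure_exponent[OF \<phi> \<eta>] by metis
next
  fix w assume "\<exists>\<phi> \<eta>. affine_iso (affine_dim L) \<phi> L \<and> haar_measure (affine_dim L) \<eta> \<and>
      w = measure_exponent (distr \<eta> borel \<phi>)"
  then show "w = (INF y\<in>L. dioph_exponent y)" using haar_measure_exponent by metis
qed

lemma besicovitch_measure_of_space:
  fixes \<mu> :: "'x::metric_space measure"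
  assumes "besicovitch_space TYPE('x)" "sets \<mu> = sets borel"
  shows "\<exists>N. besicovitch_measure UNIV dist \<mu> N"
proof -
  obtain N where N: "\<And>(E :: 'x set) \<B>. bounded E \<and> \<B> \<subseteq> {ball x r | x r. r > 0} \<and> (\<forall>x\<in>E. \<exists>r>0. ball x r \<in> \<B>) \<Longrightarrow>
     \<exists>\<C>\<subseteq>\<B>. countable \<C> \<and> E \<subseteq> \<Union>\<C> \<and> (\<forall>x. finite {B \<in> \<C>. x \<in> B} \<and> card {B \<in> \<C>. x \<in> B} \<le> N)"
    using assms(1) unfolding besicovitch_space_def by blast
  have mb: "Met_TC.mball = (ball :: 'x \<Rightarrow> _)" by (rule mball_eq_ball)
  have "besicovitch_measure_axioms UNIV dist \<mu> (max N 1)"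
  proof
    show "space \<mu> = UNIV" using sets_eq_imp_space_eq[OF assms(2)] by simp
    show "Met_TC.mball x r \<in> sets \<mu>" for x r unfolding mb assms(2) by simp
    fix E :: "'x set" and \<B> assume E: "Met_TC.mbounded E" and B: "\<B> \<subseteq> {Met_TC.mball x r | x r. x \<in> UNIV \<and> r > 0}"
      "\<forall>x\<in>E. \<exists>r>0. Met_TC.mball x r \<in> \<B>"
    have "bounded E" using E by simp
    then obtain \<C> where C: "\<C> \<subseteq> \<B>" "countable \<C>" "E \<subseteq> \<Union>\<C>"
      "\<And>x. finite {B \<in> \<C>. x \<in> B}" "\<And>x. card {B \<in> \<C>. x \<in> B} \<le> N"
      using N[of E \<B>] B unfolding mb by auto
    have "card {B \<in> \<C>. x \<in> B} \<le> max N 1" for x using C(5)[of x] by simp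
    then show "\<exists>\<C>\<subseteq>\<B>. countable \<C> \<and> E \<subseteq> \<Union>\<C> \<and>
        (\<forall>x. finite {B \<in> \<C>. x \<in> B} \<and> card {B \<in> \<C>. x \<in> B} \<le> max N 1)" using C by blast
  qed simp
  then show ?thesis using Met_TC.Metric_space_axioms besicovitch_measure.intro by blast
qed

text \<open>For \<open>c\<close> below the value at \<open>z\<close>, the points of \<open>B\<close>
  with larger value than \<open>c\<close> form an open neighbourhood of a point of the support,
  hence a set of positive measure.\<close>

lemma sup_norm_on_ge:
  fixes f :: "'x::metric_space \<Rightarrow> 'p::prime_card padic"
  assumes B: "open B" and f: "continuous_on UNIV f" and z: "z \<in> B" "z \<in> msupport \<mu>"
  shows "ennreal (padic_norm (f z)) \<le> sup_norm_on \<mu> B f"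
proof (rule dense_le)
  fix c assume c: "c < ennreal (padic_norm (f z))"
  then obtain c' where c': "c = ennreal c'" "c' \<ge> 0" by (cases c) auto
  have eq: "{x \<in> B. ennreal (padic_norm (f x)) > c} = B \<inter> {x. c' < padic_norm (f x)}"
    using c' by (auto simp: ennreal_less_iff)
  have "open {x \<in> B. ennreal (padic_norm (f x)) > c}" unfolding eq
    by (intro open_Int B open_Collect_less continuous_on_const continuous_on_padic_norm f)
  moreover have "z \<in> {x \<in> B. ennreal (padic_norm (f x)) > c}" using z c by simp
  ultimately have "emeasure \<mu> {x \<in> B. ennreal (padic_norm (f x)) > c} > 0"
    using z(2) unfolding msupport_def by blast
  then show "c \<le> sup_norm_on \<mu> B f" unfolding sup_norm_on_def by (intro Sup_upper) simp
qed

theorem theorem2p2: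
  fixes \<mu> :: "'x::metric_space measure"
    and L :: "('p::prime_card padic ^ 'n) set"
    and f :: "'x \<Rightarrow> 'p padic ^ 'n"
  assumes "besicovitch_space TYPE('x)"
    and "radon_measure \<mu>" and "emeasure \<mu> UNIV \<noteq> 0"
    and "federer \<mu>"
    and "affine_subspace L"
    and "range f \<subseteq> L" and "continuous_on UNIV f"
    and "good_pair f \<mu>" and "nonplanar_in f \<mu> L"
  shows "measure_exponent (distr \<mu> borel f) = affine_exponent L \<and>
         affine_exponent L = (INF y\<in>L. dioph_exponent y) \<and>
         (INF y\<in>L. dioph_exponent y) = (INF x\<in>msupport \<mu>. dioph_exponent (f x))"
proof -
  have sets: "sets \<mu> = sets borel" using assms(2) by (simp add: radon_measure_def)
  obtain N where "besicovitch_measure UNIV dist \<mu> N" using besicovitch_measure_of_space[OF assms(1) sets] by blast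
  then interpret besicovitch_measure "UNIV :: 'x set" dist \<mu> N .
  have mb: "Met_TC.mball = (ball :: 'x \<Rightarrow> _)" by (rule mball_eq_ball)
  have opn: "U \<in> sets \<mu>" if "open U" for U using that sets by simp
  have supp: "supp = msupport \<mu>"
  proof (intro subset_antisym subsetI)
    fix x assume x: "x \<in> supp"
    have "emeasure \<mu> U > 0" if U: "open U" "x \<in> U" for U
    proof -
      obtain r where r: "r > 0" "ball x r \<subseteq> U" using U open_contains_ball by blast
      then have "emeasure \<mu> (ball x r) > 0" using x by (simp add: supp_def mb)
      also have "emeasure \<mu> (ball x r) \<le> emeasure \<mu> U" using r opn[OF U(1)] by (intro emeasure_mono)
      finally show ?thesis .
    qed
    then show "x \<in> msupport \<mu>" by (simp add: msupport_def)
  next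
    fix x assume "x \<in> msupport \<mu>"
    then show "x \<in> supp" by (auto simp: supp_def mb msupport_def)
  qed
  have lc: "continuous_on UNIV (\<lambda>x. lin_form (f x) q)" for q
    using assms(7) by (rule continuous_on_lin_form)
  have op: "open {x. padic_norm (lin_form (f x) q) < c}" for q c
    by (intro open_Collect_less continuous_on_const continuous_on_padic_norm lc)
  have f: "f \<in> borel_measurable \<mu>"
    using borel_measurable_continuous_onI[OF assms(7)] sets by (simp cong: measurable_cong_sets)
  have meas: "{x \<in> UNIV. padic_norm (lin_form (f x) q) < c} \<in> sets \<mu>" for q c
    using opn[OF op] by simp
  have usc: "\<exists>r>0. \<forall>z\<in>Met_TC.mball y r. padic_norm (lin_form (f z) q) < c"
    if "y \<in> UNIV" "padic_norm (lin_form (f y) q) < c" for y q c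
  proof -
    have "y \<in> {x. padic_norm (lin_form (f x) q) < c}" using that by simp
    then obtain r where "r > 0" "ball y r \<subseteq> {x. padic_norm (lin_form (f x) q) < c}"
      using op open_contains_ball by blast
    then show ?thesis unfolding mb by blast
  qed
  \<comment> \<open>A point is compact and so of finite measure; outer regularity at this point
    supplies the neighbourhood.\<close>
  have locally_finite: "\<exists>W. open W \<and> x \<in> W \<and> emeasure \<mu> W < \<infinity>" for x
  proof -
    have "\<forall>K. compact K \<longrightarrow> emeasure \<mu> K < \<infinity>" using assms(2) unfolding radon_measure_def by blast
    then have "emeasure \<mu> {x} < \<infinity>" using compact_sing by blast
    moreover have "emeasure \<mu> {x} = (INF U\<in>{U. open U \<and> {x} \<subseteq> U}. emeasure \<mu> U)"
      
    proof -
      have "\<forall>A\<in>sets borel. emeasure \<mu> A = (INF U\<in>{U. open U \<and> A \<subseteq> U}. emeasure \<mu> U)"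
        using assms(2) unfolding radon_measure_def by blast
      moreover have "{x} \<in> sets borel" by simp
      ultimately show ?thesis by blast
    qed
    ultimately have "(INF U\<in>{U. open U \<and> {x} \<subseteq> U}. emeasure \<mu> U) < \<infinity>" by (simp only:)
    then show ?thesis unfolding INF_less_iff by blast
  qed
  have dbl: "ball_doubling (max D 1) U" if D: "D > 0" "federer_on D \<mu> U" for D U
    unfolding ball_doubling_def mb
  proof (intro ballI allI impI)
    fix x r assume x: "x \<in> supp" and r: "0 < (r::real)" "ball x (3 * r) \<subseteq> U"
    have pos: "emeasure \<mu> (ball x r) > 0" using x r(1) by (simp add: supp_def mb)
    let ?q = "emeasure \<mu> (ball x (3 * r)) / emeasure \<mu> (ball x r)"
    have "?q \<le> (SUP (x, r)\<in>{(x, r). x \<in> msupport \<mu> \<and> r > 0 \<and> ball x (3 * r) \<subseteq> U}.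
        emeasure \<mu> (ball x (3 * r)) / emeasure \<mu> (ball x r))"
      using x r supp by (intro SUP_upper2[of "(x, r)"]) auto
    also have "\<dots> < ennreal D" using D(2) by (simp add: federer_on_def)
    finally have q: "?q \<le> ennreal (max D 1)" by (auto intro: order_trans[OF less_imp_le] ennreal_leI)
    show "emeasure \<mu> (ball x (3 * r)) \<le> ennreal (max D 1) * emeasure \<mu> (ball x r)"
    \<comment> \<open>A ball of infinite measure gives an infinite right-hand side; otherwise the
      measure is finite and positive, and the quotient may be multiplied out.\<close>
    proof (cases "emeasure \<mu> (ball x r) = \<infinity>")
      case True
      then show ?thesis by (simp add: ennreal_mult_top)
    next
      case False
      then have "emeasure \<mu> (ball x (3 * r)) = ?q * emeasure \<mu> (ball x r)"
        using pos by (simp add: ennreal_divide_times less_top)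
      also have "\<dots> \<le> ennreal (max D 1) * emeasure \<mu> (ball x r)" using q by (rule mult_right_mono) simp
      finally show ?thesis .
    qed
  qed
  have good: "ball_good (max C 1) \<alpha> V (\<lambda>x. padic_norm (lin_form (f x) q))"
    if C: "C > 0" "\<alpha> > 0" "\<And>c0 c. good_on C \<alpha> \<mu> V (\<lambda>x. c0 + (\<Sum>i\<in>UNIV. c $ i * f x $ i))" for C \<alpha> V q
    unfolding ball_good_def mb
  proof (intro ballI allI impI)
    fix x r z \<epsilon> assume x: "x \<in> supp" and r: "0 < (r::real)" "ball x r \<subseteq> V" and z: "z \<in> ball x r \<inter> supp"
      and \<epsilon>: "0 < (\<epsilon>::real)" and fz: "0 < padic_norm (lin_form (f z) q)"
    let ?g = "\<lambda>x. lin_form (f x) q" and ?B = "emeasure \<mu> (ball x r)"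
    have g: "?g = (\<lambda>x. of_int (q $ None) + (\<Sum>i\<in>UNIV. (\<chi> i. of_int (q $ Some i)) $ i * f x $ i))"
      by (simp add: lin_form_def)
    have "good_on C \<alpha> \<mu> V ?g" unfolding g by (rule C(3))
    then have "emeasure \<mu> {y \<in> ball x r. padic_norm (?g y) < \<epsilon>}
        \<le> ennreal C * ennreal_powr (ennreal \<epsilon> / sup_norm_on \<mu> (ball x r) ?g) \<alpha> * ?B"
      using x r \<epsilon> supp unfolding good_on_def by blast
    also have "\<dots> \<le> ennreal (max C 1 * (\<epsilon> / padic_norm (?g z)) powr \<alpha>) * ?B"
    proof (rule mult_right_mono)
      \<comment> \<open>Passing from the essential supremum to the value at \<open>z\<close> can
        only enlarge the quotient; an infinite supremum gives quotient 0.\<close>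
      have sup: "ennreal (padic_norm (?g z)) \<le> sup_norm_on \<mu> (ball x r) ?g"
        using z supp by (intro sup_norm_on_ge lc) auto
      have nz: "?g z \<noteq> 0" using fz by auto
      have "ennreal \<epsilon> = ennreal (\<epsilon> / padic_norm (?g z)) * ennreal (padic_norm (?g z))"
        using \<epsilon> nz by (simp add: ennreal_mult[symmetric])
      also have "\<dots> \<le> ennreal (\<epsilon> / padic_norm (?g z)) * sup_norm_on \<mu> (ball x r) ?g"
        using sup by (rule mult_left_mono) simp
      finally have "ennreal \<epsilon> \<le> sup_norm_on \<mu> (ball x r) ?g * ennreal (\<epsilon> / padic_norm (?g z))"
        by (simp only: mult.commute)
      moreover have "0 < sup_norm_on \<mu> (ball x r) ?g" using sup nz by (auto intro!: less_le_trans[OF _ sup] simp: less_le)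
      ultimately have le: "ennreal \<epsilon> / sup_norm_on \<mu> (ball x r) ?g \<le> ennreal (\<epsilon> / padic_norm (?g z))"
        by (intro divide_le_posI_ennreal)
      then have "ennreal \<epsilon> / sup_norm_on \<mu> (ball x r) ?g \<noteq> \<infinity>" by (auto simp: top_unique)
      moreover have "enn2real (ennreal \<epsilon> / sup_norm_on \<mu> (ball x r) ?g) \<le> \<epsilon> / padic_norm (?g z)"
        using le \<epsilon> fz by (intro enn2real_leI) auto
      ultimately have "ennreal_powr (ennreal \<epsilon> / sup_norm_on \<mu> (ball x r) ?g) \<alpha> \<le> ennreal ((\<epsilon> / padic_norm (?g z)) powr \<alpha>)"
        unfolding ennreal_powr_def using C(2) by (auto intro!: ennreal_leI powr_mono2)
      then have "ennreal C * ennreal_powr (ennreal \<epsilon> / sup_norm_on \<mu> (ball x r) ?g) \<alpha>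
          \<le> ennreal (max C 1) * ennreal ((\<epsilon> / padic_norm (?g z)) powr \<alpha>)"
        by (intro mult_mono ennreal_leI) auto
      then show "ennreal C * ennreal_powr (ennreal \<epsilon> / sup_norm_on \<mu> (ball x r) ?g) \<alpha>
          \<le> ennreal (max C 1 * (\<epsilon> / padic_norm (?g z)) powr \<alpha>)" by (simp add: ennreal_mult)
    qed simp
    finally show "emeasure \<mu> {y \<in> ball x r. padic_norm (?g y) < \<epsilon>}
        \<le> ennreal (max C 1 * (\<epsilon> / padic_norm (?g z)) powr \<alpha>) * ?B" .
  qed
  have loc: "AE x in \<mu>. locally_good (\<lambda>x. lin_form (f x)) x"
    using assms(4)[unfolded federer_def] assms(8)[unfolded good_pair_def]
  proof eventually_elim
    case (elim x)
    then obtain U D V C \<alpha> where U: "x \<in> U" "D > 0" "federer_on D \<mu> U"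
      and V: "open V" "x \<in> V" "C > 0" "\<alpha> > 0"
        "\<And>c0 c. good_on C \<alpha> \<mu> V (\<lambda>x. c0 + (\<Sum>i\<in>UNIV. c $ i * f x $ i))" by blast
    obtain W where W: "open W" "x \<in> W" "emeasure \<mu> W < \<infinity>" using locally_finite by blast
    have "open (U \<inter> V \<inter> W)" using U(3) V(1) W(1) by (auto simp: federer_on_def)
    then obtain R0 where R0: "R0 > 0" "ball x R0 \<subseteq> U \<inter> V \<inter> W"
      using open_contains_ball[of "U \<inter> V \<inter> W"] U(1) V(2) W(2) by blast
    have "emeasure \<mu> (Met_TC.mball x R0) \<le> emeasure \<mu> W" unfolding mb using R0(2) opn[OF W(1)] by (intro emeasure_mono) auto
    then have "emeasure \<mu> (Met_TC.mball x R0) < \<infinity>" using W(3) by (rule le_less_trans)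
    moreover have "ball_doubling (max D 1) (Met_TC.mball x R0)"
      using dbl[OF U(2,3)] by (rule ball_doubling_mono) (use R0(2) mb in auto)
    moreover have "ball_good (max C 1) \<alpha> (Met_TC.mball x R0) (\<lambda>x. padic_norm (lin_form (f x) q))" for q
      using good[OF V(3,4,5)] by (rule ball_good_mono) (use R0(2) mb in auto)
    ultimately show ?case unfolding locally_good_def using R0(1) V(4) by (intro exI[of _ R0] exI[of _ "max C 1"] exI[of _ \<alpha>] exI[of _ "max D 1"]) auto
  qed
  have dom: "L \<subseteq> dominated (f ` (Met_TC.mball x r \<inter> supp))" if x: "x \<in> supp" and r: "r > 0" for x r
  proof -
    have "emeasure \<mu> (ball x r) > 0" using x r by (simp add: supp_def mb)
    then have eq: "L = affine_span (f ` (ball x r \<inter> msupport \<mu>))"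
      using assms(9)[unfolded nonplanar_in_def, rule_format, of "ball x r"] r by simp
    have "x \<in> ball x r \<inter> msupport \<mu>" using x r supp by simp
    then have "f ` (ball x r \<inter> msupport \<mu>) \<noteq> {}" by blast
    then have "affine_span (f ` (ball x r \<inter> msupport \<mu>)) \<subseteq> dominated (f ` (ball x r \<inter> msupport \<mu>))"
      by (rule affine_span_subset_dominated)
    then have "L \<subseteq> dominated (f ` (ball x r \<inter> msupport \<mu>))" by (subst eq)
    then show ?thesis by (simp only: mb supp)
  qed
  have "f ` UNIV \<subseteq> L" using assms(6) .
  note eq = measure_exponent_eq[OF f assms(3) this meas usc loc dom]
  show ?thesis unfolding supp[symmetric] affine_exponent_eq[OF assms(5)] using eq by blast
qed

end
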